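(* Let $V$ be a 2-dimensional vector space over $k$. If $\mathsf w\in\operatorname{Sym}^4V$ is a Calabi-Yau superpotential (i.e. $J(\mathsf w)$ is 3-dimensional Calabi-Yau), then $J(\mathsf w)$ is isomorphic to $A(M_1,M_2)$ for some $M_1,M_2\in M_2(k)$.
   Context: $k$ is an algebraically closed field of characteristic $0$. $\operatorname{Sym}^4V=\{\mathsf w\in V^{\otimes4}\mid\theta(\mathsf w)=\mathsf w\text{ for all }\theta\in\mathfrak S_4\}$, where $\mathfrak S_4$ permutes tensor factors; such $\mathsf w$ are superpotentials, i.e. invariant under cyclic permutation. With a basis $x,y$ of $V$, for a superpotential $\mathsf w$ the Jacobian algebra is $J(\mathsf w)=k\langle x,y\rangle/(\partial_x\mathsf w,\partial_y\mathsf w)$, where $\partial_x$ removes an initial letter $x$ from a word (giving $0$ if the word does not start with $x$), similarly $\partial_y$, extended linearly. For matrices $M_1,\dots,M_n\in M_n(k)$, $A(M_1,\dots,M_n)$ is the graded algebra generated by $x_1,\dots,x_n,y_1,\dots,y_n$ with $\deg x_i=1$, $\deg y_i=3$, subject to the relations $$x_ix_j^2+x_jx_ix_j+x_j^2x_i=\sum_{l=1}^n(M_l)_{ij}\,y_l\quad(1\le i,j\le n),\qquad y_1,\dots,y_n\text{ central}.$$ An $\mathbb N$-graded algebra $S$ with $S^e=S^o\otimes S$ is $d$-dimensional Calabi-Yau if $S$ has a finite length resolution by finitely generated graded projective left $S^e$-modules and, for some $\ell\in\mathbb Z$, $\underline{\operatorname{Ext}}^i_{S^e}(S,S^e)\cong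 S(\ell)$ for $i=d$ and $0$ for $i\ne d$, as graded right $S^e$-modules. *)

theory Defs
  imports
    "HOL-Algebra.QuotRing"
    "HOL-Algebra.Module"
    "HOL-Analysis.Finite_Cartesian_Product"
    "HOL-Combinatorics.Permutations"
    "HOL-Computational_Algebra.Polynomial"
    "HOL-Library.Numeral_Type"
    "HOL-Library.Poly_Mapping"
begin

hide_const (open) Multiset.mult Polynomial.smult

section \<open>Graded algebras and graded modules\<close>

text \<open>
  One record serves for graded algebras over a field (scalars: all of the field type), for graded
  left modules and for graded right modules over a noncommutative ring \<open>E\<close> (scalars:
  the carrier of \<open>E\<close>). For a right module, \<open>smult M e x\<close> stands for
  \<open>x \<cdot> e\<close>. The fields \<open>mult\<close> and \<open>one\<close> are
  meaningless for modules, as in \<^theory>\<open>HOL-Algebra.Module\<close>.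
\<close>

record ('s, 'm) graded = "('s, 'm) module" +
  homog :: "int \<Rightarrow> 'm set"

definition graded_decomposition :: "('s, 'm) graded \<Rightarrow> bool" where
  "graded_decomposition M \<longleftrightarrow>
     (\<forall>n. additive_subgroup (homog M n) M) \<and>
     (\<forall>x \<in> carrier M. \<exists>!f. (\<forall>n. f n \<in> homog M n) \<and> finite {n. f n \<noteq> \<zero>\<^bsub>M\<^esub>} \<and>
        x = finsum M f {n. f n \<noteq> \<zero>\<^bsub>M\<^esub>})"

locale graded_algebra = ring S for S :: "('k::field, 'a) graded" (structure) +
  assumes smult_closed: "x \<in> carrier S \<Longrightarrow> c \<odot> x \<in> carrier S"
    and smult_l_distr: "x \<in> carrier S \<Longrightarrow> (c + c') \<odot> x = c \<odot> x \<oplus> c' \<odot> x"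
    and smult_r_distr: "x \<in> carrier S \<Longrightarrow> y \<in> carrier S \<Longrightarrow> c \<odot> (x \<oplus> y) = c \<odot> x \<oplus> c \<odot> y"
    and smult_assoc: "x \<in> carrier S \<Longrightarrow> (c * c') \<odot> x = c \<odot> (c' \<odot> x)"
    and smult_one: "x \<in> carrier S \<Longrightarrow> 1 \<odot> x = x"
    and smult_mult_l: "x \<in> carrier S \<Longrightarrow> y \<in> carrier S \<Longrightarrow> (c \<odot> x) \<otimes> y = c \<odot> (x \<otimes> y)"
    and smult_mult_r: "x \<in> carrier S \<Longrightarrow> y \<in> carrier S \<Longrightarrow> x \<otimes> (c \<odot> y) = c \<odot> (x \<otimes> y)"
    and graded: "graded_decomposition S"
    and homog_smult: "x \<in> homog S n \<Longrightarrow> c \<odot> x \<in> homog S n"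
    and homog_one: "\<one> \<in> homog S 0"
    and homog_mult: "x \<in> homog S m \<Longrightarrow> y \<in> homog S n \<Longrightarrow> x \<otimes> y \<in> homog S (m + n)"

locale nat_graded_algebra = graded_algebra +
  assumes homog_neg: "n < 0 \<Longrightarrow> homog S n = {\<zero>}"

locale graded_left_module = abelian_group P
  for E :: "('k, 'e) graded" and P :: "('e, 'm) graded" (structure) +
  assumes smult_closed: "e \<in> carrier E \<Longrightarrow> x \<in> carrier P \<Longrightarrow> e \<odot> x \<in> carrier P"
    and smult_l_distr: "e \<in> carrier E \<Longrightarrow> e' \<in> carrier E \<Longrightarrow> x \<in> carrier P \<Longrightarrow>
      (e \<oplus>\<^bsub>E\<^esub> e') \<odot> x = e \<odot> x \<oplus> e' \<odot> x"
    and smult_r_distr: "e \<in> carrier E \<Longrightarrow> x \<in> carrier P \<Longrightarrow> y \<in> carrier P \<Longrightarrow>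
      e \<odot> (x \<oplus> y) = e \<odot> x \<oplus> e \<odot> y"
    and smult_assoc: "e \<in> carrier E \<Longrightarrow> e' \<in> carrier E \<Longrightarrow> x \<in> carrier P \<Longrightarrow>
      (e \<otimes>\<^bsub>E\<^esub> e') \<odot> x = e \<odot> (e' \<odot> x)"
    and smult_one: "x \<in> carrier P \<Longrightarrow> \<one>\<^bsub>E\<^esub> \<odot> x = x"
    and graded: "graded_decomposition P"
    and homog_smult: "e \<in> homog E m \<Longrightarrow> x \<in> homog P n \<Longrightarrow> e \<odot> x \<in> homog P (m + n)"

definition shift :: "('s, 'm) graded \<Rightarrow> int \<Rightarrow> ('s, 'm) graded" where
  "shift M l = M\<lparr>homog := (\<lambda>n. homog M (n + l))\<rparr>"

definition graded_alg_iso :: "('k::field, 'a) graded \<Rightarrow> ('k, 'b) graded \<Rightarrow> bool" where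
  "graded_alg_iso A B \<longleftrightarrow>
     (\<exists>\<phi> \<in> ring_iso A B.
        (\<forall>c. \<forall>x \<in> carrier A. \<phi> (c \<odot>\<^bsub>A\<^esub> x) = c \<odot>\<^bsub>B\<^esub> \<phi> x) \<and>
        (\<forall>n. \<phi> ` homog A n = homog B n))"

definition graded_hom ::
    "('k, 'e) graded \<Rightarrow> int \<Rightarrow> ('e, 'm) graded \<Rightarrow> ('e, 'n) graded \<Rightarrow> ('m \<Rightarrow> 'n) set" where
  "graded_hom E n M N = {f \<in> carrier M \<rightarrow> carrier N.
     (\<forall>x \<in> carrier M. \<forall>y \<in> carrier M. f (x \<oplus>\<^bsub>M\<^esub> y) = f x \<oplus>\<^bsub>N\<^esub> f y) \<and>
     (\<forall>e \<in> carrier E. \<forall>x \<in> carrier M. f (e \<odot>\<^bsub>M\<^esub> x) = e \<odot>\<^bsub>N\<^esub> f x) \<and>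
     (\<forall>m. f ` homog M m \<subseteq> homog N (m + n))}"

definition graded_module_iso ::
    "('k, 'e) graded \<Rightarrow> ('e, 'm) graded \<Rightarrow> ('e, 'n) graded \<Rightarrow> bool" where
  "graded_module_iso E M N \<longleftrightarrow>
     (\<exists>\<phi> \<in> graded_hom E 0 M N. bij_betw \<phi> (carrier M) (carrier N) \<and>
        (\<forall>n. \<phi> ` homog M n = homog N n))"

section \<open>Quotients and presented algebras\<close>

definition quot_alg :: "('k::field, 'a) graded \<Rightarrow> 'a set \<Rightarrow> ('k, 'a set) graded" where
  "quot_alg A I =
    \<lparr>carrier = carrier (A Quot I), mult = mult (A Quot I), one = one (A Quot I),
     zero = zero (A Quot I), add = add (A Quot I),
     smult = (\<lambda>c X. \<Union>x \<in> X. I +>\<^bsub>A\<^esub> (c \<odot>\<^bsub>A\<^esub> x)),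
     homog = (\<lambda>n. (\<lambda>x. I +>\<^bsub>A\<^esub> x) ` homog A n)\<rparr>"

text \<open>
  Words are wrapped so that concatenation can be their addition; the convolution product of
  \<^theory>\<open>HOL-Library.Poly_Mapping\<close> is then the product of the free algebra.
\<close>

datatype 'g word = Word (letters: "'g list")

instantiation word :: (type) monoid_add
begin

definition zero_word :: "'a word" where "zero_word = Word []"

definition plus_word :: "'a word \<Rightarrow> 'a word \<Rightarrow> 'a word" where
  "plus_word u v = Word (letters u @ letters v)"

instance by standard (simp_all add: zero_word_def plus_word_def)

end

type_synonym ('g, 'k) free_poly = "'g word \<Rightarrow>\<^sub>0 'k"

definition gen :: "'g \<Rightarrow> ('g, 'k::field) free_poly" where
  "gen g = Poly_Mapping.single (Word [g]) 1"

definition const :: "'k::field \<Rightarrow> ('g, 'k) free_poly" where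
  "const c = Poly_Mapping.single 0 c"

definition free_alg :: "('g \<Rightarrow> nat) \<Rightarrow> ('k::field, ('g, 'k) free_poly) graded" where
  "free_alg wt =
    \<lparr>carrier = UNIV, mult = (*), one = 1, zero = 0, add = (+),
     smult = (\<lambda>c p. const c * p),
     homog = (\<lambda>n. {p. \<forall>u \<in> Poly_Mapping.keys p. int (\<Sum>g\<leftarrow>letters u. wt g) = n})\<rparr>"

definition presented_alg ::
    "('g \<Rightarrow> nat) \<Rightarrow> ('g, 'k::field) free_poly set \<Rightarrow> ('k, ('g, 'k) free_poly set) graded" where
  "presented_alg wt R = quot_alg (free_alg wt) (Idl\<^bsub>free_alg wt\<^esub> R)"

section \<open>Jacobian algebras\<close>

text \<open>
  \<open>V\<close> has the basis \<open>X, Y\<close>, and its tensor power $V^{\otimes d}$ is the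
  degree \<open>d\<close> part of the free algebra on \<open>X, Y\<close>.
\<close>

datatype xy = X | Y

definition tensor_power :: "nat \<Rightarrow> (xy, 'k::field) free_poly set" where
  "tensor_power d = {w. \<forall>u \<in> Poly_Mapping.keys w. length (letters u) = d}"

definition permute_factors ::
    "(nat \<Rightarrow> nat) \<Rightarrow> (xy, 'k::field) free_poly \<Rightarrow> (xy, 'k) free_poly" where
  "permute_factors \<theta> w =
     (\<Sum>u \<in> Poly_Mapping.keys w.
        Poly_Mapping.single (Word (permute_list \<theta> (letters u))) (Poly_Mapping.lookup w u))"

definition Sym :: "nat \<Rightarrow> (xy, 'k::field) free_poly set" where
  "Sym d = {w \<in> tensor_power d. \<forall>\<theta>. \<theta> permutes {..<d} \<longrightarrow> permute_factors \<theta> w = w}"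

definition cyclic_deriv :: "xy \<Rightarrow> (xy, 'k::field) free_poly \<Rightarrow> (xy, 'k) free_poly" where
  "cyclic_deriv a w =
     (\<Sum>u \<in> Poly_Mapping.keys w.
        case letters u of
          [] \<Rightarrow> 0
        | b # v \<Rightarrow> if b = a then Poly_Mapping.single (Word v) (Poly_Mapping.lookup w u) else 0)"

definition jacobian_alg ::
    "(xy, 'k::field) free_poly \<Rightarrow> ('k, (xy, 'k) free_poly set) graded" where
  "jacobian_alg w = presented_alg (\<lambda>_. 1) {cyclic_deriv X w, cyclic_deriv Y w}"

section \<open>The algebras \<open>A(M\<^sub>1, \<dots>, M\<^sub>n)\<close>\<close>

datatype 'n gens = XG 'n | YG 'n

fun gens_deg :: "'n gens \<Rightarrow> nat" where
  "gens_deg (XG i) = 1"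
| "gens_deg (YG i) = 3"

definition A_relations :: "('n::finite \<Rightarrow> 'k::field^'n^'n) \<Rightarrow> ('n gens, 'k) free_poly set" where
  "A_relations M =
     {gen (XG i) * gen (XG j) * gen (XG j) + gen (XG j) * gen (XG i) * gen (XG j)
        + gen (XG j) * gen (XG j) * gen (XG i)
        - (\<Sum>l \<in> UNIV. const (M l $ i $ j) * gen (YG l)) | i j. True} \<union>
     {gen (YG l) * gen g - gen g * gen (YG l) | l g. True}"

definition A_alg ::
    "('n::finite \<Rightarrow> 'k::field^'n^'n) \<Rightarrow> ('k, ('n gens, 'k) free_poly set) graded" where
  "A_alg M = presented_alg gens_deg (A_relations M)"

section \<open>The enveloping algebra\<close>

text \<open>
  The tensor product $A \otimes_k B$ is the free vector space on \<open>A \<times> B\<close>, with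
  the product $(a,b)(a',b') = (aa',bb')$, modulo the bilinearity relations. Multiplying one of
  these relations by a pair on either side gives such a relation again, so the ideal they
  generate is the subspace they span.
\<close>

definition pair_alg ::
    "('k::field, 'a) graded \<Rightarrow> ('k, 'b) graded \<Rightarrow> ('k, ('a \<times> 'b) \<Rightarrow>\<^sub>0 'k) graded" where
  "pair_alg A B =
    \<lparr>carrier = {p. Poly_Mapping.keys p \<subseteq> carrier A \<times> carrier B},
     mult = (\<lambda>p q. \<Sum>(a, b) \<in> Poly_Mapping.keys p. \<Sum>(a', b') \<in> Poly_Mapping.keys q.
       Poly_Mapping.single (a \<otimes>\<^bsub>A\<^esub> a', b \<otimes>\<^bsub>B\<^esub> b')
         (Poly_Mapping.lookup p (a, b) * Poly_Mapping.lookup q (a', b'))),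
     one = Poly_Mapping.single (\<one>\<^bsub>A\<^esub>, \<one>\<^bsub>B\<^esub>) 1, zero = 0, add = (+),
     smult = (\<lambda>c. Poly_Mapping.map ((*) c)),
     homog = (\<lambda>n. {p. \<forall>(a, b) \<in> Poly_Mapping.keys p.
       \<exists>i j. a \<in> homog A i \<and> b \<in> homog B j \<and> i + j = n})\<rparr>"

definition bilinearity ::
    "('k::field, 'a) graded \<Rightarrow> ('k, 'b) graded \<Rightarrow> (('a \<times> 'b) \<Rightarrow>\<^sub>0 'k) set" where
  "bilinearity A B =
     {Poly_Mapping.single (a \<oplus>\<^bsub>A\<^esub> a', b) 1 - Poly_Mapping.single (a, b) 1 - Poly_Mapping.single (a', b) 1
        | a a' b. a \<in> carrier A \<and> a' \<in> carrier A \<and> b \<in> carrier B} \<union>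
     {Poly_Mapping.single (a, b \<oplus>\<^bsub>B\<^esub> b') 1 - Poly_Mapping.single (a, b) 1 - Poly_Mapping.single (a, b') 1
        | a b b'. a \<in> carrier A \<and> b \<in> carrier B \<and> b' \<in> carrier B} \<union>
     {Poly_Mapping.single (c \<odot>\<^bsub>A\<^esub> a, b) 1 - Poly_Mapping.single (a, b) c
        | c a b. a \<in> carrier A \<and> b \<in> carrier B} \<union>
     {Poly_Mapping.single (a, c \<odot>\<^bsub>B\<^esub> b) 1 - Poly_Mapping.single (a, b) c
        | c a b. a \<in> carrier A \<and> b \<in> carrier B}"

definition tensor_alg ::
    "('k::field, 'a) graded \<Rightarrow> ('k, 'b) graded \<Rightarrow> ('k, (('a \<times> 'b) \<Rightarrow>\<^sub>0 'k) set) graded" where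
  "tensor_alg A B = quot_alg (pair_alg A B) (Idl\<^bsub>pair_alg A B\<^esub> (bilinearity A B))"

definition op_alg :: "('k::field, 'a) graded \<Rightarrow> ('k, 'a) graded" where
  "op_alg A = A\<lparr>mult := (\<lambda>a b. b \<otimes>\<^bsub>A\<^esub> a)\<rparr>"

type_synonym ('k, 'a) env_elem = "(('a \<times> 'a) \<Rightarrow>\<^sub>0 'k) set"

definition env_alg :: "('k::field, 'a) graded \<Rightarrow> ('k, ('k, 'a) env_elem) graded" where
  "env_alg S = tensor_alg (op_alg S) S"

text \<open>
  \<open>S\<close> as a left and as a right module over $S^e = S^o \otimes S$: the actions are
  $(a \otimes b) \cdot s = b s a$ and $s \cdot (a \otimes b) = a s b$, evaluated on an arbitrary
  representative.
\<close>

definition env_left :: "('k::field, 'a) graded \<Rightarrow> (('k, 'a) env_elem, 'a) graded" where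
  "env_left S =
    \<lparr>carrier = carrier S, mult = undefined, one = undefined, zero = zero S, add = add S,
     smult = (\<lambda>e s. let p = (SOME p. p \<in> e) in
       finsum S (\<lambda>(a, b). Poly_Mapping.lookup p (a, b) \<odot>\<^bsub>S\<^esub> (b \<otimes>\<^bsub>S\<^esub> s \<otimes>\<^bsub>S\<^esub> a)) (Poly_Mapping.keys p)),
     homog = homog S\<rparr>"

definition env_right :: "('k::field, 'a) graded \<Rightarrow> (('k, 'a) env_elem, 'a) graded" where
  "env_right S =
    \<lparr>carrier = carrier S, mult = undefined, one = undefined, zero = zero S, add = add S,
     smult = (\<lambda>e s. let p = (SOME p. p \<in> e) in
       finsum S (\<lambda>(a, b). Poly_Mapping.lookup p (a, b) \<odot>\<^bsub>S\<^esub> (a \<otimes>\<^bsub>S\<^esub> s \<otimes>\<^bsub>S\<^esub> b)) (Poly_Mapping.keys p)),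
     homog = homog S\<rparr>"

section \<open>Projective resolutions and \<open>Ext\<close>\<close>

definition regular_left :: "('k, 'e) graded \<Rightarrow> ('e, 'e) graded" where
  "regular_left E =
    \<lparr>carrier = carrier E, mult = undefined, one = undefined, zero = zero E, add = add E,
     smult = mult E, homog = homog E\<rparr>"

definition graded_free :: "('k, 'e) graded \<Rightarrow> int list \<Rightarrow> ('e, nat \<Rightarrow> 'e) graded" where
  "graded_free E as =
    \<lparr>carrier = (\<Pi>\<^sub>E i \<in> {..<length as}. carrier E), mult = undefined, one = undefined,
     zero = (\<lambda>i \<in> {..<length as}. \<zero>\<^bsub>E\<^esub>), add = (\<lambda>f g. \<lambda>i \<in> {..<length as}. f i \<oplus>\<^bsub>E\<^esub> g i),
     smult = (\<lambda>e f. \<lambda>i \<in> {..<length as}. e \<otimes>\<^bsub>E\<^esub> f i),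
     homog = (\<lambda>n. \<Pi>\<^sub>E i \<in> {..<length as}. homog E (n + as ! i))\<rparr>"

text \<open>The finitely generated graded projective modules are the graded direct summands of the
  finite direct sums of shifts of \<open>E\<close>.\<close>

definition fg_graded_projective :: "('k, 'e) graded \<Rightarrow> ('e, 'm) graded \<Rightarrow> bool" where
  "fg_graded_projective E P \<longleftrightarrow> graded_left_module E P \<and>
     (\<exists>as. \<exists>i \<in> graded_hom E 0 P (graded_free E as). \<exists>r \<in> graded_hom E 0 (graded_free E as) P.
        \<forall>x \<in> carrier P. r (i x) = x)"

text \<open>
  \<open>\<dots> \<rightarrow> P 2 \<rightarrow> P 1 \<rightarrow> P 0 \<rightarrow> N \<rightarrow> 0\<close>, with differentials
  \<open>\<delta> i : P (i + 1) \<rightarrow> P i\<close> and augmentation \<open>\<epsilon>\<close>. The carrier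
  type \<open>nat \<Rightarrow> 'e\<close> is no restriction, since it contains all direct summands of
  all the modules \<open>graded_free E as\<close>.
\<close>

definition finite_fg_projective_resolution ::
    "('k, 'e) graded \<Rightarrow> ('e, 'm) graded \<Rightarrow> (nat \<Rightarrow> ('e, nat \<Rightarrow> 'e) graded) \<Rightarrow>
     (nat \<Rightarrow> (nat \<Rightarrow> 'e) \<Rightarrow> (nat \<Rightarrow> 'e)) \<Rightarrow> ((nat \<Rightarrow> 'e) \<Rightarrow> 'm) \<Rightarrow> bool" where
  "finite_fg_projective_resolution E N P \<delta> \<epsilon> \<longleftrightarrow>
     (\<forall>i. fg_graded_projective E (P i)) \<and>
     (\<exists>l. \<forall>i > l. carrier (P i) = {\<zero>\<^bsub>P i\<^esub>}) \<and>
     (\<forall>i. \<delta> i \<in> graded_hom E 0 (P (Suc i)) (P i)) \<and>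
     \<epsilon> \<in> graded_hom E 0 (P 0) N \<and>
     \<epsilon> ` carrier (P 0) = carrier N \<and>
     {x \<in> carrier (P 0). \<epsilon> x = \<zero>\<^bsub>N\<^esub>} = \<delta> 0 ` carrier (P 1) \<and>
     (\<forall>i. {x \<in> carrier (P (Suc i)). \<delta> i x = \<zero>\<^bsub>P i\<^esub>} = \<delta> (Suc i) ` carrier (P (Suc (Suc i))))"

text \<open>
  \<open>graded_dual E P\<close> is the graded Hom module
  $\bigoplus_n \mathrm{Hom}_E(P, E(n))_0$ as a right \<open>E\<close>-module, through the right
  multiplication of \<open>E\<close>. Its elements are the finite sums of homogeneous
  homomorphisms, cut off outside the carrier of \<open>P\<close>.
\<close>

definition graded_dual ::
    "('k, 'e) graded \<Rightarrow> ('e, 'm) graded \<Rightarrow> ('e, 'm \<Rightarrow> 'e) graded" where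
  "graded_dual E P =
    \<lparr>carrier = {f. \<exists>F g. finite F \<and> (\<forall>n \<in> F. g n \<in> graded_hom E n P (regular_left E)) \<and>
       f = (\<lambda>x \<in> carrier P. finsum E (\<lambda>n. g n x) F)},
     mult = undefined, one = undefined,
     zero = (\<lambda>x \<in> carrier P. \<zero>\<^bsub>E\<^esub>), add = (\<lambda>f g. \<lambda>x \<in> carrier P. f x \<oplus>\<^bsub>E\<^esub> g x),
     smult = (\<lambda>e f. \<lambda>x \<in> carrier P. f x \<otimes>\<^bsub>E\<^esub> e),
     homog = (\<lambda>n. graded_hom E n P (regular_left E) \<inter> extensional (carrier P))\<rparr>"

definition cocycles ::
    "('k, 'e) graded \<Rightarrow> (nat \<Rightarrow> ('e, 'm) graded) \<Rightarrow> (nat \<Rightarrow> 'm \<Rightarrow> 'm) \<Rightarrow> nat \<Rightarrow> ('m \<Rightarrow> 'e) set" where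
  "cocycles E P \<delta> i =
     {f \<in> carrier (graded_dual E (P i)). \<forall>x \<in> carrier (P (Suc i)). f (\<delta> i x) = \<zero>\<^bsub>E\<^esub>}"

fun coboundaries ::
    "('k, 'e) graded \<Rightarrow> (nat \<Rightarrow> ('e, 'm) graded) \<Rightarrow> (nat \<Rightarrow> 'm \<Rightarrow> 'm) \<Rightarrow> nat \<Rightarrow> ('m \<Rightarrow> 'e) set" where
  "coboundaries E P \<delta> 0 = {\<zero>\<^bsub>graded_dual E (P 0)\<^esub>}"
| "coboundaries E P \<delta> (Suc i) =
     (\<lambda>f. \<lambda>x \<in> carrier (P (Suc i)). f (\<delta> i x)) ` carrier (graded_dual E (P i))"

definition subquotient :: "('s, 'm) graded \<Rightarrow> 'm set \<Rightarrow> 'm set \<Rightarrow> ('s, 'm set) graded" where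
  "subquotient M Z B =
    \<lparr>carrier = (\<lambda>z. B +>\<^bsub>M\<^esub> z) ` Z, mult = undefined, one = undefined,
     zero = B, add = set_add M, smult = (\<lambda>e C. \<Union>z \<in> C. B +>\<^bsub>M\<^esub> (e \<odot>\<^bsub>M\<^esub> z)),
     homog = (\<lambda>n. (\<lambda>z. B +>\<^bsub>M\<^esub> z) ` (Z \<inter> homog M n))\<rparr>"

text \<open>The graded right \<open>E\<close>-module $\underline{\mathrm{Ext}}^i_E(N, E)$, computed from a
  resolution \<open>P, \<delta>\<close> of \<open>N\<close>.\<close>

definition graded_Ext ::
    "('k, 'e) graded \<Rightarrow> (nat \<Rightarrow> ('e, 'm) graded) \<Rightarrow> (nat \<Rightarrow> 'm \<Rightarrow> 'm) \<Rightarrow> nat \<Rightarrow>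
     ('e, ('m \<Rightarrow> 'e) set) graded" where
  "graded_Ext E P \<delta> i =
     subquotient (graded_dual E (P i)) (cocycles E P \<delta> i) (coboundaries E P \<delta> i)"

text \<open>As \<open>Ext\<close> does not depend on the resolution, it is read off from the finite one
  whose existence is part of the definition.\<close>

definition calabi_yau :: "nat \<Rightarrow> ('k::field, 'a) graded \<Rightarrow> bool" where
  "calabi_yau d S \<longleftrightarrow> nat_graded_algebra S \<and>
     (\<exists>P \<delta> \<epsilon>. finite_fg_projective_resolution (env_alg S) (env_left S) P \<delta> \<epsilon> \<and>
        (\<exists>l. graded_module_iso (env_alg S) (graded_Ext (env_alg S) P \<delta> d) (shift (env_right S) l)) \<and>
        (\<forall>i. i \<noteq> d \<longrightarrow>
           carrier (graded_Ext (env_alg S) P \<delta> i) = {\<zero>\<^bsub>graded_Ext (env_alg S) P \<delta> i\<^esub>}))"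

end

theory Submission
  imports Defs "HOL-Analysis.Cartesian_Space"
begin

text \<open>
  Write \<open>a\<^sub>i\<close> for the coefficient of \<open>w\<close> at the words with \<open>i\<close> letters \<open>y\<close>, and \<open>s\<^sub>i\<close> for the sum of the
  words of length 3 with \<open>i\<close> letters \<open>y\<close>. The relations of \<open>J(w)\<close> are \<open>\<Sum> a\<^sub>i s\<^sub>i\<close> and \<open>\<Sum> a\<^sub>i\<^sub>+\<^sub>1 s\<^sub>i\<close>.

  If the Hankel determinant of \<open>(a\<^sub>i\<^sub>+\<^sub>j)\<close> is nonzero, commuting the relations with \<open>x\<close> and \<open>y\<close> shows that
  all \<open>s\<^sub>i\<close> are central in \<open>J(w)\<close>; they span a plane, and a basis of it serves as \<open>y\<^sub>1, y\<^sub>2\<close>.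

  If the determinant vanishes and \<open>w \<noteq> 0\<close>, then \<open>w\<close> is apolar to a binary quadric, so for suitable
  independent linear forms \<open>z, z'\<close> the relations are \<open>z\<^sup>3\<close> and \<open>\<beta> z'\<^sup>3\<close>, or \<open>z\<^sup>3\<close> and
  \<open>z z z' + z z' z + z' z z\<close>. In both cases \<open>J(w)\<close> is free over the subalgebra $B = k[z]/(z^3)$. On free
  \<open>J(w)\<^sup>e\<close>-modules the operators \<open>d = 1 \<otimes> z - z \<otimes> 1\<close> and \<open>e = 1 \<otimes> z\<^sup>2 + z \<otimes> z + z\<^sup>2 \<otimes> 1\<close> have
  \<open>ker d = im e\<close> and \<open>ker e = im d\<close> (the periodic resolution of \<open>B\<close> over \<open>B\<^sup>e\<close>), and this passes to every
  module with a finite projective resolution. It fails for \<open>J(w)\<close>, where \<open>1 \<in> ker d\<close> but \<open>1 \<notin> im e\<close>.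

  If \<open>w = 0\<close>, then \<open>J(w)\<close> is free, and a free algebra has outer derivations into \<open>J(w)\<^sup>e\<close>, so that
  \<open>Ext\<^sup>1(J(w), J(w)\<^sup>e) \<noteq> 0\<close>.
\<close>

text \<open>The argument with \<open>d\<close> and \<open>e\<close> works because module
  homomorphisms commute with these operators. Hence the vanishing of the homology of the periodic
  complex with maps \<open>d, e, d, ...\<close> is inherited by direct summands and, by dimension
  shifting, moves along a resolution; finite length provides the start, a zero module. No normal
  forms of J(w) are computed. Freeness over B is used only through one map, the coefficient of z^2,
  which is obtained by letting the free algebra act on triples. A quadric apolar to w is a linear
  recurrence of order two for the \<open>a\<^sub>i\<close>. Its characteristic roots, possibly
  infinite, give the linear forms, and the relation with mixed words arises from a double root.
  Characteristic 0 enters because the relations of A(M_1, M_2) with i = j read 3 x_i^3 = ..., so 3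
  has to be inverted. The enveloping algebra is a record of cosets of formal sums, not a type with
  operations. Maps out of it are therefore defined on formal sums and shown to respect the
  bilinearity relations.\<close>

definition lin_ext :: "('a \<Rightarrow> 'b \<Rightarrow> 'c) \<Rightarrow> ('a \<Rightarrow>\<^sub>0 'b::zero) \<Rightarrow> 'c::comm_monoid_add" where
  "lin_ext h p = (\<Sum>u\<in>Poly_Mapping.keys p. h u (Poly_Mapping.lookup p u))"

lemma poly_mapping_sum_singles:
  "p = (\<Sum>u\<in>Poly_Mapping.keys p. Poly_Mapping.single u (Poly_Mapping.lookup p u))"
  for p :: "'a \<Rightarrow>\<^sub>0 'b::comm_monoid_add"
  by (rule poly_mapping_eqI)
     (auto simp: lookup_sum lookup_single when_def sum.delta in_keys_iff)

text \<open>The \<open>single\<close> case ranges only over keys of the given \<open>p\<close>.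
  Conditions on its support, such as homogeneity or lying in a carrier, thus enter the induction
  without being part of the predicate.\<close>

lemma poly_mapping_additive_induct [case_names zero single add]:
  fixes p :: "'a \<Rightarrow>\<^sub>0 'b::comm_monoid_add"
  assumes "P 0" and "\<And>u c. u \<in> Poly_Mapping.keys p \<Longrightarrow> P (Poly_Mapping.single u c)"
    and "\<And>p q. P p \<Longrightarrow> P q \<Longrightarrow> P (p + q)"
  shows "P p"
proof -
  have "P (\<Sum>u\<in>A. Poly_Mapping.single u (Poly_Mapping.lookup p u))"
    if "finite A" "A \<subseteq> Poly_Mapping.keys p" for A
    using that by (induction A) (auto intro: assms)
  from this[of "Poly_Mapping.keys p"] show ?thesis
    using poly_mapping_sum_singles[of p] by simp
qed

text \<open>The coefficient is an argument of \<open>h\<close>, not a scalar factor, so the target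
  needs an addition but no scalar multiplication. Additivity in it makes \<open>lin_ext h\<close>
  additive even when keys of a sum cancel.\<close>

locale coefficient_additive =
  fixes h :: "'a \<Rightarrow> 'b::comm_monoid_add \<Rightarrow> 'c::comm_monoid_add"
  assumes zero: "h u 0 = 0" and add: "h u (b + c) = h u b + h u c"
begin

lemma superset:
  assumes "finite A" "Poly_Mapping.keys p \<subseteq> A"
  shows "lin_ext h p = (\<Sum>u\<in>A. h u (Poly_Mapping.lookup p u))"
  unfolding lin_ext_def
  by (rule sum.mono_neutral_left) (use assms in \<open>auto simp: in_keys_iff zero\<close>)

lemma lin_ext_add: "lin_ext h (p + q) = lin_ext h p + lin_ext h q"
proof -
  let ?A = "Poly_Mapping.keys p \<union> Poly_Mapping.keys q"
  have "lin_ext h (p + q) = (\<Sum>u\<in>?A. h u (Poly_Mapping.lookup (p + q) u))"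
    by (rule superset) (use keys_add[of p q] in auto)
  moreover have "lin_ext h p = (\<Sum>u\<in>?A. h u (Poly_Mapping.lookup p u))"
    "lin_ext h q = (\<Sum>u\<in>?A. h u (Poly_Mapping.lookup q u))"
    by (rule superset; auto)+
  ultimately show ?thesis by (simp add: lookup_add add sum.distrib)
qed

lemma lin_ext_zero [simp]: "lin_ext h 0 = 0"
  by (simp add: lin_ext_def)

lemma lin_ext_single [simp]: "lin_ext h (Poly_Mapping.single u c) = h u c"
  by (simp add: lin_ext_def zero)

end

lemma additive_uminus:
  fixes f :: "'a::ab_group_add \<Rightarrow> 'b::ab_group_add"
  assumes "\<And>p q. f (p + q) = f p + f q" shows "f (- p) = - f p"
proof -
  have "f 0 = 0" using assms[of 0 0] by simp
  then show ?thesis using assms[of p "-p"] by (simp add: eq_neg_iff_add_eq_0 add.commute)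
qed

lemma additive_diff:
  fixes f :: "'a::ab_group_add \<Rightarrow> 'b::ab_group_add"
  assumes "\<And>p q. f (p + q) = f p + f q" shows "f (p - q) = f p - f q"
  using assms[of p "-q"] additive_uminus[of f q, OF assms] by simp

section \<open>Quotient algebras\<close>

text \<open>\<open>quot_alg\<close> lists the operations of \<open>A Quot I\<close> again in a
  record with scalars and grading. The ring axioms see only the five ring fields and pass between
  such records.\<close>

lemma ring_cong_fields:
  assumes "ring R" "carrier R' = carrier R" "mult R' = mult R" "one R' = one R"
    "zero R' = zero R" "add R' = add R"
  shows "ring R'"
proof -
  interpret ring R by fact
  show ?thesis
  proof (rule ringI)
    show "abelian_group R'"
    proof (rule abelian_groupI)
      fix x assume "x \<in> carrier R'"
      then show "\<exists>y\<in>carrier R'. y \<oplus>\<^bsub>R'\<^esub> x = \<zero>\<^bsub>R'\<^esub>"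
        using assms l_neg by auto
    qed (use assms a_assoc a_comm in auto)
    show "monoid R'"
      by (rule monoidI) (use assms m_assoc in auto)
  qed (use assms l_distr r_distr in auto)
qed

locale algebra_ideal = ideal I A for I and A :: "('k::field, 'a) graded" (structure) +
  assumes smult_closed: "x \<in> carrier A \<Longrightarrow> c \<odot> x \<in> carrier A"
    and smult_add: "x \<in> carrier A \<Longrightarrow> y \<in> carrier A \<Longrightarrow> c \<odot> (x \<oplus> y) = c \<odot> x \<oplus> c \<odot> y"
    and smult_ideal: "x \<in> I \<Longrightarrow> c \<odot> x \<in> I"
begin

lemma quot_alg_carrier: "carrier (quot_alg A I) = (\<lambda>x. I +> x) ` carrier A"
  by (auto simp: quot_alg_def FactRing_simps)

lemma quot_alg_add:
  "x \<in> carrier A \<Longrightarrow> y \<in> carrier A \<Longrightarrow> (I +> x) \<oplus>\<^bsub>quot_alg A I\<^esub> (I +> y) = I +> (x \<oplus> y)"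
  by (simp add: quot_alg_def FactRing_def a_rcos_sum)

lemma quot_alg_mult:
  "x \<in> carrier A \<Longrightarrow> y \<in> carrier A \<Longrightarrow> (I +> x) \<otimes>\<^bsub>quot_alg A I\<^esub> (I +> y) = I +> (x \<otimes> y)"
  by (simp add: quot_alg_def FactRing_def rcoset_mult_add)

lemma quot_alg_one: "\<one>\<^bsub>quot_alg A I\<^esub> = I +> \<one>"
  by (simp add: quot_alg_def FactRing_def)

lemma quot_alg_zero: "\<zero>\<^bsub>quot_alg A I\<^esub> = I +> \<zero>"
  using a_rcos_const[of \<zero>] additive_subgroup.zero_closed[OF additive_subgroup_axioms]
  by (simp add: quot_alg_def FactRing_def)

lemma coset_eq_iff:
  "x \<in> carrier A \<Longrightarrow> y \<in> carrier A \<Longrightarrow> I +> x = I +> y \<longleftrightarrow> x \<ominus> y \<in> I"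
  using quotient_eq_iff_same_a_r_cos[OF ideal_axioms] by simp

text \<open>All members of the union that defines the scalar multiple are one coset: if y = i + x
  with i in I, then c y and c x differ by c i, which lies in I.\<close>

lemma quot_alg_smult:
  assumes "x \<in> carrier A"
  shows "c \<odot>\<^bsub>quot_alg A I\<^esub> (I +> x) = I +> (c \<odot> x)"
proof -
  have "I +> (c \<odot> y) = I +> (c \<odot> x)" if y: "y \<in> I +> x" for y
  proof -
    obtain i where i: "i \<in> I" "y = i \<oplus> x"
      using y by (auto simp: a_r_coset_def r_coset_def)
    have ic: "i \<in> carrier A" using i(1) by (rule a_Hcarr)
    have "c \<odot> y \<ominus> c \<odot> x = c \<odot> i"
      unfolding i(2) smult_add[OF ic assms] a_minus_def
      using ic assms by (simp add: smult_closed a_assoc r_neg)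
    moreover have "y \<in> carrier A" unfolding i(2) using ic assms by (rule add.m_closed)
    ultimately show ?thesis
      using i(1) assms by (simp add: coset_eq_iff smult_closed smult_ideal)
  qed
  moreover have "x \<in> I +> x" using assms by (rule a_rcos_self)
  ultimately have "(\<Union>y\<in>I +> x. I +> (c \<odot> y)) = I +> (c \<odot> x)"
    by (intro SUP_eq_const) blast+
  then show ?thesis by (simp add: quot_alg_def)
qed

lemma quot_alg_homog: "homog (quot_alg A I) n = (\<lambda>x. I +> x) ` homog A n"
  by (simp add: quot_alg_def)

end

section \<open>Presented algebras\<close>

lemma const_zero [simp]: "const 0 = 0" by (simp add: const_def)
lemma const_one [simp]: "const 1 = 1" by (simp add: const_def)
lemma const_add: "const (a + b) = const a + const b" by (simp add: const_def single_add)
lemma const_mult: "const (a * b) = const a * const b" by (simp add: const_def mult_single)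
lemma const_diff: "const (a - b) = const a - const b" by (simp add: const_def single_diff)

lemma const_commute: "const c * p = p * const c"
proof (induction p rule: poly_mapping_additive_induct)
  case (single u d) then show ?case by (simp add: const_def mult_single mult.commute)
qed (simp_all add: distrib_left distrib_right)

lemma free_alg_simps [simp]:
  "carrier (free_alg wt) = UNIV" "mult (free_alg wt) = (*)" "one (free_alg wt) = 1"
  "zero (free_alg wt) = 0" "add (free_alg wt) = (+)"
  "smult (free_alg wt) = (\<lambda>c p. const c * p)"
  by (simp_all add: free_alg_def)

lemma free_alg_ring: "ring (free_alg wt)"
proof (rule ringI)
  show "abelian_group (free_alg wt)"
  proof (rule abelian_groupI)
    fix x assume "x \<in> carrier (free_alg wt)"
    show "\<exists>y\<in>carrier (free_alg wt). y \<oplus>\<^bsub>free_alg wt\<^esub> x = \<zero>\<^bsub>free_alg wt\<^esub>"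
      by (rule bexI[of _ "- x"]) auto
  qed (auto simp: add.assoc add.commute)
  show "monoid (free_alg wt)" by (rule monoidI) (auto simp: mult.assoc)
qed (auto simp: distrib_left distrib_right)

lemma free_alg_minus [simp]:
  "\<ominus>\<^bsub>free_alg wt\<^esub> y = - y" "x \<ominus>\<^bsub>free_alg wt\<^esub> y = x - y"
proof -
  show *: "\<ominus>\<^bsub>free_alg wt\<^esub> y = - y"
  proof (rule abelian_group.minus_equality[OF ring.is_abelian_group[OF free_alg_ring]])
    show "- y \<oplus>\<^bsub>free_alg wt\<^esub> y = \<zero>\<^bsub>free_alg wt\<^esub>" by simp
  qed simp_all
  show "x \<ominus>\<^bsub>free_alg wt\<^esub> y = x - y" unfolding a_minus_def * by simp
qed

text \<open>Ideals of \<open>free_alg wt\<close> expressed on the type itself, hence independent of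
  the weights: the same relations generate the same ideal for every grading. Closure under negation
  comes from multiplication by -1.\<close>

definition two_sided :: "('g, 'k::field) free_poly set \<Rightarrow> bool" where
  "two_sided J \<longleftrightarrow> 0 \<in> J \<and> (\<forall>p\<in>J. \<forall>q\<in>J. p + q \<in> J) \<and> (\<forall>p\<in>J. \<forall>q. q * p \<in> J \<and> p * q \<in> J)"

lemma two_sidedD:
  assumes "two_sided J"
  shows "0 \<in> J" "p \<in> J \<Longrightarrow> q \<in> J \<Longrightarrow> p + q \<in> J" "p \<in> J \<Longrightarrow> q * p \<in> J" "p \<in> J \<Longrightarrow> p * q \<in> J"
    "p \<in> J \<Longrightarrow> - p \<in> J" "p \<in> J \<Longrightarrow> q \<in> J \<Longrightarrow> p - q \<in> J"
proof -
  have a: "\<And>p q. p \<in> J \<Longrightarrow> q * p \<in> J" and b: "\<And>p q. p \<in> J \<Longrightarrow> q \<in> J \<Longrightarrow> p + q \<in> J"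
    using assms by (auto simp: two_sided_def)
  have n: "- p \<in> J" if "p \<in> J" for p using a[OF that, of "-1"] by simp
  show "p \<in> J \<Longrightarrow> - p \<in> J" by (rule n)
  show "p \<in> J \<Longrightarrow> q \<in> J \<Longrightarrow> p - q \<in> J" using b[of p "-q"] n[of q] by simp
qed (use assms in \<open>auto simp: two_sided_def\<close>)

lemma two_sided_iff_ideal: "two_sided J \<longleftrightarrow> ideal J (free_alg wt)"
proof
  assume J: "two_sided J"
  show "ideal J (free_alg wt)"
  proof (rule idealI[OF free_alg_ring])
    show "subgroup J (add_monoid (free_alg wt))"
    proof
      fix x assume "x \<in> J"
      interpret ring "free_alg wt" by (rule free_alg_ring)
      have "inv\<^bsub>add_monoid (free_alg wt)\<^esub> x = - x"
        using free_alg_minus(1) by (metis a_inv_def)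
      then show "inv\<^bsub>add_monoid (free_alg wt)\<^esub> x \<in> J" using \<open>x \<in> J\<close> two_sidedD[OF J] by auto
    qed (use two_sidedD[OF J] in auto)
  qed (use two_sidedD[OF J] in auto)
next
  assume "ideal J (free_alg wt)"
  then interpret ideal J "free_alg wt" .
  show "two_sided J"
    using additive_subgroup.zero_closed[OF additive_subgroup_axioms] I_l_closed I_r_closed
      additive_subgroup.a_closed[OF additive_subgroup_axioms]
    by (auto simp: two_sided_def)
qed

definition rel_ideal :: "('g, 'k::field) free_poly set \<Rightarrow> ('g, 'k) free_poly set" where
  "rel_ideal R = \<Inter>{J. two_sided J \<and> R \<subseteq> J}"

lemma Idl_free_alg: "Idl\<^bsub>free_alg wt\<^esub> R = rel_ideal R"
  by (simp add: genideal_def rel_ideal_def two_sided_iff_ideal[symmetric])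

lemma two_sided_rel_ideal: "two_sided (rel_ideal R)"
  by (auto simp: two_sided_def rel_ideal_def)

lemma rel_ideal_minimal: "two_sided J \<Longrightarrow> R \<subseteq> J \<Longrightarrow> rel_ideal R \<subseteq> J"
  by (auto simp: rel_ideal_def)

lemma rel_ideal_superset: "R \<subseteq> rel_ideal R"
  by (auto simp: rel_ideal_def)

lemma rel_ideal_eqI: "R \<subseteq> rel_ideal R' \<Longrightarrow> R' \<subseteq> rel_ideal R \<Longrightarrow> rel_ideal R = rel_ideal R'"
  by (meson rel_ideal_minimal subset_antisym two_sided_rel_ideal)

text \<open>The projection from the free algebra. Elements of a presented algebra are handled
  through representatives, and \<open>pres_eq_iff\<close> turns equations between them into
  membership in \<open>rel_ideal R\<close>.\<close>

definition pres :: "('g \<Rightarrow> nat) \<Rightarrow> ('g, 'k::field) free_poly set \<Rightarrow> ('g, 'k) free_poly \<Rightarrow> ('g, 'k) free_poly set" where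
  "pres wt R p = rel_ideal R +>\<^bsub>free_alg wt\<^esub> p"

lemma presented_alg_ideal: "algebra_ideal (rel_ideal R) (free_alg wt)"
proof (rule algebra_ideal.intro)
  show "ideal (rel_ideal R) (free_alg wt)"
    using two_sided_rel_ideal two_sided_iff_ideal by blast
  show "algebra_ideal_axioms (rel_ideal R) (free_alg wt)"
    by unfold_locales (simp_all add: distrib_left two_sidedD(3)[OF two_sided_rel_ideal])
qed

lemma pres_carrier: "carrier (presented_alg wt R) = range (pres wt R)"
  and pres_add: "pres wt R p \<oplus>\<^bsub>presented_alg wt R\<^esub> pres wt R q = pres wt R (p + q)"
  and pres_mult: "pres wt R p \<otimes>\<^bsub>presented_alg wt R\<^esub> pres wt R q = pres wt R (p * q)"
  and pres_one: "\<one>\<^bsub>presented_alg wt R\<^esub> = pres wt R 1"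
  and pres_zero: "\<zero>\<^bsub>presented_alg wt R\<^esub> = pres wt R 0"
  and pres_smult: "c \<odot>\<^bsub>presented_alg wt R\<^esub> pres wt R p = pres wt R (const c * p)"
  and pres_homog: "homog (presented_alg wt R) n = pres wt R ` homog (free_alg wt) n"
proof -
  interpret algebra_ideal "rel_ideal R" "free_alg wt" by (rule presented_alg_ideal)
  have eq: "presented_alg wt R = quot_alg (free_alg wt) (rel_ideal R)"
    by (simp add: presented_alg_def Idl_free_alg)
  have coset: "pres wt R = (\<lambda>x. rel_ideal R +>\<^bsub>free_alg wt\<^esub> x)"
    by (simp add: pres_def fun_eq_iff)
  show "carrier (presented_alg wt R) = range (pres wt R)"
    using quot_alg_carrier by (simp only: eq coset free_alg_simps)
  show "pres wt R p \<oplus>\<^bsub>presented_alg wt R\<^esub> pres wt R q = pres wt R (p + q)"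
    using quot_alg_add[of p q] by (simp only: eq coset free_alg_simps UNIV_I simp_thms)
  show "pres wt R p \<otimes>\<^bsub>presented_alg wt R\<^esub> pres wt R q = pres wt R (p * q)"
    using quot_alg_mult[of p q] by (simp only: eq coset free_alg_simps UNIV_I simp_thms)
  show "\<one>\<^bsub>presented_alg wt R\<^esub> = pres wt R 1"
    using quot_alg_one by (simp only: eq coset free_alg_simps)
  show "\<zero>\<^bsub>presented_alg wt R\<^esub> = pres wt R 0"
    using quot_alg_zero by (simp only: eq coset free_alg_simps)
  show "c \<odot>\<^bsub>presented_alg wt R\<^esub> pres wt R p = pres wt R (const c * p)"
    using quot_alg_smult[of p c] by (simp only: eq coset free_alg_simps UNIV_I simp_thms)
  show "homog (presented_alg wt R) n = pres wt R ` homog (free_alg wt) n"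
    using quot_alg_homog[of n] by (simp only: eq coset)
qed

lemma pres_eq_iff: "pres wt R p = pres wt R q \<longleftrightarrow> p - q \<in> rel_ideal R"
proof -
  interpret algebra_ideal "rel_ideal R" "free_alg wt" by (rule presented_alg_ideal)
  show ?thesis using coset_eq_iff[of p q] by (simp add: pres_def)
qed

section \<open>Tensor products of algebras\<close>

locale tensor_product = A: graded_algebra A + B: graded_algebra B
  for A :: "('k::field, 'a) graded" and B :: "('k, 'b) graded"
begin

abbreviation "PA \<equiv> pair_alg A B"
abbreviation "E \<equiv> tensor_alg A B"

lemma pair_carrier: "carrier PA = {p. Poly_Mapping.keys p \<subseteq> carrier A \<times> carrier B}"
  by (simp add: pair_alg_def)

lemma pair_simps [simp]:
  "one PA = Poly_Mapping.single (\<one>\<^bsub>A\<^esub>, \<one>\<^bsub>B\<^esub>) 1" "zero PA = 0" "add PA = (+)"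
  "smult PA = (\<lambda>c. Poly_Mapping.map ((*) c))"
  by (simp_all add: pair_alg_def)

abbreviation pair_mult where "pair_mult x y \<equiv> (fst x \<otimes>\<^bsub>A\<^esub> fst y, snd x \<otimes>\<^bsub>B\<^esub> snd y)"

text \<open>Read as two nested linear extensions, the double sum over pairs of keys inherits both
  distributive laws from \<open>lin_ext_add\<close>.\<close>

lemma mult_lin_ext:
  "mult PA p q = lin_ext (\<lambda>x c. lin_ext (\<lambda>y d. Poly_Mapping.single (pair_mult x y) (c * d)) q) p"
  by (simp add: pair_alg_def lin_ext_def case_prod_beta)

lemma coefficient_additive_inner:
  "coefficient_additive (\<lambda>y d. Poly_Mapping.single (pair_mult x y) (c * d))"
  for c :: 'k
  by unfold_locales (simp_all add: distrib_left single_add)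

lemma coefficient_additive_outer:
  "coefficient_additive (\<lambda>x c. lin_ext (\<lambda>y d. Poly_Mapping.single (pair_mult x y) (c * d)) q)"
  for q :: "('a \<times> 'b) \<Rightarrow>\<^sub>0 'k"
  by unfold_locales (simp_all add: lin_ext_def single_add distrib_right sum.distrib)

lemma mult_add_l: "mult PA (p + p') q = mult PA p q + mult PA p' q"
  unfolding mult_lin_ext
  by (rule coefficient_additive.lin_ext_add[OF coefficient_additive_outer])

lemma mult_add_r: "mult PA p (q + q') = mult PA p q + mult PA p q'"
  unfolding mult_lin_ext coefficient_additive.lin_ext_add[OF coefficient_additive_inner]
  by (simp add: lin_ext_def sum.distrib)

lemma mult_zero [simp]: "mult PA 0 q = 0" "mult PA p 0 = 0"
  unfolding mult_lin_ext by (simp_all add: lin_ext_def)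

lemma mult_single:
  "mult PA (Poly_Mapping.single x c) (Poly_Mapping.single y d) =
    Poly_Mapping.single (pair_mult x y) (c * d)"
  unfolding mult_lin_ext
  by (subst coefficient_additive.lin_ext_single[OF coefficient_additive_outer],
      subst coefficient_additive.lin_ext_single[OF coefficient_additive_inner]) (rule refl)

lemma mult_diff_l: "mult PA (p - p') q = mult PA p q - mult PA p' q"
  by (rule additive_diff[of "\<lambda>p. mult PA p q"]) (rule mult_add_l)

lemma mult_diff_r: "mult PA p (q - q') = mult PA p q - mult PA p q'"
  by (rule additive_diff[of "mult PA p"]) (rule mult_add_r)

lemma pair_closed:
  "p \<in> carrier PA \<Longrightarrow> q \<in> carrier PA \<Longrightarrow> p + q \<in> carrier PA"
  "p \<in> carrier PA \<Longrightarrow> - p \<in> carrier PA"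
  "p \<in> carrier PA \<Longrightarrow> q \<in> carrier PA \<Longrightarrow> p - q \<in> carrier PA"
  "a \<in> carrier A \<Longrightarrow> b \<in> carrier B \<Longrightarrow> Poly_Mapping.single (a, b) c \<in> carrier PA"
  "0 \<in> carrier PA"
  using keys_add[of p q] keys_diff[of p q] by (auto simp: pair_carrier split: if_splits)

lemma pair_induct [consumes 1, case_names zero single add]:
  assumes "p \<in> carrier PA" and "P 0"
    and "\<And>a b c. a \<in> carrier A \<Longrightarrow> b \<in> carrier B \<Longrightarrow> P (Poly_Mapping.single (a, b) c)"
    and "\<And>p q. p \<in> carrier PA \<Longrightarrow> q \<in> carrier PA \<Longrightarrow> P p \<Longrightarrow> P q \<Longrightarrow> P (p + q)"
  shows "P p"
proof -
  have "p \<in> carrier PA \<and> P p"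
  proof (induction p rule: poly_mapping_additive_induct)
    case (single u c)
    then have "fst u \<in> carrier A" "snd u \<in> carrier B" using assms(1) by (auto simp: pair_carrier)
    from pair_closed(4)[OF this] assms(3)[OF this] show ?case by simp
  qed (use assms(2,4) pair_closed in auto)
  then show ?thesis ..
qed

lemma mult_closed: "p \<in> carrier PA \<Longrightarrow> q \<in> carrier PA \<Longrightarrow> mult PA p q \<in> carrier PA"
proof (induction p rule: pair_induct)
  case (single a b c)
  from single(3) show ?case
  proof (induction q rule: pair_induct)
    case (single a' b' c')
    show ?case unfolding mult_single fst_conv snd_conv
      by (rule pair_closed(4)) (use single \<open>a \<in> carrier A\<close> \<open>b \<in> carrier B\<close> in auto)
  qed (simp_all only: mult_add_r mult_zero pair_closed)
qed (simp_all only: mult_add_l mult_zero pair_closed)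

lemma mult_assoc:
  assumes "p \<in> carrier PA" "q \<in> carrier PA" "r \<in> carrier PA"
  shows "mult PA (mult PA p q) r = mult PA p (mult PA q r)"
  using assms(1)
proof (induction p rule: pair_induct)
  case p: (single a b c)
  from assms(2) show ?case
  proof (induction q rule: pair_induct)
    case q: (single a' b' c')
    from assms(3) show ?case
    proof (induction r rule: pair_induct)
      case (single a'' b'' c'')
      then show ?case
        using p q by (simp add: mult_single A.m_assoc B.m_assoc mult.assoc)
    qed (simp_all only: mult_add_r mult_zero)
  qed (simp_all only: mult_add_r mult_add_l mult_zero)
qed (simp_all only: mult_add_l mult_zero)

lemma mult_one:
  assumes "p \<in> carrier PA"
  shows "mult PA \<one>\<^bsub>PA\<^esub> p = p" "mult PA p \<one>\<^bsub>PA\<^esub> = p"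
  using assms
  by (induction p rule: pair_induct) (simp_all add: mult_single mult_add_l mult_add_r)

lemma pair_ring: "ring PA"
proof (rule ringI)
  show "abelian_group PA"
  proof (rule abelian_groupI)
    fix x assume "x \<in> carrier PA"
    from pair_closed(2)[OF this] show "\<exists>y\<in>carrier PA. y \<oplus>\<^bsub>PA\<^esub> x = \<zero>\<^bsub>PA\<^esub>"
      by (intro bexI[of _ "- x"]) simp_all
  next
    fix x y assume "x \<in> carrier PA" "y \<in> carrier PA"
    then show "x \<oplus>\<^bsub>PA\<^esub> y \<in> carrier PA" using pair_closed(1) by simp
  qed (simp_all add: add.assoc add.commute pair_closed(5))
  show "monoid PA"
  proof (rule monoidI)
    show "\<one>\<^bsub>PA\<^esub> \<in> carrier PA" using pair_closed(4)[OF A.one_closed B.one_closed] by simp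
  qed (use mult_closed mult_assoc mult_one in auto)
qed (simp_all add: mult_add_l mult_add_r)

lemma pair_minus: "x \<in> carrier PA \<Longrightarrow> y \<in> carrier PA \<Longrightarrow> x \<ominus>\<^bsub>PA\<^esub> y = x - y"
proof -
  assume "x \<in> carrier PA" and y: "y \<in> carrier PA"
  have "\<ominus>\<^bsub>PA\<^esub> y = - y"
  proof (rule abelian_group.minus_equality[OF ring.is_abelian_group[OF pair_ring]])
    show "- y \<oplus>\<^bsub>PA\<^esub> y = \<zero>\<^bsub>PA\<^esub>" by simp
  qed (use y pair_closed in simp_all)
  then show ?thesis by (simp add: a_minus_def)
qed

definition rel where "rel = Idl\<^bsub>PA\<^esub> (bilinearity A B)"

lemma bilinearity_closed: "bilinearity A B \<subseteq> carrier PA"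
  unfolding bilinearity_def
  by (intro Un_least subsetI)
    (elim CollectE exE conjE, simp add: pair_closed A.smult_closed B.smult_closed)+

lemma rel_ideal: "ideal rel PA"
  unfolding rel_def by (rule ring.genideal_ideal[OF pair_ring bilinearity_closed])

lemma bilinearity_rel: "bilinearity A B \<subseteq> rel"
  unfolding rel_def by (rule ring.genideal_self[OF pair_ring bilinearity_closed])

definition cls where "cls p = rel +>\<^bsub>PA\<^esub> p"

text \<open>The class of c times the tensor of a and b. With the coefficient kept separate, every
  formal pair has literally this shape, and \<open>E_induct\<close> can split an element into such
  classes.\<close>

definition pure where "pure c a b = cls (Poly_Mapping.single (a, b) c)"

lemma cls_eq_iff: "p \<in> carrier PA \<Longrightarrow> q \<in> carrier PA \<Longrightarrow> cls p = cls q \<longleftrightarrow> p - q \<in> rel"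
  unfolding cls_def
  using ring.quotient_eq_iff_same_a_r_cos[OF pair_ring rel_ideal] pair_minus by metis

lemma E_ring: "ring E"
  unfolding tensor_alg_def rel_def[symmetric]
  by (rule ring_cong_fields[OF ideal.quotient_is_ring[OF rel_ideal]]) (simp_all add: quot_alg_def)

sublocale E: ring E by (rule E_ring)

lemma E_carrier: "carrier E = cls ` carrier PA"
  unfolding tensor_alg_def rel_def[symmetric]
  by (auto simp: quot_alg_def FactRing_def A_RCOSETS_def' cls_def)

lemma E_add: "p \<in> carrier PA \<Longrightarrow> q \<in> carrier PA \<Longrightarrow> cls p \<oplus>\<^bsub>E\<^esub> cls q = cls (p + q)"
  unfolding tensor_alg_def rel_def[symmetric] cls_def
  using ideal.a_rcos_sum[OF rel_ideal, of p q] by (simp add: quot_alg_def FactRing_def)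

lemma E_mult: "p \<in> carrier PA \<Longrightarrow> q \<in> carrier PA \<Longrightarrow> cls p \<otimes>\<^bsub>E\<^esub> cls q = cls (mult PA p q)"
  unfolding tensor_alg_def rel_def[symmetric] cls_def
  using ideal.rcoset_mult_add[OF rel_ideal, of p q] by (simp add: quot_alg_def FactRing_def)

lemma E_one: "\<one>\<^bsub>E\<^esub> = pure 1 \<one>\<^bsub>A\<^esub> \<one>\<^bsub>B\<^esub>"
  unfolding tensor_alg_def rel_def[symmetric] cls_def pure_def
  by (simp add: quot_alg_def FactRing_def)

lemma E_zero: "\<zero>\<^bsub>E\<^esub> = cls 0"
proof -
  interpret ideal rel PA by (rule rel_ideal)
  have "rel +>\<^bsub>PA\<^esub> \<zero>\<^bsub>PA\<^esub> = rel"
    by (rule a_rcos_const) (rule additive_subgroup.zero_closed[OF additive_subgroup_axioms])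
  then show ?thesis
    unfolding tensor_alg_def rel_def[symmetric] cls_def
    by (simp add: quot_alg_def FactRing_def)
qed

lemma E_homog: "homog E n = cls ` homog PA n"
  unfolding tensor_alg_def rel_def[symmetric] cls_def[abs_def]
  by (simp add: quot_alg_def)

lemma pure_closed: "a \<in> carrier A \<Longrightarrow> b \<in> carrier B \<Longrightarrow> pure c a b \<in> carrier E"
  unfolding pure_def E_carrier by (intro imageI pair_closed)

lemma pure_mult:
  assumes "a \<in> carrier A" "b \<in> carrier B" "a' \<in> carrier A" "b' \<in> carrier B"
  shows "pure c a b \<otimes>\<^bsub>E\<^esub> pure d a' b' = pure (c * d) (a \<otimes>\<^bsub>A\<^esub> a') (b \<otimes>\<^bsub>B\<^esub> b')"
  unfolding pure_def using assms by (simp only: E_mult pair_closed mult_single fst_conv snd_conv)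

lemma pure_add_coeff:
  assumes "a \<in> carrier A" "b \<in> carrier B"
  shows "pure (c + d) a b = pure c a b \<oplus>\<^bsub>E\<^esub> pure d a b"
  unfolding pure_def using assms by (simp only: E_add pair_closed single_add)

text \<open>The relations in \<open>bilinearity\<close> have leading coefficient 1. Their multiples,
  needed for \<open>pure c\<close>, arise from multiplication by c times the pair of units.\<close>

lemma scaled_relation:
  assumes "p \<in> bilinearity A B"
  shows "mult PA (Poly_Mapping.single (\<one>\<^bsub>A\<^esub>, \<one>\<^bsub>B\<^esub>) c) p \<in> rel"
proof -
  interpret ideal rel PA by (rule rel_ideal)
  show ?thesis
    using assms bilinearity_rel pair_closed(4)[OF A.one_closed B.one_closed]
    by (intro I_l_closed) auto
qed

lemma pure_add_l:
  assumes "a \<in> carrier A" "a' \<in> carrier A" "b \<in> carrier B"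
  shows "pure c (a \<oplus>\<^bsub>A\<^esub> a') b = pure c a b \<oplus>\<^bsub>E\<^esub> pure c a' b"
proof -
  let ?r = "Poly_Mapping.single (a \<oplus>\<^bsub>A\<^esub> a', b) 1 - Poly_Mapping.single (a, b) 1
    - Poly_Mapping.single (a', b) (1::'k)"
  have "?r \<in> bilinearity A B" unfolding bilinearity_def using assms by blast
  from scaled_relation[OF this, of c] show ?thesis
    unfolding pure_def using assms
    by (simp add: E_add pair_closed cls_eq_iff mult_diff_r mult_add_r mult_single diff_diff_eq)
qed

lemma pure_add_r:
  assumes "a \<in> carrier A" "b \<in> carrier B" "b' \<in> carrier B"
  shows "pure c a (b \<oplus>\<^bsub>B\<^esub> b') = pure c a b \<oplus>\<^bsub>E\<^esub> pure c a b'"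
proof -
  let ?r = "Poly_Mapping.single (a, b \<oplus>\<^bsub>B\<^esub> b') 1 - Poly_Mapping.single (a, b) 1
    - Poly_Mapping.single (a, b') (1::'k)"
  have "?r \<in> bilinearity A B" unfolding bilinearity_def using assms by blast
  from scaled_relation[OF this, of c] show ?thesis
    unfolding pure_def using assms
    by (simp add: E_add pair_closed cls_eq_iff mult_diff_r mult_add_r mult_single diff_diff_eq)
qed

lemma pure_smult_l:
  assumes "a \<in> carrier A" "b \<in> carrier B"
  shows "pure c (d \<odot>\<^bsub>A\<^esub> a) b = pure (c * d) a b"
proof -
  have "Poly_Mapping.single (d \<odot>\<^bsub>A\<^esub> a, b) 1 - Poly_Mapping.single (a, b) d \<in> bilinearity A B"
    unfolding bilinearity_def using assms by blast
  from scaled_relation[OF this, of c] show ?thesis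
    unfolding pure_def using assms
    by (simp add: pair_closed cls_eq_iff mult_diff_r mult_single A.smult_closed)
qed

lemma pure_smult_r:
  assumes "a \<in> carrier A" "b \<in> carrier B"
  shows "pure c a (d \<odot>\<^bsub>B\<^esub> b) = pure (c * d) a b"
proof -
  have "Poly_Mapping.single (a, d \<odot>\<^bsub>B\<^esub> b) 1 - Poly_Mapping.single (a, b) d \<in> bilinearity A B"
    unfolding bilinearity_def using assms by blast
  from scaled_relation[OF this, of c] show ?thesis
    unfolding pure_def using assms
    by (simp add: pair_closed cls_eq_iff mult_diff_r mult_single B.smult_closed)
qed

lemma E_induct [consumes 1, case_names pure add]:
  assumes "e \<in> carrier E"
    and "\<And>a b c. a \<in> carrier A \<Longrightarrow> b \<in> carrier B \<Longrightarrow> P (pure c a b)"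
    and "\<And>e e'. e \<in> carrier E \<Longrightarrow> e' \<in> carrier E \<Longrightarrow> P e \<Longrightarrow> P e' \<Longrightarrow> P (e \<oplus>\<^bsub>E\<^esub> e')"
  shows "P e"
proof -
  obtain p where p: "p \<in> carrier PA" "e = cls p" using assms(1) unfolding E_carrier by blast
  from p(1) have "P (cls p)"
  proof (induction p rule: pair_induct)
    case zero
    show ?case using assms(2)[of "\<one>\<^bsub>A\<^esub>" "\<one>\<^bsub>B\<^esub>" 0] by (simp add: pure_def)
  next
    case (single a b c) then show ?case using assms(2) by (simp add: pure_def)
  next
    case (add p q)
    then show ?case using assms(3)[of "cls p" "cls q"] by (simp add: E_carrier E_add)
  qed
  then show ?thesis using p by simp
qed

lemma pure_zero_l: "b \<in> carrier B \<Longrightarrow> pure c \<zero>\<^bsub>A\<^esub> b = \<zero>\<^bsub>E\<^esub>"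
  using pure_add_l[of "\<zero>\<^bsub>A\<^esub>" "\<zero>\<^bsub>A\<^esub>" b c] pure_closed[of "\<zero>\<^bsub>A\<^esub>" b c] by simp

lemma pure_zero_r: "a \<in> carrier A \<Longrightarrow> pure c a \<zero>\<^bsub>B\<^esub> = \<zero>\<^bsub>E\<^esub>"
  using pure_add_r[of a "\<zero>\<^bsub>B\<^esub>" "\<zero>\<^bsub>B\<^esub>" c] pure_closed[of a "\<zero>\<^bsub>B\<^esub>" c] by simp

end

section \<open>Grading of the tensor product\<close>

context graded_algebra
begin

lemma homog_carrier: "x \<in> homog S n \<Longrightarrow> x \<in> carrier S"
  using graded additive_subgroup.a_Hcarr unfolding graded_decomposition_def by metis

end

context tensor_product
begin

lemma homog_pair:
  "homog PA n = {p. \<forall>(a, b)\<in>Poly_Mapping.keys p. \<exists>i j. a \<in> homog A i \<and> b \<in> homog B j \<and> i + j = n}"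
  by (simp add: pair_alg_def)

lemma homog_pair_closed: "homog PA n \<subseteq> carrier PA"
  unfolding homog_pair pair_carrier by (force dest: A.homog_carrier B.homog_carrier)

lemma pure_homog: "a \<in> homog A i \<Longrightarrow> b \<in> homog B j \<Longrightarrow> pure c a b \<in> homog E (i + j)"
  unfolding pure_def E_homog homog_pair by (intro imageI) auto

lemma E_homog_zero: "\<zero>\<^bsub>E\<^esub> \<in> homog E n"
  unfolding E_zero E_homog homog_pair by (intro imageI) auto

lemma E_homog_closed: "e \<in> homog E n \<Longrightarrow> e \<in> carrier E"
  unfolding E_homog E_carrier using homog_pair_closed by blast

lemma homog_pair_add: "p \<in> homog PA n \<Longrightarrow> q \<in> homog PA n \<Longrightarrow> p + q \<in> homog PA n"
  unfolding homog_pair using keys_add[of p q] by blast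

lemma E_homog_add: "e \<in> homog E n \<Longrightarrow> e' \<in> homog E n \<Longrightarrow> e \<oplus>\<^bsub>E\<^esub> e' \<in> homog E n"
  unfolding E_homog using homog_pair_closed homog_pair_add
  by (elim imageE) (simp add: E_add subset_iff)

lemma E_homog_induct [consumes 1, case_names zero pure add]:
  assumes "e \<in> homog E n" and "P \<zero>\<^bsub>E\<^esub>"
    and "\<And>a b c i j. a \<in> homog A i \<Longrightarrow> b \<in> homog B j \<Longrightarrow> n = i + j \<Longrightarrow> P (pure c a b)"
    and "\<And>e e'. e \<in> homog E n \<Longrightarrow> e' \<in> homog E n \<Longrightarrow> P e \<Longrightarrow> P e' \<Longrightarrow> P (e \<oplus>\<^bsub>E\<^esub> e')"
  shows "P e"
proof -
  obtain p where p: "p \<in> homog PA n" "e = cls p" using assms(1) unfolding E_homog by blast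
  have "p \<in> homog PA n \<and> P (cls p)"
  proof (induction p rule: poly_mapping_additive_induct)
    case zero
    show ?case using assms(2) by (simp add: E_zero homog_pair)
  next
    case (single u c)
    then obtain i j where u: "fst u \<in> homog A i" "snd u \<in> homog B j" "n = i + j"
      using p(1) by (auto simp: homog_pair)
    from assms(3)[OF u, of c] u show ?case
      by (cases u) (auto simp: pure_def homog_pair)
  next
    case (add p q)
    then have "cls p \<oplus>\<^bsub>E\<^esub> cls q = cls (p + q)" using homog_pair_closed by (intro E_add) auto
    then show ?case using add assms(4)[of "cls p" "cls q"] homog_pair_add by (simp add: E_homog)
  qed
  then show ?thesis using p by simp
qed

lemma E_homog_mult:
  assumes "e \<in> homog E m" "e' \<in> homog E n" shows "e \<otimes>\<^bsub>E\<^esub> e' \<in> homog E (m + n)"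
  using assms(1)
proof (induction e rule: E_homog_induct)
  case (pure a b c i j)
  note p = pure
  from assms(2) show ?case
  proof (induction e' rule: E_homog_induct)
    case (pure a' b' c' i' j')
    have "pure (c * c') (a \<otimes>\<^bsub>A\<^esub> a') (b \<otimes>\<^bsub>B\<^esub> b') \<in> homog E ((i + i') + (j + j'))"
      using p pure by (intro pure_homog A.homog_mult B.homog_mult)
    then show ?case
      using p pure by (simp add: pure_mult A.homog_carrier B.homog_carrier algebra_simps)
  next
    case (add e e')
    then show ?case
      using p E_homog_closed by (simp add: E.r_distr pure_closed A.homog_carrier B.homog_carrier E_homog_add)
  qed (use p in \<open>simp add: E_homog_zero pure_closed A.homog_carrier B.homog_carrier\<close>)
next
  case (add e f)
  then show ?case using assms(2) E_homog_closed by (simp add: E.l_distr E_homog_add)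
qed (use assms(2) E_homog_closed E_homog_zero in simp)

end

text \<open>The universal property of the tensor product for a target that is only an abelian group:
  the scalar is an argument of \<open>\<beta>\<close>, so \<open>G\<close> needs no scalar action by
  the field.\<close>

locale tensor_map = tensor_product A B + G: abelian_group G
  for A :: "('k::field, 'a) graded" and B :: "('k, 'b) graded" and G :: "('s, 'g) graded" +
  fixes \<beta> :: "'k \<Rightarrow> 'a \<Rightarrow> 'b \<Rightarrow> 'g"
  assumes closed: "a \<in> carrier A \<Longrightarrow> b \<in> carrier B \<Longrightarrow> \<beta> c a b \<in> carrier G"
    and add_coeff: "a \<in> carrier A \<Longrightarrow> b \<in> carrier B \<Longrightarrow> \<beta> (c + d) a b = \<beta> c a b \<oplus>\<^bsub>G\<^esub> \<beta> d a b"
    and add_l: "a \<in> carrier A \<Longrightarrow> a' \<in> carrier A \<Longrightarrow> b \<in> carrier B \<Longrightarrow>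
      \<beta> c (a \<oplus>\<^bsub>A\<^esub> a') b = \<beta> c a b \<oplus>\<^bsub>G\<^esub> \<beta> c a' b"
    and add_r: "a \<in> carrier A \<Longrightarrow> b \<in> carrier B \<Longrightarrow> b' \<in> carrier B \<Longrightarrow>
      \<beta> c a (b \<oplus>\<^bsub>B\<^esub> b') = \<beta> c a b \<oplus>\<^bsub>G\<^esub> \<beta> c a b'"
    and smult_l: "a \<in> carrier A \<Longrightarrow> b \<in> carrier B \<Longrightarrow> \<beta> c (d \<odot>\<^bsub>A\<^esub> a) b = \<beta> (c * d) a b"
    and smult_r: "a \<in> carrier A \<Longrightarrow> b \<in> carrier B \<Longrightarrow> \<beta> c a (d \<odot>\<^bsub>B\<^esub> b) = \<beta> (c * d) a b"
begin

definition tsum where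
  "tsum p = finsum G (\<lambda>(a, b). \<beta> (Poly_Mapping.lookup p (a, b)) a b) (Poly_Mapping.keys p)"

text \<open>Evaluation at an arbitrary representative has the same shape as the action in
  \<open>env_left\<close>, so that this action becomes an instance by unfolding.\<close>

definition ext where "ext e = tsum (SOME p. p \<in> e)"

lemma coeff_zero: "a \<in> carrier A \<Longrightarrow> b \<in> carrier B \<Longrightarrow> \<beta> 0 a b = \<zero>\<^bsub>G\<^esub>"
  using add_coeff[of a b 0 0] closed[of a b 0] by simp

lemma tsum_superset:
  assumes "finite K" "Poly_Mapping.keys p \<subseteq> K" "K \<subseteq> carrier A \<times> carrier B"
  shows "tsum p = finsum G (\<lambda>(a, b). \<beta> (Poly_Mapping.lookup p (a, b)) a b) K"
  unfolding tsum_def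
proof (rule G.add.finprod_mono_neutral_cong_left)
  show "(\<lambda>(a, b). \<beta> (Poly_Mapping.lookup p (a, b)) a b) \<in> K \<rightarrow> carrier G"
    using assms closed by auto
qed (use assms coeff_zero in \<open>auto simp: in_keys_iff\<close>)

lemma tsum_closed: "p \<in> carrier PA \<Longrightarrow> tsum p \<in> carrier G"
  unfolding tsum_def pair_carrier by (rule G.finsum_closed) (auto intro: closed)

lemma tsum_add:
  assumes "p \<in> carrier PA" "q \<in> carrier PA"
  shows "tsum (p + q) = tsum p \<oplus>\<^bsub>G\<^esub> tsum q"
proof -
  let ?K = "Poly_Mapping.keys p \<union> Poly_Mapping.keys q"
  let ?f = "\<lambda>p (a, b). \<beta> (Poly_Mapping.lookup p (a, b)) a b"
  have K: "?K \<subseteq> carrier A \<times> carrier B" using assms by (auto simp: pair_carrier)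
  have c: "?f r \<in> ?K \<rightarrow> carrier G" for r using K by (auto intro: closed)
  have "tsum (p + q) = finsum G (?f (p + q)) ?K"
    using keys_add[of p q] K by (intro tsum_superset) auto
  also have "\<dots> = finsum G (\<lambda>x. ?f p x \<oplus>\<^bsub>G\<^esub> ?f q x) ?K"
    using K c by (intro G.finsum_cong') (auto simp: lookup_add intro!: add_coeff closed)
  also have "\<dots> = finsum G (?f p) ?K \<oplus>\<^bsub>G\<^esub> finsum G (?f q) ?K"
    using c by (intro G.finsum_addf) auto
  also have "\<dots> = tsum p \<oplus>\<^bsub>G\<^esub> tsum q"
    using tsum_superset[of ?K p] tsum_superset[of ?K q] K by simp
  finally show ?thesis .
qed

lemma tsum_zero: "tsum 0 = \<zero>\<^bsub>G\<^esub>"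
  by (simp add: tsum_def)

lemma tsum_single:
  assumes "a \<in> carrier A" "b \<in> carrier B"
  shows "tsum (Poly_Mapping.single (a, b) c) = \<beta> c a b"
proof -
  have "tsum (Poly_Mapping.single (a, b) c) =
      finsum G (\<lambda>(a', b'). \<beta> (Poly_Mapping.lookup (Poly_Mapping.single (a, b) c) (a', b')) a' b') {(a, b)}"
    using assms by (intro tsum_superset) auto
  then show ?thesis using assms closed by simp
qed

lemma tsum_diff:
  assumes "p \<in> carrier PA" "q \<in> carrier PA"
  shows "tsum (p - q) = tsum p \<ominus>\<^bsub>G\<^esub> tsum q"
proof -
  have "tsum (p - q) \<oplus>\<^bsub>G\<^esub> tsum q = tsum p"
    using tsum_add[of "p - q" q] assms pair_closed(3)[OF assms] by simp
  moreover have "tsum (p - q) \<in> carrier G" "tsum q \<in> carrier G" "tsum p \<in> carrier G"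
    using assms pair_closed(3) tsum_closed by blast+
  ultimately show ?thesis
    by (metis G.add.inv_solve_right a_minus_def)
qed

text \<open>Multiplying a relation by formal pairs on both sides distributes over its terms, and
  bilinearity of \<open>\<beta>\<close> cancels the result. The two-sided form is needed because
  \<open>tsum\<close> is not multiplicative, while the relations generate an ideal.\<close>

lemma tsum_bilinearity:
  assumes r: "r \<in> bilinearity A B" and 0: "a\<^sub>0 \<in> carrier A" "b\<^sub>0 \<in> carrier B"
    and 1: "a\<^sub>1 \<in> carrier A" "b\<^sub>1 \<in> carrier B"
  shows "tsum (mult PA (mult PA (Poly_Mapping.single (a\<^sub>0, b\<^sub>0) c\<^sub>0) r)
    (Poly_Mapping.single (a\<^sub>1, b\<^sub>1) c\<^sub>1)) = \<zero>\<^bsub>G\<^esub>"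
  using r unfolding bilinearity_def
proof (elim UnE CollectE exE conjE)
  note simps = mult_diff_l mult_diff_r mult_single tsum_diff tsum_single pair_closed 0 1
    A.r_distr A.l_distr B.r_distr B.l_distr add_l add_r closed
    A.smult_closed B.smult_closed A.smult_mult_l A.smult_mult_r B.smult_mult_l B.smult_mult_r
    smult_l smult_r
  have cancel: "(x \<oplus>\<^bsub>G\<^esub> y) \<ominus>\<^bsub>G\<^esub> x \<ominus>\<^bsub>G\<^esub> y = \<zero>\<^bsub>G\<^esub>" if "x \<in> carrier G" "y \<in> carrier G" for x y
  proof -
    have "(x \<oplus>\<^bsub>G\<^esub> y) \<ominus>\<^bsub>G\<^esub> x \<ominus>\<^bsub>G\<^esub> y = (x \<oplus>\<^bsub>G\<^esub> y) \<oplus>\<^bsub>G\<^esub> (\<ominus>\<^bsub>G\<^esub> x \<oplus>\<^bsub>G\<^esub> \<ominus>\<^bsub>G\<^esub> y)"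
      using that by (simp only: a_minus_def G.a_assoc G.add.m_closed G.a_inv_closed)
    also have "\<dots> = \<zero>\<^bsub>G\<^esub>"
      using that by (simp only: G.minus_add[symmetric] G.r_neg G.add.m_closed)
    finally show ?thesis .
  qed
  { fix a a' b
    assume "r = Poly_Mapping.single (a \<oplus>\<^bsub>A\<^esub> a', b) 1 - Poly_Mapping.single (a, b) 1 - Poly_Mapping.single (a', b) 1"
      "a \<in> carrier A" "a' \<in> carrier A" "b \<in> carrier B"
    then show ?thesis by (simp add: simps cancel) }
  { fix a b b'
    assume "r = Poly_Mapping.single (a, b \<oplus>\<^bsub>B\<^esub> b') 1 - Poly_Mapping.single (a, b) 1 - Poly_Mapping.single (a, b') 1"
      "a \<in> carrier A" "b \<in> carrier B" "b' \<in> carrier B"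
    then show ?thesis by (simp add: simps cancel) }
  { fix c a b
    assume "r = Poly_Mapping.single (c \<odot>\<^bsub>A\<^esub> a, b) 1 - Poly_Mapping.single (a, b) c"
      "a \<in> carrier A" "b \<in> carrier B"
    then show ?thesis by (simp add: simps a_minus_def G.r_neg mult_ac) }
  { fix c a b
    assume "r = Poly_Mapping.single (a, c \<odot>\<^bsub>B\<^esub> b) 1 - Poly_Mapping.single (a, b) c"
      "a \<in> carrier A" "b \<in> carrier B"
    then show ?thesis by (simp add: simps a_minus_def G.r_neg mult_ac) }
qed

text \<open>The kernel of \<open>tsum\<close> need not be visibly an ideal. The set
  \<open>?J\<close>, defined by the vanishing of \<open>tsum\<close> on all two-sided multiples, is
  one by construction and contains the relations; multiplication by units then recovers
  \<open>tsum p\<close>.\<close>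

lemma tsum_rel:
  assumes "p \<in> rel" shows "tsum p = \<zero>\<^bsub>G\<^esub>"
proof -
  interpret PA: ring PA by (rule pair_ring)
  let ?J = "{p \<in> carrier PA. \<forall>q\<in>carrier PA. \<forall>r\<in>carrier PA.
    tsum (mult PA (mult PA q p) r) = \<zero>\<^bsub>G\<^esub>}"
  have "ideal ?J PA"
  proof (rule idealI[OF pair_ring])
    show "subgroup ?J (add_monoid PA)"
    proof (rule PA.add.subgroupI)
      show "?J \<subseteq> carrier PA" by blast
      have "0 \<in> ?J" using tsum_zero pair_closed(5) by simp
      then show "?J \<noteq> {}" by blast
    next
      fix p assume p: "p \<in> ?J"
      have "\<ominus>\<^bsub>PA\<^esub> p = 0 - p"
        using pair_minus[of 0 p] p pair_closed by (simp add: a_minus_def)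
      moreover have "0 - p \<in> ?J"
        using p pair_closed(2) mult_closed tsum_diff[OF pair_closed(5)] tsum_zero
        by (simp only: mem_Collect_eq mult_diff_l mult_diff_r mult_zero)
          (simp add: G.minus_eq)
      ultimately show "\<ominus>\<^bsub>PA\<^esub> p \<in> ?J" by (simp only:)
    next
      fix p q assume "p \<in> ?J" "q \<in> ?J"
      then show "p \<oplus>\<^bsub>PA\<^esub> q \<in> ?J"
        using pair_closed(1)[of p q] mult_closed
        by (simp add: mult_add_l mult_add_r tsum_add)
    qed
  next
    fix p x assume p: "p \<in> ?J" and x: "x \<in> carrier PA"
    have "mult PA (mult PA q (mult PA x p)) r = mult PA (mult PA (mult PA q x) p) r"
      "mult PA (mult PA q (mult PA p x)) r = mult PA (mult PA q p) (mult PA x r)"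
      if "q \<in> carrier PA" "r \<in> carrier PA" for q r
      using that p x mult_closed by (simp_all add: mult_assoc)
    then show "x \<otimes>\<^bsub>PA\<^esub> p \<in> ?J" "p \<otimes>\<^bsub>PA\<^esub> x \<in> ?J"
      using p x mult_closed by (simp_all)
  qed
  moreover have "bilinearity A B \<subseteq> ?J"
  proof (intro subsetI CollectI conjI ballI)
    fix p q r
    assume p: "p \<in> bilinearity A B" and q: "q \<in> carrier PA" and r: "r \<in> carrier PA"
    note pc = subsetD[OF bilinearity_closed p]
    from q show "tsum (mult PA (mult PA q p) r) = \<zero>\<^bsub>G\<^esub>"
    proof (induction q rule: pair_induct)
      case (single a b c)
      note q = single and qc = pair_closed(4)[OF single, of c]
      from r show ?case
      proof (induction r rule: pair_induct)
        case (single a' b' c')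
        then show ?case using tsum_bilinearity[OF p q] by blast
      next
        case (add r s)
        then show ?case using pc qc mult_closed by (simp add: mult_add_r tsum_add)
      qed (simp add: tsum_zero)
    next
      case (add q s)
      then show ?case using pc r mult_closed by (simp add: mult_add_l tsum_add)
    qed (simp add: tsum_zero)
  qed (use bilinearity_closed in blast)
  ultimately have "rel \<subseteq> ?J" unfolding rel_def by (rule ring.genideal_minimal[OF pair_ring])
  with assms have p: "p \<in> ?J" by blast
  then have "tsum (mult PA (mult PA \<one>\<^bsub>PA\<^esub> p) \<one>\<^bsub>PA\<^esub>) = \<zero>\<^bsub>G\<^esub>"
    using PA.one_closed by blast
  then show ?thesis using p mult_one by (simp)
qed

lemma ext_cls:
  assumes "p \<in> carrier PA" shows "ext (cls p) = tsum p"
proof -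
  interpret ideal rel PA by (rule rel_ideal)
  have "p \<in> cls p" unfolding cls_def using assms by (rule a_rcos_self)
  then have "(SOME p'. p' \<in> cls p) \<in> cls p" by (rule someI)
  then obtain i where i: "i \<in> rel" "(SOME p'. p' \<in> cls p) = i + p"
    by (auto simp: cls_def a_r_coset_def r_coset_def)
  have "i \<in> carrier PA" using i(1) by (rule a_Hcarr)
  then show ?thesis
    using assms i tsum_closed by (simp add: ext_def tsum_add tsum_rel)
qed

lemma ext_closed: "e \<in> carrier E \<Longrightarrow> ext e \<in> carrier G"
  unfolding E_carrier using ext_cls tsum_closed by auto

lemma ext_add: "e \<in> carrier E \<Longrightarrow> e' \<in> carrier E \<Longrightarrow> ext (e \<oplus>\<^bsub>E\<^esub> e') = ext e \<oplus>\<^bsub>G\<^esub> ext e'"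
  unfolding E_carrier using pair_closed(1)
  by (auto simp add: E_add ext_cls tsum_add)

lemma ext_pure: "a \<in> carrier A \<Longrightarrow> b \<in> carrier B \<Longrightarrow> ext (pure c a b) = \<beta> c a b"
  unfolding pure_def by (simp add: ext_cls pair_closed(4) tsum_single)

lemma ext_zero: "ext \<zero>\<^bsub>E\<^esub> = \<zero>\<^bsub>G\<^esub>"
  unfolding E_zero by (simp add: ext_cls[OF pair_closed(5)] tsum_zero)

end

section \<open>Modules over the enveloping algebra\<close>

lemma op_graded_algebra:
  assumes "graded_algebra S" shows "graded_algebra (op_alg S)"
proof -
  interpret graded_algebra S by fact
  have dec: "graded_decomposition (op_alg S)"
  proof -
    have "finsum (op_alg S) = (finsum S :: (int \<Rightarrow> _) \<Rightarrow> _)"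
      by (simp add: finsum_def finprod_def op_alg_def fun_eq_iff)
    moreover have "additive_subgroup H (op_alg S) \<longleftrightarrow> additive_subgroup H S" for H
      by (simp add: additive_subgroup_def op_alg_def)
    ultimately show ?thesis
      using graded unfolding graded_decomposition_def by (simp add: op_alg_def)
  qed
  have "ring (op_alg S)"
  proof (rule ringI)
    show "abelian_group (op_alg S)"
    proof (rule abelian_groupI)
      fix x assume "x \<in> carrier (op_alg S)"
      then show "\<exists>y\<in>carrier (op_alg S). y \<oplus>\<^bsub>op_alg S\<^esub> x = \<zero>\<^bsub>op_alg S\<^esub>"
        using l_neg by (auto simp: op_alg_def)
    qed (auto simp: op_alg_def intro: a_assoc a_comm)
    show "monoid (op_alg S)" by (rule monoidI) (auto simp: op_alg_def m_assoc)
  qed (auto simp: op_alg_def l_distr r_distr)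
  moreover have "y \<otimes>\<^bsub>S\<^esub> x \<in> homog S (m + n)" if "x \<in> homog S m" "y \<in> homog S n" for x y m n
    using homog_mult[OF that(2,1)] by (simp add: add.commute)
  ultimately show ?thesis
    using dec
    by (intro graded_algebra.intro graded_algebra_axioms.intro)
      (auto simp: op_alg_def smult_closed smult_l_distr smult_r_distr smult_assoc smult_one
        smult_mult_l smult_mult_r homog_smult homog_one)
qed

context graded_left_module
begin

lemma smult_zero_r: "e \<in> carrier E \<Longrightarrow> e \<odot> \<zero> = \<zero>"
  using smult_r_distr[of e \<zero> \<zero>] smult_closed[of e \<zero>] by simp

lemma smult_minus_r: "e \<in> carrier E \<Longrightarrow> x \<in> carrier P \<Longrightarrow> e \<odot> (\<ominus> x) = \<ominus> (e \<odot> x)"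
  using smult_r_distr[of e "\<ominus> x" x] smult_closed
  by (intro minus_equality[symmetric]) (simp_all add: smult_zero_r l_neg)

lemma smult_zero_l: "ring E \<Longrightarrow> x \<in> carrier P \<Longrightarrow> \<zero>\<^bsub>E\<^esub> \<odot> x = \<zero>"
proof -
  assume "ring E" and x: "x \<in> carrier P"
  then interpret E: ring E by simp
  show ?thesis
    using smult_l_distr[of "\<zero>\<^bsub>E\<^esub>" "\<zero>\<^bsub>E\<^esub>" x] smult_closed[of "\<zero>\<^bsub>E\<^esub>" x] x by simp
qed

end

text \<open>Vanishing of the homology of the complex with maps d, e, d, e, ... on A. Only the
  inclusions of kernels in images are recorded; the reverse ones come from the separate assumptions
  d e = e d = 0. The set A allows kernels and images to be treated with the operations of the
  ambient module.\<close>

definition exact_pair :: "('e, 'm) graded \<Rightarrow> 'm set \<Rightarrow> 'e \<Rightarrow> 'e \<Rightarrow> bool" where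
  "exact_pair M A d e \<longleftrightarrow>
     (\<forall>u\<in>A. d \<odot>\<^bsub>M\<^esub> u = \<zero>\<^bsub>M\<^esub> \<longrightarrow> (\<exists>v\<in>A. u = e \<odot>\<^bsub>M\<^esub> v)) \<and>
     (\<forall>u\<in>A. e \<odot>\<^bsub>M\<^esub> u = \<zero>\<^bsub>M\<^esub> \<longrightarrow> (\<exists>v\<in>A. u = d \<odot>\<^bsub>M\<^esub> v))"

lemma exact_pair_free:
  assumes "exact_pair (regular_left E) (carrier E) d e"
  shows "exact_pair (graded_free E as) (carrier (graded_free E as)) d e"
proof -
  have half: "\<exists>v\<in>carrier (graded_free E as). u = b \<odot>\<^bsub>graded_free E as\<^esub> v"
    if ex: "\<And>u. u \<in> carrier E \<Longrightarrow> a \<otimes>\<^bsub>E\<^esub> u = \<zero>\<^bsub>E\<^esub> \<Longrightarrow> \<exists>v\<in>carrier E. u = b \<otimes>\<^bsub>E\<^esub> v"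
      and u: "u \<in> carrier (graded_free E as)" "a \<odot>\<^bsub>graded_free E as\<^esub> u = \<zero>\<^bsub>graded_free E as\<^esub>"
    for a b u
  proof -
    have "\<exists>v\<in>carrier E. u i = b \<otimes>\<^bsub>E\<^esub> v" if i: "i < length as" for i
    proof (rule ex)
      show "u i \<in> carrier E" using u(1) i by (auto simp: graded_free_def)
      show "a \<otimes>\<^bsub>E\<^esub> u i = \<zero>\<^bsub>E\<^esub>" using fun_cong[OF u(2), of i] i by (simp add: graded_free_def)
    qed
    then obtain v where v: "\<And>i. i < length as \<Longrightarrow> v i \<in> carrier E"
      "\<And>i. i < length as \<Longrightarrow> u i = b \<otimes>\<^bsub>E\<^esub> v i"
      by metis
    show ?thesis
    proof (rule bexI[of _ "restrict v {..<length as}"])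
      show "u = b \<odot>\<^bsub>graded_free E as\<^esub> restrict v {..<length as}"
        using u(1) v(2) by (auto simp: graded_free_def fun_eq_iff PiE_def extensional_def)
    qed (use v in \<open>auto simp: graded_free_def\<close>)
  qed
  show ?thesis
    using assms half[of d e] half[of e d] unfolding exact_pair_def by (auto simp: regular_left_def)
qed

lemma graded_hom_simps:
  assumes "f \<in> graded_hom E n M N"
  shows "x \<in> carrier M \<Longrightarrow> f x \<in> carrier N"
    and "x \<in> carrier M \<Longrightarrow> y \<in> carrier M \<Longrightarrow> f (x \<oplus>\<^bsub>M\<^esub> y) = f x \<oplus>\<^bsub>N\<^esub> f y"
    and "e \<in> carrier E \<Longrightarrow> x \<in> carrier M \<Longrightarrow> f (e \<odot>\<^bsub>M\<^esub> x) = e \<odot>\<^bsub>N\<^esub> f x"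
    and "x \<in> homog M m \<Longrightarrow> f x \<in> homog N (m + n)"
  using assms unfolding graded_hom_def by blast+

lemma graded_hom_zero:
  assumes "f \<in> graded_hom E n M N" "abelian_group M" "abelian_group N"
  shows "f \<zero>\<^bsub>M\<^esub> = \<zero>\<^bsub>N\<^esub>"
proof -
  interpret M: abelian_group M by fact
  interpret N: abelian_group N by fact
  show ?thesis
    using graded_hom_simps(1,2)[OF assms(1), of "\<zero>\<^bsub>M\<^esub>"] by (metis M.r_zero M.zero_closed N.add.r_cancel_one)
qed

lemma graded_free_simps:
  "carrier (graded_free E as) = (\<Pi>\<^sub>E i \<in> {..<length as}. carrier E)"
  "zero (graded_free E as) = (\<lambda>i\<in>{..<length as}. \<zero>\<^bsub>E\<^esub>)"
  "add (graded_free E as) f g = (\<lambda>i\<in>{..<length as}. f i \<oplus>\<^bsub>E\<^esub> g i)"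
  "smult (graded_free E as) e f = (\<lambda>i\<in>{..<length as}. e \<otimes>\<^bsub>E\<^esub> f i)"
  by (simp_all add: graded_free_def)

lemma graded_free_abelian_group:
  assumes "ring E" shows "abelian_group (graded_free E as)"
proof -
  interpret E: ring E by fact
  let ?I = "{..<length as}" and ?F = "graded_free E as"
  have mem: "x i \<in> carrier E" if "x \<in> carrier ?F" "i \<in> ?I" for x i
    using that unfolding graded_free_simps by (rule PiE_mem)
  show ?thesis
  proof (rule abelian_groupI)
    fix x y assume x: "x \<in> carrier ?F" and y: "y \<in> carrier ?F"
    show "x \<oplus>\<^bsub>?F\<^esub> y \<in> carrier ?F"
      unfolding graded_free_simps(1,3) using mem x y by (simp add: restrict_PiE_iff)
    show "x \<oplus>\<^bsub>?F\<^esub> y = y \<oplus>\<^bsub>?F\<^esub> x"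
      unfolding graded_free_simps(3) using mem x y by (intro restrict_ext E.a_comm)
    fix z assume z: "z \<in> carrier ?F"
    show "x \<oplus>\<^bsub>?F\<^esub> y \<oplus>\<^bsub>?F\<^esub> z = x \<oplus>\<^bsub>?F\<^esub> (y \<oplus>\<^bsub>?F\<^esub> z)"
      unfolding graded_free_simps(3) using mem[OF x] mem[OF y] mem[OF z]
      by (intro restrict_ext) (simp add: E.a_assoc)
  next
    fix x assume x: "x \<in> carrier ?F"
    have "\<zero>\<^bsub>?F\<^esub> \<oplus>\<^bsub>?F\<^esub> x = restrict x ?I"
      unfolding graded_free_simps(2,3) using mem[OF x] by (intro restrict_ext) simp
    also have "\<dots> = x" using x unfolding graded_free_simps by (rule PiE_restrict)
    finally show "\<zero>\<^bsub>?F\<^esub> \<oplus>\<^bsub>?F\<^esub> x = x" .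
    show "\<exists>y\<in>carrier ?F. y \<oplus>\<^bsub>?F\<^esub> x = \<zero>\<^bsub>?F\<^esub>"
    proof (rule bexI)
      show "(\<lambda>i\<in>?I. \<ominus>\<^bsub>E\<^esub> x i) \<oplus>\<^bsub>?F\<^esub> x = \<zero>\<^bsub>?F\<^esub>"
        unfolding graded_free_simps(2,3) using mem[OF x] by (intro restrict_ext) (simp add: E.l_neg)
      show "(\<lambda>i\<in>?I. \<ominus>\<^bsub>E\<^esub> x i) \<in> carrier ?F"
        unfolding graded_free_simps(1) using mem[OF x] by (simp add: restrict_PiE_iff)
    qed
  qed (simp add: graded_free_simps restrict_PiE_iff)
qed

text \<open>Exactness passes to retracts: if a kills u, it kills \<open>i u\<close>, so
  \<open>i u\<close> is b times some v in the free module, and applying \<open>r\<close> gives u as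
  b times \<open>r v\<close>.\<close>

lemma exact_pair_projective:
  assumes "ring E" and P: "fg_graded_projective E P"
    and d: "d \<in> carrier E" and e: "e \<in> carrier E"
    and "exact_pair (regular_left E) (carrier E) d e"
  shows "exact_pair P (carrier P) d e"
proof -
  obtain as i r where i: "i \<in> graded_hom E 0 P (graded_free E as)"
    and r: "r \<in> graded_hom E 0 (graded_free E as) P"
    and ri: "\<And>x. x \<in> carrier P \<Longrightarrow> r (i x) = x"
    using P unfolding fg_graded_projective_def by blast
  interpret P: graded_left_module E P using P unfolding fg_graded_projective_def by blast
  let ?F = "graded_free E as"
  have F: "exact_pair ?F (carrier ?F) d e" by (rule exact_pair_free) fact
  have half: "\<exists>v\<in>carrier P. u = b \<odot>\<^bsub>P\<^esub> v"
    if u: "u \<in> carrier P" "a \<odot>\<^bsub>P\<^esub> u = \<zero>\<^bsub>P\<^esub>" and ab: "a \<in> carrier E" "b \<in> carrier E"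
      and ex: "\<And>u. u \<in> carrier ?F \<Longrightarrow> a \<odot>\<^bsub>?F\<^esub> u = \<zero>\<^bsub>?F\<^esub> \<Longrightarrow> \<exists>v\<in>carrier ?F. u = b \<odot>\<^bsub>?F\<^esub> v"
    for a b u
  proof -
    have "a \<odot>\<^bsub>?F\<^esub> i u = i \<zero>\<^bsub>P\<^esub>" using graded_hom_simps(3)[OF i ab(1) u(1)] u(2) by simp
    then have "a \<odot>\<^bsub>?F\<^esub> i u = \<zero>\<^bsub>?F\<^esub>"
      using graded_hom_zero[OF i P.abelian_group_axioms graded_free_abelian_group[OF \<open>ring E\<close>]] by simp
    then obtain v where v: "v \<in> carrier ?F" "i u = b \<odot>\<^bsub>?F\<^esub> v"
      using ex graded_hom_simps(1)[OF i u(1)] by blast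
    then have "u = b \<odot>\<^bsub>P\<^esub> r v" using graded_hom_simps(3)[OF r ab(2) v(1)] ri[OF u(1)] by simp
    then show ?thesis using graded_hom_simps(1)[OF r v(1)] by blast
  qed
  show ?thesis
    unfolding exact_pair_def using F half[of _ d e] half[of _ e d] d e unfolding exact_pair_def by meson
qed

text \<open>
  The pair \<open>d, e\<close> computes a two-periodic homology, and the long exact sequence reduces to
  this dimension shift.
\<close>

lemma exact_pair_image:
  assumes "ring E" "graded_left_module E P" "abelian_group N"
    and f: "f \<in> graded_hom E 0 P N"
    and d: "d \<in> carrier E" and e: "e \<in> carrier E"
    and de: "d \<otimes>\<^bsub>E\<^esub> e = \<zero>\<^bsub>E\<^esub>" "e \<otimes>\<^bsub>E\<^esub> d = \<zero>\<^bsub>E\<^esub>"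
    and P: "exact_pair P (carrier P) d e"
    and K: "exact_pair P {x \<in> carrier P. f x = \<zero>\<^bsub>N\<^esub>} d e"
  shows "exact_pair N (f ` carrier P) d e"
proof -
  interpret P: graded_left_module E P by fact
  interpret N: abelian_group N by fact
  let ?K = "{x \<in> carrier P. f x = \<zero>\<^bsub>N\<^esub>}"
  have half: "\<exists>v\<in>f ` carrier P. u = b \<odot>\<^bsub>N\<^esub> v"
    if u: "u \<in> f ` carrier P" "a \<odot>\<^bsub>N\<^esub> u = \<zero>\<^bsub>N\<^esub>" and a: "a \<in> carrier E" and b: "b \<in> carrier E"
      and ba: "b \<otimes>\<^bsub>E\<^esub> a = \<zero>\<^bsub>E\<^esub>"
      and exP: "\<And>u. u \<in> carrier P \<Longrightarrow> a \<odot>\<^bsub>P\<^esub> u = \<zero>\<^bsub>P\<^esub> \<Longrightarrow> \<exists>v\<in>carrier P. u = b \<odot>\<^bsub>P\<^esub> v"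
      and exK: "\<And>u. u \<in> ?K \<Longrightarrow> b \<odot>\<^bsub>P\<^esub> u = \<zero>\<^bsub>P\<^esub> \<Longrightarrow> \<exists>v\<in>?K. u = a \<odot>\<^bsub>P\<^esub> v"
    for a b u
  proof -
    \<comment> \<open>Lift u to p. Then a p lies in the kernel of f and is killed by b, so exactness
      of the kernel at the other position gives a p = a q with q in the kernel. Now a kills p - q,
      hence p - q = b v, and f maps it to u.\<close>
    obtain p where p: "p \<in> carrier P" "u = f p" using u(1) by blast
    have ap: "a \<odot>\<^bsub>P\<^esub> p \<in> carrier P" using P.smult_closed[OF a p(1)] .
    have "f (a \<odot>\<^bsub>P\<^esub> p) = \<zero>\<^bsub>N\<^esub>" using graded_hom_simps(3)[OF f a p(1)] u(2) p(2) by simp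
    moreover have "b \<odot>\<^bsub>P\<^esub> (a \<odot>\<^bsub>P\<^esub> p) = \<zero>\<^bsub>P\<^esub>"
      using P.smult_assoc[OF b a p(1)] ba P.smult_zero_l[OF \<open>ring E\<close> p(1)] by simp
    ultimately obtain q where q: "q \<in> carrier P" "f q = \<zero>\<^bsub>N\<^esub>" "a \<odot>\<^bsub>P\<^esub> p = a \<odot>\<^bsub>P\<^esub> q"
      using exK[of "a \<odot>\<^bsub>P\<^esub> p"] ap by blast
    have pq: "p \<ominus>\<^bsub>P\<^esub> q \<in> carrier P" using p(1) q(1) by (rule P.minus_closed)
    have "a \<odot>\<^bsub>P\<^esub> (p \<ominus>\<^bsub>P\<^esub> q) = \<zero>\<^bsub>P\<^esub>"
      using p(1) q a ap by (simp add: a_minus_def P.smult_r_distr P.smult_minus_r P.r_neg)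
    then obtain v where v: "v \<in> carrier P" "p \<ominus>\<^bsub>P\<^esub> q = b \<odot>\<^bsub>P\<^esub> v" using exP pq by blast
    have "p = (p \<ominus>\<^bsub>P\<^esub> q) \<oplus>\<^bsub>P\<^esub> q" using p(1) q(1) by (simp add: a_minus_def P.a_assoc P.l_neg)
    then have "f p = f (p \<ominus>\<^bsub>P\<^esub> q) \<oplus>\<^bsub>N\<^esub> f q" using graded_hom_simps(2)[OF f pq q(1)] by simp
    then have "u = f (b \<odot>\<^bsub>P\<^esub> v)"
      using p(2) q(2) v(2) graded_hom_simps(1)[OF f pq] by simp
    then have "u = b \<odot>\<^bsub>N\<^esub> f v" using graded_hom_simps(3)[OF f b v(1)] by simp
    then show ?thesis using v(1) by blast
  qed
  show ?thesis
    unfolding exact_pair_def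
  proof (intro conjI ballI impI)
    fix u assume u: "u \<in> f ` carrier P"
    { assume "d \<odot>\<^bsub>N\<^esub> u = \<zero>\<^bsub>N\<^esub>"
      then show "\<exists>v\<in>f ` carrier P. u = e \<odot>\<^bsub>N\<^esub> v"
        by (rule half[OF u _ d e de(2)]) (use P K in \<open>(unfold exact_pair_def, blast)+\<close>) }
    { assume "e \<odot>\<^bsub>N\<^esub> u = \<zero>\<^bsub>N\<^esub>"
      then show "\<exists>v\<in>f ` carrier P. u = d \<odot>\<^bsub>N\<^esub> v"
        by (rule half[OF u _ e d de(1)]) (use P K in \<open>(unfold exact_pair_def, blast)+\<close>) }
  qed
qed

text \<open>Beyond the length of the resolution the image of the differential is zero, where
  exactness is trivial. Since the kernel of each differential is the image of the next,
  \<open>exact_pair_image\<close> carries exactness down to the kernel of \<open>\<epsilon>\<close>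
  and then to N.\<close>

lemma exact_pair_resolved:
  assumes E: "ring E" and N: "abelian_group N"
    and res: "finite_fg_projective_resolution E N P \<delta> \<epsilon>"
    and d: "d \<in> carrier E" and e: "e \<in> carrier E"
    and de: "d \<otimes>\<^bsub>E\<^esub> e = \<zero>\<^bsub>E\<^esub>" "e \<otimes>\<^bsub>E\<^esub> d = \<zero>\<^bsub>E\<^esub>"
    and reg: "exact_pair (regular_left E) (carrier E) d e"
  shows "exact_pair N (carrier N) d e"
proof -
  note res = res[unfolded finite_fg_projective_resolution_def]
  have proj: "fg_graded_projective E (P i)" for i
    by (rule res[THEN conjunct1, rule_format])
  have M: "graded_left_module E (P i)" for i
    using proj[of i] unfolding fg_graded_projective_def by (rule conjunct1)
  then have ab: "abelian_group (P i)" for i by (rule graded_left_module.axioms)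
  from res[THEN conjunct2, THEN conjunct1] obtain l
    where l: "\<And>i. i > l \<Longrightarrow> carrier (P i) = {\<zero>\<^bsub>P i\<^esub>}"
    by (elim exE) blast
  note res = res[THEN conjunct2, THEN conjunct2]
  have \<delta>: "\<delta> i \<in> graded_hom E 0 (P (Suc i)) (P i)" for i
    by (rule res[THEN conjunct1, rule_format])
  have ker: "{x \<in> carrier (P (Suc i)). \<delta> i x = \<zero>\<^bsub>P i\<^esub>} = \<delta> (Suc i) ` carrier (P (Suc (Suc i)))" for i
    by (rule res[THEN conjunct2, THEN conjunct2, THEN conjunct2, THEN conjunct2, rule_format])
  have P: "exact_pair (P i) (carrier (P i)) d e" for i
    by (rule exact_pair_projective[OF E proj d e reg])
  let ?C = "\<lambda>i. exact_pair (P i) (\<delta> i ` carrier (P (Suc i))) d e"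
  have step: "?C i" if "?C (Suc i)" for i
    by (rule exact_pair_image[OF E M ab \<delta> d e de P]) (use that ker in simp)
  have "?C (Suc l)"
  proof -
    interpret P: graded_left_module E "P (Suc l)" by (rule M)
    have "\<delta> (Suc l) ` carrier (P (Suc (Suc l))) = {\<zero>\<^bsub>P (Suc l)\<^esub>}"
      using l[of "Suc (Suc l)"] graded_hom_zero[OF \<delta> ab ab] by simp
    then show ?thesis unfolding exact_pair_def using P.smult_zero_r d e by simp
  qed
  moreover have "?C m \<Longrightarrow> ?C 0" for m
    by (induction m) (blast intro: step)+
  ultimately have "?C 0" by blast
  then have "exact_pair (P 0) {x \<in> carrier (P 0). \<epsilon> x = \<zero>\<^bsub>N\<^esub>} d e"
    unfolding res[THEN conjunct2, THEN conjunct2, THEN conjunct2, THEN conjunct1] by simp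
  from exact_pair_image[OF E M N res[THEN conjunct2, THEN conjunct1] d e de P this]
  show ?thesis unfolding res[THEN conjunct2, THEN conjunct2, THEN conjunct1] .
qed

section \<open>Commuting elements and the factors of a difference of cubes\<close>

context ring
begin

text \<open>The ring is noncommutative, so the expansion is done by distributivity alone; afterwards
  the rule \<open>c\<close> moves K past L inside longer products and the mixed terms
  cancel.\<close>

lemma difference_of_cubes:
  assumes L: "L \<in> carrier R" and K: "K \<in> carrier R" and comm: "K \<otimes> L = L \<otimes> K"
  shows "(L \<ominus> K) \<otimes> (L \<otimes> L \<oplus> L \<otimes> K \<oplus> K \<otimes> K) = L \<otimes> (L \<otimes> L) \<ominus> K \<otimes> (K \<otimes> K)" (is ?l)
    and "(L \<otimes> L \<oplus> L \<otimes> K \<oplus> K \<otimes> K) \<otimes> (L \<ominus> K) = L \<otimes> (L \<otimes> L) \<ominus> K \<otimes> (K \<otimes> K)" (is ?r)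
proof -
  have c: "K \<otimes> (L \<otimes> z) = L \<otimes> (K \<otimes> z)" if "z \<in> carrier R" for z
    using L K comm that by (metis m_assoc)
  have cancel: "p \<oplus> q \<oplus> r \<ominus> (q \<oplus> r \<oplus> t) = p \<ominus> t"
    if "p \<in> carrier R" "q \<in> carrier R" "r \<in> carrier R" "t \<in> carrier R" for p q r t
    using that by algebra
  have "(L \<ominus> K) \<otimes> (L \<otimes> L \<oplus> L \<otimes> K \<oplus> K \<otimes> K) =
      L \<otimes> (L \<otimes> L) \<oplus> L \<otimes> (L \<otimes> K) \<oplus> L \<otimes> (K \<otimes> K) \<ominus>
      (K \<otimes> (L \<otimes> L) \<oplus> K \<otimes> (L \<otimes> K) \<oplus> K \<otimes> (K \<otimes> K))"
    using L K by algebra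
  then show ?l using L K by (simp add: c comm cancel)
  have "(L \<otimes> L \<oplus> L \<otimes> K \<oplus> K \<otimes> K) \<otimes> (L \<ominus> K) =
      L \<otimes> (L \<otimes> L) \<oplus> L \<otimes> (K \<otimes> L) \<oplus> K \<otimes> (K \<otimes> L) \<ominus>
      (L \<otimes> (L \<otimes> K) \<oplus> L \<otimes> (K \<otimes> K) \<oplus> K \<otimes> (K \<otimes> K))"
    using L K by algebra
  then show ?r using L K by (simp add: c comm cancel)
qed

text \<open>\<open>\<Lambda>\<close> stands for the coefficient of L^2 and \<open>split\<close> is
  the expansion of u in 1, L, L^2. If L u = K u, each L under \<open>\<Lambda>\<close> can be
  replaced by K and pulled out, which turns \<open>split\<close> into the first claim. In the
  second, applying \<open>\<Lambda>\<close> to the hypothesis gives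
  \<open>\<Lambda>(L L u) + K \<Lambda>(L u) + K K \<Lambda> u = 0\<close>; subtracted from
  \<open>split\<close>, this leaves a multiple of L - K.\<close>

lemma cube_zero_exact:
  assumes L: "L \<in> carrier R" and K: "K \<in> carrier R" and comm: "K \<otimes> L = L \<otimes> K"
    and \<Lambda>: "\<And>u. u \<in> carrier R \<Longrightarrow> \<Lambda> u \<in> carrier R"
    and \<Lambda>_add: "\<And>u v. u \<in> carrier R \<Longrightarrow> v \<in> carrier R \<Longrightarrow> \<Lambda> (u \<oplus> v) = \<Lambda> u \<oplus> \<Lambda> v"
    and \<Lambda>K: "\<And>u. u \<in> carrier R \<Longrightarrow> \<Lambda> (K \<otimes> u) = K \<otimes> \<Lambda> u"
    and split: "\<And>u. u \<in> carrier R \<Longrightarrow>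
      \<Lambda> (L \<otimes> (L \<otimes> u)) \<oplus> L \<otimes> \<Lambda> (L \<otimes> u) \<oplus> L \<otimes> (L \<otimes> \<Lambda> u) = u"
    and u: "u \<in> carrier R"
  shows "(L \<ominus> K) \<otimes> u = \<zero> \<Longrightarrow> u = (L \<otimes> L \<oplus> L \<otimes> K \<oplus> K \<otimes> K) \<otimes> \<Lambda> u"
    and "(L \<otimes> L \<oplus> L \<otimes> K \<oplus> K \<otimes> K) \<otimes> u = \<zero> \<Longrightarrow>
      u = (L \<ominus> K) \<otimes> ((L \<oplus> K) \<otimes> \<Lambda> u \<oplus> \<Lambda> (L \<otimes> u))"
proof -
  have c: "K \<otimes> (L \<otimes> z) = L \<otimes> (K \<otimes> z)" if "z \<in> carrier R" for z
    using L K comm that by (metis m_assoc)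
  note closed = L K u \<Lambda> \<Lambda>[OF u]
  {
    assume "(L \<ominus> K) \<otimes> u = \<zero>"
    then have "L \<otimes> u \<ominus> K \<otimes> u = \<zero>" using closed by (simp add: a_minus_def l_distr l_minus)
    moreover have "K \<otimes> u = L \<otimes> u \<ominus> (L \<otimes> u \<ominus> K \<otimes> u)" using L K u by algebra
    ultimately have LK: "K \<otimes> u = L \<otimes> u" using L u by (simp add: a_minus_def)
    have "(L \<otimes> L \<oplus> L \<otimes> K \<oplus> K \<otimes> K) \<otimes> \<Lambda> u =
        K \<otimes> (K \<otimes> \<Lambda> u) \<oplus> L \<otimes> (K \<otimes> \<Lambda> u) \<oplus> L \<otimes> (L \<otimes> \<Lambda> u)"
      using closed by algebra
    also have "\<dots> = \<Lambda> (L \<otimes> (L \<otimes> u)) \<oplus> L \<otimes> \<Lambda> (L \<otimes> u) \<oplus> L \<otimes> (L \<otimes> \<Lambda> u)"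
      using closed by (simp add: \<Lambda>K[symmetric] LK c)
    also have "\<dots> = u" by (rule split[OF u])
    finally show "u = (L \<otimes> L \<oplus> L \<otimes> K \<oplus> K \<otimes> K) \<otimes> \<Lambda> u" ..
  }
  {
    assume 0: "(L \<otimes> L \<oplus> L \<otimes> K \<oplus> K \<otimes> K) \<otimes> u = \<zero>"
    have \<Lambda>0: "\<Lambda> \<zero> = \<zero>" using \<Lambda>_add[of \<zero> \<zero>] \<Lambda>[of \<zero>] by simp
    have LLu: "\<Lambda> (L \<otimes> (L \<otimes> u)) \<oplus> K \<otimes> \<Lambda> (L \<otimes> u) \<oplus> K \<otimes> (K \<otimes> \<Lambda> u) = \<zero>"
    proof -
      have "\<Lambda> (L \<otimes> (L \<otimes> u)) \<oplus> K \<otimes> \<Lambda> (L \<otimes> u) \<oplus> K \<otimes> (K \<otimes> \<Lambda> u) =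
          \<Lambda> (L \<otimes> (L \<otimes> u) \<oplus> L \<otimes> (K \<otimes> u) \<oplus> K \<otimes> (K \<otimes> u))"
        using closed by (simp add: \<Lambda>_add \<Lambda>K[symmetric] c)
      also have "L \<otimes> (L \<otimes> u) \<oplus> L \<otimes> (K \<otimes> u) \<oplus> K \<otimes> (K \<otimes> u) = \<zero>"
        using closed 0 by (simp add: l_distr m_assoc)
      finally show ?thesis by (simp add: \<Lambda>0)
    qed
    let ?a = "\<Lambda> (L \<otimes> (L \<otimes> u))" and ?b = "\<Lambda> (L \<otimes> u)" and ?c = "\<Lambda> u"
    have abc: "?a \<in> carrier R" "?b \<in> carrier R" "?c \<in> carrier R" using closed by simp_all
    have "(L \<ominus> K) \<otimes> ((L \<oplus> K) \<otimes> ?c \<oplus> ?b) =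
        (L \<otimes> (L \<otimes> ?c) \<oplus> L \<otimes> (K \<otimes> ?c) \<oplus> L \<otimes> ?b)
        \<ominus> (K \<otimes> (L \<otimes> ?c) \<oplus> K \<otimes> (K \<otimes> ?c) \<oplus> K \<otimes> ?b)"
      using abc L K by algebra
    also have "K \<otimes> (L \<otimes> ?c) = L \<otimes> (K \<otimes> ?c)" by (rule c) (rule abc)
    also have "(L \<otimes> (L \<otimes> ?c) \<oplus> L \<otimes> (K \<otimes> ?c) \<oplus> L \<otimes> ?b)
        \<ominus> (L \<otimes> (K \<otimes> ?c) \<oplus> K \<otimes> (K \<otimes> ?c) \<oplus> K \<otimes> ?b) =
        (?a \<oplus> L \<otimes> ?b \<oplus> L \<otimes> (L \<otimes> ?c)) \<ominus> (?a \<oplus> K \<otimes> ?b \<oplus> K \<otimes> (K \<otimes> ?c))"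
      using abc L K by algebra
    also have "\<dots> = u" using split[OF u] LLu u by (simp add: a_minus_def)
    finally show "u = (L \<ominus> K) \<otimes> ((L \<oplus> K) \<otimes> ?c \<oplus> ?b)" ..
  }
qed

end

section \<open>The enveloping algebra and its action on the algebra\<close>

locale enveloping = graded_algebra S for S :: "('k::field, 'a) graded" (structure)
begin

sublocale T: tensor_product "op_alg S" S
  by (intro tensor_product.intro op_graded_algebra) unfold_locales

abbreviation env_mult (infixl \<open>\<boxtimes>\<close> 70) where "e \<boxtimes> e' \<equiv> e \<otimes>\<^bsub>T.E\<^esub> e'"
abbreviation env_add (infixl \<open>\<boxplus>\<close> 65) where "e \<boxplus> e' \<equiv> e \<oplus>\<^bsub>T.E\<^esub> e'"
abbreviation env_minus (infixl \<open>\<boxminus>\<close> 65) where "e \<boxminus> e' \<equiv> e \<ominus>\<^bsub>T.E\<^esub> e'"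
abbreviation env_action (infixl \<open>\<triangleright>\<close> 75) where "e \<triangleright> s \<equiv> e \<odot>\<^bsub>env_left S\<^esub> s"

lemma op_alg_simps [simp]:
  "carrier (op_alg S) = carrier S" "one (op_alg S) = one S" "zero (op_alg S) = zero S"
  "add (op_alg S) = add S" "smult (op_alg S) = smult S" "homog (op_alg S) = homog S"
  "a \<otimes>\<^bsub>op_alg S\<^esub> b = b \<otimes> a"
  by (simp_all add: op_alg_def)

lemma env_alg_eq: "env_alg S = tensor_alg (op_alg S) S"
  by (simp add: env_alg_def)

lemma env_left_simps [simp]:
  "carrier (env_left S) = carrier S" "zero (env_left S) = zero S" "add (env_left S) = add S"
  "homog (env_left S) = homog S"
  by (simp_all add: env_left_def)

lemma env_left_abelian_group: "abelian_group (env_left S)"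
  by (rule abelian_groupI) (use l_neg in \<open>auto intro: a_assoc a_comm\<close>)

lemma action_map:
  assumes s: "s \<in> carrier S"
  shows "tensor_map (op_alg S) S S (\<lambda>c a b. c \<odot> (b \<otimes> s \<otimes> a))"
  by unfold_locales
    (use s in \<open>simp_all add: smult_closed smult_l_distr smult_r_distr smult_mult_l smult_mult_r
      l_distr r_distr smult_assoc\<close>)

lemma action_ext:
  assumes s: "s \<in> carrier S"
  shows "e \<triangleright> s = tensor_map.ext S (\<lambda>c a b. c \<odot> (b \<otimes> s \<otimes> a)) e"
proof -
  interpret tensor_map "op_alg S" S S "\<lambda>c a b. c \<odot> (b \<otimes> s \<otimes> a)" by (rule action_map[OF s])
  show ?thesis by (simp add: ext_def tsum_def env_left_def Let_def case_prod_beta)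
qed

lemma action_closed:
  assumes "e \<in> carrier T.E" "s \<in> carrier S" shows "e \<triangleright> s \<in> carrier S"
proof -
  interpret M: tensor_map "op_alg S" S S "\<lambda>c a b. c \<odot> (b \<otimes> s \<otimes> a)"
    by (rule action_map[OF assms(2)])
  show ?thesis using assms M.ext_closed by (simp add: action_ext)
qed

lemma action_add:
  assumes "e \<in> carrier T.E" "e' \<in> carrier T.E" "s \<in> carrier S"
  shows "(e \<boxplus> e') \<triangleright> s = e \<triangleright> s \<oplus> e' \<triangleright> s"
proof -
  interpret M: tensor_map "op_alg S" S S "\<lambda>c a b. c \<odot> (b \<otimes> s \<otimes> a)"
    by (rule action_map[OF assms(3)])
  show ?thesis using assms M.ext_add by (simp add: action_ext)
qed

text \<open>The factor from the opposite algebra acts on the right. Thus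
  \<open>pure 1 \<one> x\<close> acts as left multiplication by x and \<open>pure 1 x \<one>\<close>
  as right multiplication, the convention behind all later formulas.\<close>

lemma action_pure:
  assumes "a \<in> carrier S" "b \<in> carrier S" "s \<in> carrier S"
  shows "T.pure c a b \<triangleright> s = c \<odot> (b \<otimes> s \<otimes> a)"
proof -
  interpret M: tensor_map "op_alg S" S S "\<lambda>c a b. c \<odot> (b \<otimes> s \<otimes> a)"
    by (rule action_map[OF assms(3)])
  show ?thesis using assms M.ext_pure by (simp add: action_ext)
qed

lemma action_minus:
  assumes "e \<in> carrier T.E" "e' \<in> carrier T.E" "s \<in> carrier S"
  shows "(e \<boxminus> e') \<triangleright> s = e \<triangleright> s \<ominus> e' \<triangleright> s"
proof -
  have "(e \<boxminus> e') \<boxplus> e' = e"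
    using assms by (simp add: a_minus_def T.E.a_assoc T.E.l_neg)
  then have "(e \<boxminus> e') \<triangleright> s \<oplus> e' \<triangleright> s = e \<triangleright> s"
    using action_add[of "e \<boxminus> e'" e' s] assms by simp
  then show ?thesis
    using action_closed assms T.E.minus_closed
    by (metis add.inv_solve_right minus_eq)
qed

text \<open>
  Let \<open>x\<^sup>3 = 0\<close> and let \<open>S\<close> be free as a left module over $k[x]/(x^3)$, with
  \<open>\<kappa>\<close> extracting the coefficient of \<open>x\<^sup>2\<close>. The enveloping algebra is then
  free over $k[x]/(x^3) \otimes k[x]/(x^3)$, where the differences and
  \<open>x\<^sup>2 \<otimes> 1 + x \<otimes> x + 1 \<otimes> x\<^sup>2\<close> annihilate each other exactly.
\<close>

lemma cube_zero_not_resolved: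
  assumes x: "x \<in> carrier S" and x3: "x \<otimes> (x \<otimes> x) = \<zero>"
    and \<kappa>: "\<And>s. s \<in> carrier S \<Longrightarrow> \<kappa> s \<in> carrier S"
    and \<kappa>_add: "\<And>s t. s \<in> carrier S \<Longrightarrow> t \<in> carrier S \<Longrightarrow> \<kappa> (s \<oplus> t) = \<kappa> s \<oplus> \<kappa> t"
    and \<kappa>_smult: "\<And>c s. s \<in> carrier S \<Longrightarrow> \<kappa> (c \<odot> s) = c \<odot> \<kappa> s"
    and split: "\<And>s. s \<in> carrier S \<Longrightarrow>
      \<kappa> (x \<otimes> (x \<otimes> s)) \<oplus> x \<otimes> \<kappa> (x \<otimes> s) \<oplus> x \<otimes> (x \<otimes> \<kappa> s) = s"
    and unit: "\<And>s. s \<in> carrier S \<Longrightarrow> \<one> \<noteq> (x \<otimes> x) \<otimes> s \<oplus> x \<otimes> s \<otimes> x \<oplus> s \<otimes> (x \<otimes> x)"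
  shows "\<not> finite_fg_projective_resolution (env_alg S) (env_left S) P \<delta> \<epsilon>"
proof
  assume res: "finite_fg_projective_resolution (env_alg S) (env_left S) P \<delta> \<epsilon>"
  \<comment> \<open>The map id tensor \<open>\<kappa>\<close>; it extracts the coefficient of the
    square of \<open>?L\<close> in the enveloping algebra.\<close>
  interpret M: tensor_map "op_alg S" S T.E "\<lambda>c a b. T.pure c a (\<kappa> b)"
  proof unfold_locales
    fix a b :: 'a and c d :: 'k
    assume ab: "a \<in> carrier (op_alg S)" "b \<in> carrier S"
    then show "T.pure c a (\<kappa> b) \<in> carrier T.E" by (intro T.pure_closed \<kappa>)
    show "T.pure (c + d) a (\<kappa> b) = T.pure c a (\<kappa> b) \<boxplus> T.pure d a (\<kappa> b)"
      using ab by (intro T.pure_add_coeff \<kappa>)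
    show "T.pure c (d \<odot>\<^bsub>op_alg S\<^esub> a) (\<kappa> b) = T.pure (c * d) a (\<kappa> b)"
      using ab by (intro T.pure_smult_l \<kappa>)
    show "T.pure c a (\<kappa> (d \<odot> b)) = T.pure (c * d) a (\<kappa> b)"
      using ab by (simp add: \<kappa>_smult T.pure_smult_r \<kappa>)
  next
    fix a a' b c
    assume "a \<in> carrier (op_alg S)" "a' \<in> carrier (op_alg S)" "b \<in> carrier S"
    then show "T.pure c (a \<oplus>\<^bsub>op_alg S\<^esub> a') (\<kappa> b) = T.pure c a (\<kappa> b) \<boxplus> T.pure c a' (\<kappa> b)"
      by (intro T.pure_add_l \<kappa>)
  next
    fix a b b' c
    assume "a \<in> carrier (op_alg S)" "b \<in> carrier S" "b' \<in> carrier S"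
    then show "T.pure c a (\<kappa> (b \<oplus> b')) = T.pure c a (\<kappa> b) \<boxplus> T.pure c a (\<kappa> b')"
      by (simp add: \<kappa>_add T.pure_add_r \<kappa>)
  qed
  let ?L = "T.pure 1 \<one> x" and ?R = "T.pure 1 x \<one>" and ?\<Lambda> = "M.ext"
  let ?d = "?L \<boxminus> ?R"
    and ?e = "?L \<boxtimes> ?L \<boxplus> ?L \<boxtimes> ?R \<boxplus> ?R \<boxtimes> ?R"
  have L: "?L \<in> carrier T.E" and R: "?R \<in> carrier T.E" using x by (simp_all add: T.pure_closed)
  have LR: "?R \<boxtimes> ?L = ?L \<boxtimes> ?R" using x by (simp add: T.pure_mult)
  have L3: "?L \<boxtimes> (?L \<boxtimes> ?L) = \<zero>\<^bsub>T.E\<^esub>"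
    using x x3 by (simp add: T.pure_mult T.pure_zero_r)
  have R3: "?R \<boxtimes> (?R \<boxtimes> ?R) = \<zero>\<^bsub>T.E\<^esub>"
    using x x3 T.pure_zero_l[of "\<one>"] by (simp add: T.pure_mult m_assoc)
  have d: "?d \<in> carrier T.E" and e: "?e \<in> carrier T.E" using L R by simp_all
  have de: "?d \<boxtimes> ?e = ?L \<boxtimes> (?L \<boxtimes> ?L) \<boxminus> ?R \<boxtimes> (?R \<boxtimes> ?R)"
    by (rule T.E.difference_of_cubes(1)[OF L R LR])
  have ed: "?e \<boxtimes> ?d = ?L \<boxtimes> (?L \<boxtimes> ?L) \<boxminus> ?R \<boxtimes> (?R \<boxtimes> ?R)"
    by (rule T.E.difference_of_cubes(2)[OF L R LR])
  have \<Lambda>: "?\<Lambda> u \<in> carrier T.E" if "u \<in> carrier T.E" for u using that by (rule M.ext_closed)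
  \<comment> \<open>\<open>?R\<close> changes only the first tensor factor, \<open>\<Lambda>\<close>
    only the second.\<close>
  have \<Lambda>R: "?\<Lambda> (?R \<boxtimes> u) = ?R \<boxtimes> ?\<Lambda> u" if "u \<in> carrier T.E" for u
    using that
  proof (induction u rule: T.E_induct)
    case (pure a b c)
    then show ?case using x \<kappa> by (simp add: T.pure_mult M.ext_pure)
  next
    case (add u v)
    then show ?case using R by (simp add: T.E.r_distr M.ext_add \<Lambda>)
  qed
  have \<Lambda>L: "?\<Lambda> (?L \<boxtimes> (?L \<boxtimes> u)) \<boxplus> ?L \<boxtimes> ?\<Lambda> (?L \<boxtimes> u)
      \<boxplus> ?L \<boxtimes> (?L \<boxtimes> ?\<Lambda> u) = u"
    if "u \<in> carrier T.E" for u
    using that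
  proof (induction u rule: T.E_induct)
    case (pure a b c)
    then have ab: "a \<in> carrier S" "b \<in> carrier S" by simp_all
    have "T.pure c a (\<kappa> (x \<otimes> (x \<otimes> b))) \<boxplus> T.pure c a (x \<otimes> \<kappa> (x \<otimes> b))
      \<boxplus> T.pure c a (x \<otimes> (x \<otimes> \<kappa> b)) = T.pure c a b"
      using ab x \<kappa> split[OF ab(2)] by (simp add: T.pure_add_r[symmetric])
    then show ?case using ab x \<kappa> by (simp add: T.pure_mult M.ext_pure)
  next
    case (add u v)
    define f where "f u = ?\<Lambda> (?L \<boxtimes> (?L \<boxtimes> u))" for u
    define g where "g u = ?L \<boxtimes> ?\<Lambda> (?L \<boxtimes> u)" for u
    define h where "h u = ?L \<boxtimes> (?L \<boxtimes> ?\<Lambda> u)" for u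
    have closed: "f w \<in> carrier T.E" "g w \<in> carrier T.E" "h w \<in> carrier T.E"
      if "w \<in> carrier T.E" for w
      using that L \<Lambda> by (simp_all add: f_def g_def h_def)
    have "f (u \<boxplus> v) = f u \<boxplus> f v" "g (u \<boxplus> v) = g u \<boxplus> g v"
      "h (u \<boxplus> v) = h u \<boxplus> h v"
      unfolding f_def g_def h_def
      using add L \<Lambda> by (simp_all add: T.E.r_distr M.ext_add)
    then have "f (u \<boxplus> v) \<boxplus> g (u \<boxplus> v) \<boxplus> h (u \<boxplus> v)
        = (f u \<boxplus> g u \<boxplus> h u) \<boxplus> (f v \<boxplus> g v \<boxplus> h v)"
      using closed[OF add(1)] closed[OF add(2)] by (simp add: T.E.a_ac)
    then show ?case
      unfolding f_def g_def h_def by (simp only: add.IH)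
  qed
  have ex: "exact_pair (regular_left T.E) (carrier T.E) ?d ?e"
    unfolding exact_pair_def regular_left_def graded.simps module.simps ring.simps
  proof (intro conjI ballI impI)
    fix u assume u: "u \<in> carrier T.E"
    { assume 0: "?d \<boxtimes> u = \<zero>\<^bsub>T.E\<^esub>"
      have "u = ?e \<boxtimes> ?\<Lambda> u"
        by (rule T.E.cube_zero_exact(1)[OF L R LR _ _ _ _ u 0]; rule \<Lambda> M.ext_add \<Lambda>R \<Lambda>L; assumption)
      then show "\<exists>v\<in>carrier T.E. u = ?e \<boxtimes> v" using \<Lambda>[OF u] by blast }
    { assume 0: "?e \<boxtimes> u = \<zero>\<^bsub>T.E\<^esub>"
      have "u = ?d \<boxtimes> ((?L \<boxplus> ?R) \<boxtimes> ?\<Lambda> u \<boxplus> ?\<Lambda> (?L \<boxtimes> u))"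
        by (rule T.E.cube_zero_exact(2)[OF L R LR _ _ _ _ u 0]; rule \<Lambda> M.ext_add \<Lambda>R \<Lambda>L; assumption)
      then show "\<exists>v\<in>carrier T.E. u = ?d \<boxtimes> v"
        by (rule bexI) (use L R u \<Lambda> in simp) }
  qed
  \<comment> \<open>If S had such a resolution, the pair would be exact on S. Left and right
    multiplication by x agree on 1, so \<open>?d\<close> kills 1, and 1 would be a value of
    \<open>?e\<close>, which \<open>unit\<close> excludes.\<close>
  have "exact_pair (env_left S) (carrier (env_left S)) ?d ?e"
    using exact_pair_resolved[OF T.E_ring env_left_abelian_group _ d e _ _ ex] res de ed L3 R3
    by (simp add: env_alg_eq a_minus_def)
  moreover have "?d \<triangleright> \<one> = \<zero>"
    using x L R by (simp add: action_minus action_pure smult_one minus_eq r_neg)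
  ultimately obtain s where s: "s \<in> carrier S" "\<one> = ?e \<triangleright> s"
    unfolding exact_pair_def by auto
  have "?e \<triangleright> s = (x \<otimes> x) \<otimes> s \<oplus> x \<otimes> s \<otimes> x \<oplus> s \<otimes> (x \<otimes> x)"
    using x s(1) by (simp add: T.pure_mult T.pure_closed action_add action_pure smult_one)
  then show False using unit s by simp
qed

end

section \<open>Lifts through the multiplication map of the enveloping algebra\<close>

context enveloping
begin

lemma action_add_r:
  assumes "e \<in> carrier T.E" "s \<in> carrier S" "t \<in> carrier S"
  shows "e \<triangleright> (s \<oplus> t) = e \<triangleright> s \<oplus> e \<triangleright> t"
  using assms(1)
proof (induction e rule: T.E_induct)
  case (pure a b c)
  then show ?case using assms by (simp add: action_pure r_distr l_distr smult_r_distr)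
next
  case (add e e')
  then show ?case using assms by (simp add: action_add action_closed a_ac)
qed

lemma action_assoc:
  assumes "e \<in> carrier T.E" "e' \<in> carrier T.E" "s \<in> carrier S"
  shows "(e \<boxtimes> e') \<triangleright> s = e \<triangleright> (e' \<triangleright> s)"
  using assms(1)
proof (induction e rule: T.E_induct)
  case (pure a b c)
  note ab = pure
  from assms(2) show ?case
  proof (induction e' rule: T.E_induct)
    case (pure a' b' d)
    then show ?case
      using ab assms
      by (simp add: T.pure_mult action_pure smult_closed smult_mult_l smult_mult_r smult_assoc m_assoc)
  next
    case (add e e')
    then show ?case
      using ab assms by (simp add: T.E.r_distr T.pure_closed action_add action_add_r action_closed)
  qed
next
  case (add e f)
  then show ?case using assms by (simp add: T.E.l_distr action_add action_closed)
qed

text \<open>Projectivity of P applied to the surjection from the enveloping algebra to S that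
  evaluates at 1. The degree-preserving section sending s to \<open>pure 1 \<one> s\<close> makes
  the lift explicit on a free module, and P is a retract of one.\<close>

lemma lift_through_action:
  assumes "fg_graded_projective T.E P" and \<epsilon>: "\<epsilon> \<in> graded_hom T.E 0 P (env_left S)"
  obtains \<alpha> where "\<alpha> \<in> graded_hom T.E 0 P (regular_left T.E)"
    "\<And>p. p \<in> carrier P \<Longrightarrow> \<alpha> p \<triangleright> \<one> = \<epsilon> p"
proof -
  obtain as i r where i: "i \<in> graded_hom T.E 0 P (graded_free T.E as)"
    and r: "r \<in> graded_hom T.E 0 (graded_free T.E as) P"
    and ri: "\<And>x. x \<in> carrier P \<Longrightarrow> r (i x) = x"
    using assms(1) unfolding fg_graded_projective_def by blast
  interpret P: graded_left_module T.E P
    using assms(1) unfolding fg_graded_projective_def by (rule conjunct1)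
  let ?F = "graded_free T.E as" and ?I = "{..<length as}"
  define \<eta> where "\<eta> f = \<epsilon> (r f)" for f
  have \<eta>_closed: "\<eta> f \<in> carrier S" if "f \<in> carrier ?F" for f
    using graded_hom_simps(1)[OF \<epsilon> graded_hom_simps(1)[OF r that]] by (simp add: \<eta>_def)
  have \<eta>_add: "\<eta> (f \<oplus>\<^bsub>?F\<^esub> g) = \<eta> f \<oplus> \<eta> g" if "f \<in> carrier ?F" "g \<in> carrier ?F" for f g
    using that graded_hom_simps(1,2)[OF r] graded_hom_simps(2)[OF \<epsilon>] by (simp add: \<eta>_def)
  have \<eta>_smult: "\<eta> (e \<odot>\<^bsub>?F\<^esub> f) = e \<triangleright> \<eta> f" if "e \<in> carrier T.E" "f \<in> carrier ?F" for e f
    using that graded_hom_simps(1,3)[OF r] graded_hom_simps(3)[OF \<epsilon>] by (simp add: \<eta>_def)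
  have \<eta>_homog: "\<eta> f \<in> homog S n" if "f \<in> homog ?F n" for f n
    using graded_hom_simps(4)[OF \<epsilon> graded_hom_simps(4)[OF r that]] by (simp add: \<eta>_def)
  define b where "b j = (\<lambda>k\<in>?I. if k = j then \<one>\<^bsub>T.E\<^esub> else \<zero>\<^bsub>T.E\<^esub>)" for j
  have b: "b j \<in> carrier ?F" for j
    by (simp add: b_def graded_free_simps restrict_PiE_iff)
  have one_homog: "\<one>\<^bsub>T.E\<^esub> \<in> homog T.E 0"
    unfolding T.E_one using T.pure_homog[of \<one> 0 \<one> 0 1] homog_one by simp
  \<comment> \<open>A summand shifted by \<open>as ! j\<close> has E in degree n +
    \<open>as ! j\<close> as its part of degree n, so its generator 1 sits in degree minus
    \<open>as ! j\<close>.\<close>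
  have b_homog: "b j \<in> homog ?F (- (as ! j))" if "j < length as" for j
    using one_homog T.E_homog_zero by (auto simp: b_def graded_free_def)
  define t where "t j = T.pure 1 \<one> (\<eta> (b j))" for j
  have t: "t j \<in> carrier T.E" for j by (simp add: t_def T.pure_closed \<eta>_closed b)
  have t_homog: "t j \<in> homog T.E (- (as ! j))" if "j < length as" for j
    using T.pure_homog[of \<one> 0 "\<eta> (b j)" "- (as ! j)" 1] \<eta>_homog[OF b_homog[OF that]] homog_one
    by (simp add: t_def)
  define h where "h f = finsum T.E (\<lambda>j. f j \<boxtimes> t j) ?I" for f
  have mem: "f j \<in> carrier T.E" if "f \<in> carrier ?F" "j \<in> ?I" for f j
    using that unfolding graded_free_simps by (rule PiE_mem)
  have h_closed: "h f \<in> carrier T.E" if "f \<in> carrier ?F" for f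
    unfolding h_def using mem[OF that] t by (intro T.E.finsum_closed) auto
  have h_add: "h (f \<oplus>\<^bsub>?F\<^esub> g) = h f \<boxplus> h g" if "f \<in> carrier ?F" "g \<in> carrier ?F" for f g
  proof -
    have "h (f \<oplus>\<^bsub>?F\<^esub> g) = finsum T.E (\<lambda>j. f j \<boxtimes> t j \<boxplus> g j \<boxtimes> t j) ?I"
      unfolding h_def using mem[OF that(1)] mem[OF that(2)] t
      by (intro T.E.finsum_cong') (auto simp: graded_free_simps T.E.l_distr)
    also have "\<dots> = h f \<boxplus> h g"
      unfolding h_def using mem[OF that(1)] mem[OF that(2)] t by (intro T.E.finsum_addf) auto
    finally show ?thesis .
  qed
  have h_smult: "h (e \<odot>\<^bsub>?F\<^esub> f) = e \<boxtimes> h f" if "e \<in> carrier T.E" "f \<in> carrier ?F" for e f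
  proof -
    have "h (e \<odot>\<^bsub>?F\<^esub> f) = finsum T.E (\<lambda>j. e \<boxtimes> (f j \<boxtimes> t j)) ?I"
      unfolding h_def using mem[OF that(2)] that(1) t
      by (intro T.E.finsum_cong') (auto simp: graded_free_simps T.E.m_assoc)
    also have "\<dots> = e \<boxtimes> h f"
      unfolding h_def using mem[OF that(2)] that(1) t
      by (intro T.E.finsum_rdistr[symmetric]) auto
    finally show ?thesis .
  qed
  have h_homog: "h f \<in> homog T.E n" if "f \<in> homog ?F n" for f n
  proof -
    have f: "f j \<in> homog T.E (n + as ! j)" if "j < length as" for j
      using \<open>f \<in> homog ?F n\<close> that by (auto simp: graded_free_def)
    have ft: "f j \<boxtimes> t j \<in> homog T.E n" if "j < length as" for j
      using T.E_homog_mult[OF f t_homog] that by fastforce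
    have "finsum T.E (\<lambda>j. f j \<boxtimes> t j) {..<m} \<in> homog T.E n" if "m \<le> length as" for m
      using that
    proof (induction m)
      case (Suc m)
      have "finsum T.E (\<lambda>j. f j \<boxtimes> t j) {..<Suc m} =
          f m \<boxtimes> t m \<boxplus> finsum T.E (\<lambda>j. f j \<boxtimes> t j) {..<m}"
        unfolding lessThan_Suc using Suc.prems ft[THEN T.E_homog_closed]
        by (intro T.E.finsum_insert) auto
      then show ?case using Suc ft by (simp add: T.E_homog_add)
    qed (simp add: T.E_homog_zero)
    then show ?thesis unfolding h_def by blast
  qed
  have h_action: "h f \<triangleright> \<one> = \<eta> f" if f: "f \<in> carrier ?F" for f
  proof -
    \<comment> \<open>The truncation of f to its first m coordinates, so that the sum over the basis
      can be built by induction on m.\<close>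
    define tr where "tr m = (\<lambda>k\<in>?I. if k < m then f k else \<zero>\<^bsub>T.E\<^esub>)" for m
    have tr: "tr m \<in> carrier ?F" for m
      using mem[OF f] by (simp add: tr_def graded_free_simps restrict_PiE_iff)
    have "finsum T.E (\<lambda>j. f j \<boxtimes> t j) {..<m} \<triangleright> \<one> = \<eta> (tr m)"
      if "m \<le> length as" for m
      using that
    proof (induction m)
      case 0
      have "\<eta> (tr 0 \<oplus>\<^bsub>?F\<^esub> tr 0) = \<eta> (tr 0) \<oplus> \<eta> (tr 0)" by (rule \<eta>_add[OF tr tr])
      moreover have "tr 0 \<oplus>\<^bsub>?F\<^esub> tr 0 = tr 0"
        unfolding graded_free_simps tr_def by (intro restrict_ext) simp
      ultimately have "\<eta> (tr 0) = \<zero>" using \<eta>_closed[OF tr, of 0] by simp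
      moreover have "\<zero>\<^bsub>T.E\<^esub> \<triangleright> \<one> = \<zero>"
        using action_pure[of \<zero> \<one> \<one> 1] T.pure_zero_l[of \<one> 1] smult_one by simp
      ultimately show ?case by simp
    next
      case (Suc m)
      have m: "m \<in> ?I" using Suc.prems by simp
      have "tr (Suc m) = f m \<odot>\<^bsub>?F\<^esub> b m \<oplus>\<^bsub>?F\<^esub> tr m"
        unfolding graded_free_simps tr_def b_def using mem[OF f] m
        by (intro restrict_ext) (auto simp: less_Suc_eq)
      moreover have fb: "f m \<odot>\<^bsub>?F\<^esub> b m \<in> carrier ?F"
        using mem[OF f m] b[of m, unfolded graded_free_simps]
        by (auto simp add: graded_free_simps restrict_PiE_iff dest: PiE_mem)
      ultimately have "\<eta> (tr (Suc m)) = f m \<triangleright> \<eta> (b m) \<oplus> \<eta> (tr m)"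
        using \<eta>_add[OF fb tr] \<eta>_smult[OF mem[OF f m] b] by simp
      moreover have "f m \<triangleright> \<eta> (b m) = (f m \<boxtimes> t m) \<triangleright> \<one>"
        using mem[OF f m] t \<eta>_closed[OF b]
        by (simp add: action_assoc) (simp add: t_def action_pure smult_one)
      moreover have "finsum T.E (\<lambda>j. f j \<boxtimes> t j) {..<Suc m} =
          f m \<boxtimes> t m \<boxplus> finsum T.E (\<lambda>j. f j \<boxtimes> t j) {..<m}"
        unfolding lessThan_Suc using Suc.prems mem[OF f] t
        by (intro T.E.finsum_insert) auto
      moreover have "finsum T.E (\<lambda>j. f j \<boxtimes> t j) {..<m} \<in> carrier T.E"
        using Suc.prems mem[OF f] t by (intro T.E.finsum_closed) auto
      ultimately show ?case
        using Suc mem[OF f m] t by (simp add: action_add)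
    qed
    then have "h f \<triangleright> \<one> = \<eta> (tr (length as))" unfolding h_def by blast
    also have "tr (length as) = restrict f ?I" unfolding tr_def by (intro restrict_ext) simp
    also have "\<dots> = f" using f unfolding graded_free_simps by (rule PiE_restrict)
    finally show ?thesis .
  qed
  show thesis
  proof (rule that)
    show "(\<lambda>p. h (i p)) \<in> graded_hom T.E 0 P (regular_left T.E)"
      unfolding graded_hom_def
      using graded_hom_simps[OF i] h_closed h_add h_smult h_homog
      by (auto simp: regular_left_def)
    show "h (i p) \<triangleright> \<one> = \<epsilon> p" if "p \<in> carrier P" for p
      using h_action[OF graded_hom_simps(1)[OF i that]] ri[OF that] by (simp add: \<eta>_def)
  qed
qed

end

text \<open>An element of the dual is a finite sum of homogeneous homomorphisms of various degrees:
  it need not be homogeneous, but it is still linear.\<close>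

lemma graded_dual_hom:
  assumes "ring E" and f: "f \<in> carrier (graded_dual E P)"
  shows "x \<in> carrier P \<Longrightarrow> f x \<in> carrier E"
    and "graded_left_module E P \<Longrightarrow> e \<in> carrier E \<Longrightarrow> x \<in> carrier P \<Longrightarrow> f (e \<odot>\<^bsub>P\<^esub> x) = e \<otimes>\<^bsub>E\<^esub> f x"
proof -
  interpret E: ring E by fact
  obtain F g where F: "finite F" and g: "\<And>n. n \<in> F \<Longrightarrow> g n \<in> graded_hom E n P (regular_left E)"
    and f: "f = (\<lambda>x\<in>carrier P. finsum E (\<lambda>n. g n x) F)"
    using f unfolding graded_dual_def by auto
  have g_closed: "g n x \<in> carrier E" if "n \<in> F" "x \<in> carrier P" for n x
    using graded_hom_simps(1)[OF g[OF that(1)] that(2)] by (simp add: regular_left_def)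
  show "f x \<in> carrier E" if "x \<in> carrier P"
    unfolding f using that g_closed by (auto intro!: E.finsum_closed)
  show "f (e \<odot>\<^bsub>P\<^esub> x) = e \<otimes>\<^bsub>E\<^esub> f x"
    if P: "graded_left_module E P" and e: "e \<in> carrier E" and x: "x \<in> carrier P"
  proof -
    interpret P: graded_left_module E P by fact
    have "f (e \<odot>\<^bsub>P\<^esub> x) = finsum E (\<lambda>n. g n (e \<odot>\<^bsub>P\<^esub> x)) F"
      using P.smult_closed[OF e x] by (simp add: f)
    also have "\<dots> = finsum E (\<lambda>n. e \<otimes>\<^bsub>E\<^esub> g n x) F"
    proof (rule E.finsum_cong')
      fix n assume "n \<in> F"
      then show "g n (e \<odot>\<^bsub>P\<^esub> x) = e \<otimes>\<^bsub>E\<^esub> g n x"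
        using graded_hom_simps(3)[OF g e x] by (simp add: regular_left_def)
    qed (use e x g_closed in auto)
    also have "\<dots> = e \<otimes>\<^bsub>E\<^esub> f x"
      unfolding f using F e x g_closed by (simp add: E.finsum_rdistr)
    finally show ?thesis .
  qed
qed

lemma graded_dual_zero:
  assumes "ring E"
  shows "(\<lambda>x\<in>carrier P. \<zero>\<^bsub>E\<^esub>) \<in> carrier (graded_dual E P)"
proof -
  interpret E: ring E by fact
  show ?thesis
    unfolding graded_dual_def by (auto intro!: exI[of _ "{} :: int set"])
qed

section \<open>Derivations and the first Ext group\<close>

context enveloping
begin

text \<open>
  A derivation \<open>D : S \<rightarrow> S\<^sup>e\<close> (outer bimodule structure) restricts to a
  homomorphism from the kernel of the multiplication \<open>S\<^sup>e \<rightarrow> S\<close> to \<open>S\<^sup>e\<close>,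
  and so defines a class in \<open>Ext\<^sup>1(S, S\<^sup>e)\<close>. The class vanishes only if the
  derivation is inner.
\<close>

lemma outer_derivation_Ext:
  assumes D: "\<And>s. s \<in> carrier S \<Longrightarrow> D s \<in> carrier T.E"
    and D_add: "\<And>s t. s \<in> carrier S \<Longrightarrow> t \<in> carrier S \<Longrightarrow> D (s \<oplus> t) = D s \<boxplus> D t"
    and D_smult: "\<And>c s. s \<in> carrier S \<Longrightarrow> D (c \<odot> s) = T.pure c \<one> \<one> \<boxtimes> D s"
    and D_mult: "\<And>s t. s \<in> carrier S \<Longrightarrow> t \<in> carrier S \<Longrightarrow>
      D (s \<otimes> t) = T.pure 1 \<one> s \<boxtimes> D t \<boxplus> T.pure 1 t \<one> \<boxtimes> D s"
    and D_homog: "\<And>s n. s \<in> homog S n \<Longrightarrow> D s \<in> homog T.E (n - 1)"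
    and x: "x \<in> carrier S" and Dx: "D x = \<one>\<^bsub>T.E\<^esub>"
    and outer: "\<And>v. v \<in> carrier T.E \<Longrightarrow>
      (T.pure 1 \<one> x \<boxminus> T.pure 1 x \<one>) \<boxtimes> v \<noteq> \<one>\<^bsub>T.E\<^esub>"
    and res: "finite_fg_projective_resolution (env_alg S) (env_left S) P \<delta> \<epsilon>"
  shows "carrier (graded_Ext (env_alg S) P \<delta> 1) \<noteq> {\<zero>\<^bsub>graded_Ext (env_alg S) P \<delta> 1\<^esub>}"
proof
  assume Ext: "carrier (graded_Ext (env_alg S) P \<delta> 1) = {\<zero>\<^bsub>graded_Ext (env_alg S) P \<delta> 1\<^esub>}"
  note res = res[unfolded finite_fg_projective_resolution_def env_alg_eq]
  have proj: "fg_graded_projective T.E (P i)" for i by (rule res[THEN conjunct1, rule_format])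
  then have M: "graded_left_module T.E (P i)" for i unfolding fg_graded_projective_def by blast
  then have ab: "abelian_group (P i)" for i by (rule graded_left_module.axioms)
  note res = res[THEN conjunct2, THEN conjunct2]
  have \<delta>: "\<delta> i \<in> graded_hom T.E 0 (P (Suc i)) (P i)" for i
    by (rule res[THEN conjunct1, rule_format])
  have \<epsilon>: "\<epsilon> \<in> graded_hom T.E 0 (P 0) (env_left S)" by (rule res[THEN conjunct2, THEN conjunct1])
  have surj: "\<epsilon> ` carrier (P 0) = carrier S"
    using res[THEN conjunct2, THEN conjunct2, THEN conjunct1] by simp
  have ker_\<epsilon>: "{y \<in> carrier (P 0). \<epsilon> y = \<zero>} = \<delta> 0 ` carrier (P 1)"
    using res[THEN conjunct2, THEN conjunct2, THEN conjunct2, THEN conjunct1] by simp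
  have ker_\<delta>: "{y \<in> carrier (P (Suc i)). \<delta> i y = \<zero>\<^bsub>P i\<^esub>} = \<delta> (Suc i) ` carrier (P (Suc (Suc i)))" for i
    by (rule res[THEN conjunct2, THEN conjunct2, THEN conjunct2, THEN conjunct2, rule_format])
  \<comment> \<open>\<open>\<alpha>\<close> compares the resolution with the enveloping algebra: it
    carries the image of \<open>\<delta> 0\<close>, the kernel of \<open>\<epsilon>\<close>, into
    the kernel of the multiplication map.\<close>
  obtain \<alpha> where \<alpha>: "\<alpha> \<in> graded_hom T.E 0 (P 0) (regular_left T.E)"
    and \<alpha>\<epsilon>: "\<And>p. p \<in> carrier (P 0) \<Longrightarrow> \<alpha> p \<triangleright> \<one> = \<epsilon> p"
    using lift_through_action[OF proj \<epsilon>] by blast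
  have reg: "carrier (regular_left T.E) = carrier T.E" "add (regular_left T.E) = add T.E"
    "smult (regular_left T.E) = mult T.E" "homog (regular_left T.E) = homog T.E"
    "zero (regular_left T.E) = zero T.E"
    by (simp_all add: regular_left_def)
  note \<alpha>_simps = graded_hom_simps[OF \<alpha>, unfolded reg]

  \<comment> \<open>The tensor of a and b goes to (a tensor 1) times D b. On the kernel of
    multiplication this is the homomorphism that corresponds to D.\<close>
  interpret M: tensor_map "op_alg S" S T.E "\<lambda>c a b. T.pure c a \<one> \<boxtimes> D b"
  proof unfold_locales
    fix a b :: 'a and c d :: 'k
    assume ab: "a \<in> carrier (op_alg S)" "b \<in> carrier S"
    then show "T.pure c a \<one> \<boxtimes> D b \<in> carrier T.E" by (simp add: T.pure_closed D)
    show "T.pure (c + d) a \<one> \<boxtimes> D b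
        = T.pure c a \<one> \<boxtimes> D b \<boxplus> T.pure d a \<one> \<boxtimes> D b"
      using ab by (simp add: T.pure_add_coeff T.pure_closed D T.E.l_distr)
    show "T.pure c (d \<odot>\<^bsub>op_alg S\<^esub> a) \<one> \<boxtimes> D b = T.pure (c * d) a \<one> \<boxtimes> D b"
      using ab T.pure_smult_l[of a \<one> c d] by simp
    show "T.pure c a \<one> \<boxtimes> D (d \<odot> b) = T.pure (c * d) a \<one> \<boxtimes> D b"
      using ab by (simp add: D_smult T.E.m_assoc[symmetric] T.pure_closed D T.pure_mult)
  next
    fix a a' b c
    assume "a \<in> carrier (op_alg S)" "a' \<in> carrier (op_alg S)" "b \<in> carrier S"
    then show "T.pure c (a \<oplus>\<^bsub>op_alg S\<^esub> a') \<one> \<boxtimes> D b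
        = T.pure c a \<one> \<boxtimes> D b \<boxplus> T.pure c a' \<one> \<boxtimes> D b"
      using T.pure_add_l[of a a' \<one> c] by (simp add: T.pure_closed D T.E.l_distr)
  next
    fix a b b' c
    assume "a \<in> carrier (op_alg S)" "b \<in> carrier S" "b' \<in> carrier S"
    then show "T.pure c a \<one> \<boxtimes> D (b \<oplus> b')
        = T.pure c a \<one> \<boxtimes> D b \<boxplus> T.pure c a \<one> \<boxtimes> D b'"
      by (simp add: D_add T.pure_closed D T.E.r_distr)
  qed
  have ext_homog: "M.ext e \<in> homog T.E (n - 1)" if "e \<in> homog T.E n" for e n
    using that
  proof (induction e rule: T.E_homog_induct)
    case (pure a b c i j)
    have "T.pure c a \<one> \<boxtimes> D b \<in> homog T.E ((i + 0) + (j - 1))"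
      using pure homog_one by (intro T.E_homog_mult T.pure_homog D_homog) auto
    then show ?case using pure homog_carrier by (simp add: M.ext_pure add_diff_eq)
  qed (simp_all add: M.ext_zero T.E_homog_zero M.ext_add T.E_homog_closed T.E_homog_add)
  \<comment> \<open>The Leibniz rule makes the extension linear up to a term that depends on m only
    through its image in S. It disappears on the kernel of multiplication.\<close>
  have ext_pure: "M.ext (T.pure c a b \<boxtimes> m) = T.pure c a b \<boxtimes> M.ext m \<boxplus>
      T.pure c ((m \<triangleright> \<one>) \<otimes> a) \<one> \<boxtimes> D b"
    if ab: "a \<in> carrier S" "b \<in> carrier S" and m: "m \<in> carrier T.E" for a b c m
    using m
  proof (induction m rule: T.E_induct)
    case (pure a' b' d)
    then have ab': "a' \<in> carrier S" "b' \<in> carrier S" by simp_all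
    have "M.ext (T.pure c a b \<boxtimes> T.pure d a' b')
        = T.pure (c * d) (a' \<otimes> a) \<one> \<boxtimes> D (b \<otimes> b')"
      using ab ab' by (simp add: T.pure_mult M.ext_pure)
    also have "\<dots> = (T.pure (c * d) (a' \<otimes> a) \<one> \<boxtimes> T.pure 1 \<one> b) \<boxtimes> D b' \<boxplus>
        (T.pure (c * d) (a' \<otimes> a) \<one> \<boxtimes> T.pure 1 b' \<one>) \<boxtimes> D b"
      using ab ab' by (simp add: D_mult T.E.r_distr T.E.m_assoc T.pure_closed D del: op_alg_simps(7))
    also have "T.pure (c * d) (a' \<otimes> a) \<one> \<boxtimes> T.pure 1 \<one> b = T.pure c a b \<boxtimes> T.pure d a' \<one>"
      using ab ab' by (simp add: T.pure_mult)
    also have "T.pure (c * d) (a' \<otimes> a) \<one> \<boxtimes> T.pure 1 b' \<one> =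
        T.pure c ((T.pure d a' b' \<triangleright> \<one>) \<otimes> a) \<one>"
      using ab ab' T.pure_smult_l[of "(b' \<otimes> a') \<otimes> a" \<one> c d]
      by (simp add: T.pure_mult action_pure smult_mult_l m_assoc)
    finally show ?case
      using ab ab' by (simp add: M.ext_pure T.E.m_assoc T.pure_closed D)
  next
    case (add m m')
    let ?u = "m \<triangleright> \<one>" and ?v = "m' \<triangleright> \<one>"
    have uv: "?u \<in> carrier S" "?v \<in> carrier S" using add by (simp_all add: action_closed)
    have "T.pure c ((m \<boxplus> m') \<triangleright> \<one> \<otimes> a) \<one> =
        T.pure c (?u \<otimes> a) \<one> \<boxplus> T.pure c (?v \<otimes> a) \<one>"
      using add ab uv T.pure_add_l[of "?u \<otimes> a" "?v \<otimes> a" \<one> c] by (simp add: action_add l_distr)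
    moreover have "M.ext (T.pure c a b \<boxtimes> (m \<boxplus> m')) =
        M.ext (T.pure c a b \<boxtimes> m) \<boxplus> M.ext (T.pure c a b \<boxtimes> m')"
      using add ab by (simp add: T.E.r_distr T.pure_closed M.ext_add)
    ultimately show ?case
      using add ab uv
      by (simp add: M.ext_add M.ext_closed T.E.r_distr T.E.l_distr T.pure_closed D T.E.a_ac)
  qed
  have ext_linear: "M.ext (e \<boxtimes> m) = e \<boxtimes> M.ext m"
    if "e \<in> carrier T.E" and m: "m \<in> carrier T.E" "m \<triangleright> \<one> = \<zero>" for e m
    using that(1)
  proof (induction e rule: T.E_induct)
    case (pure a b c)
    then show ?case
      using ext_pure[of a b m c] m T.pure_zero_l[of \<one> c] by (simp add: M.ext_closed T.pure_closed D)
  next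
    case (add e e')
    then show ?case using m by (simp add: T.E.l_distr M.ext_add M.ext_closed)
  qed
  let ?d = "T.pure 1 \<one> x \<boxminus> T.pure 1 x \<one>"
  have L: "T.pure 1 \<one> x \<in> carrier T.E" and R: "T.pure 1 x \<one> \<in> carrier T.E"
    using x by (simp_all add: T.pure_closed)
  then have d: "?d \<in> carrier T.E" by simp
  have D1: "D \<one> = \<zero>\<^bsub>T.E\<^esub>"
  proof -
    have "D \<one> = D \<one> \<boxplus> D \<one>"
      using D_mult[of \<one> \<one>] D[of \<one>] T.E_one[symmetric] by simp
    then show ?thesis using D[of \<one>] by simp
  qed
  \<comment> \<open>When m maps to 1, the correction term is D x = 1 for left multiplication by x
    and a multiple of D 1 = 0 for right multiplication.\<close>
  have ext_d: "M.ext (?d \<boxtimes> m) = ?d \<boxtimes> M.ext m \<boxplus> \<one>\<^bsub>T.E\<^esub>"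
    if m: "m \<in> carrier T.E" "m \<triangleright> \<one> = \<one>" for m
  proof -
    have eL: "M.ext (T.pure 1 \<one> x \<boxtimes> m) = T.pure 1 \<one> x \<boxtimes> M.ext m \<boxplus> \<one>\<^bsub>T.E\<^esub>"
      using ext_pure[of \<one> x m 1] m x T.E_one[symmetric] Dx by simp
    have eR: "M.ext (T.pure 1 x \<one> \<boxtimes> m) = T.pure 1 x \<one> \<boxtimes> M.ext m"
      using ext_pure[of x \<one> m 1] m x D1 by (simp add: T.pure_closed M.ext_closed)
    have "T.pure 1 \<one> x \<boxtimes> m = ?d \<boxtimes> m \<boxplus> T.pure 1 x \<one> \<boxtimes> m"
      using L R m(1) by algebra
    then have "T.pure 1 \<one> x \<boxtimes> M.ext m \<boxplus> \<one>\<^bsub>T.E\<^esub> =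
        M.ext (?d \<boxtimes> m) \<boxplus> T.pure 1 x \<one> \<boxtimes> M.ext m"
      using eL eR d R m(1) M.ext_add[of "?d \<boxtimes> m" "T.pure 1 x \<one> \<boxtimes> m"] by simp
    moreover have "M.ext (?d \<boxtimes> m) \<in> carrier T.E" "M.ext m \<in> carrier T.E"
      using d m(1) by (simp_all add: M.ext_closed)
    moreover have "p = (p \<boxplus> q) \<boxminus> q" if "p \<in> carrier T.E" "q \<in> carrier T.E" for p q
      using that by algebra
    ultimately have "M.ext (?d \<boxtimes> m) =
        (T.pure 1 \<one> x \<boxtimes> M.ext m \<boxplus> \<one>\<^bsub>T.E\<^esub>) \<boxminus> T.pure 1 x \<one> \<boxtimes> M.ext m"
      using R by (metis T.E.m_closed)
    also have "\<dots> = ?d \<boxtimes> M.ext m \<boxplus> \<one>\<^bsub>T.E\<^esub>"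
    proof -
      have "(l \<boxtimes> q \<boxplus> \<one>\<^bsub>T.E\<^esub>) \<boxminus> r \<boxtimes> q = (l \<boxminus> r) \<boxtimes> q \<boxplus> \<one>\<^bsub>T.E\<^esub>"
        if "l \<in> carrier T.E" "r \<in> carrier T.E" "q \<in> carrier T.E" for l r q
        using that by algebra
      from this[OF L R M.ext_closed[OF m(1)]] show ?thesis .
    qed
    finally show ?thesis .
  qed

  \<comment> \<open>The cocycle. It has degree -1 because D lowers degrees by one.\<close>
  define z where "z y = M.ext (\<alpha> (\<delta> 0 y))" for y
  have \<delta>0: "\<delta> 0 y \<in> carrier (P 0)" "\<epsilon> (\<delta> 0 y) = \<zero>" if "y \<in> carrier (P (Suc 0))" for y
    using ker_\<epsilon> that by auto
  have z_hom: "z \<in> graded_hom T.E (- 1) (P (Suc 0)) (regular_left T.E)"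
    unfolding graded_hom_def mem_Collect_eq reg
  proof (intro conjI ballI allI)
    show "z \<in> carrier (P (Suc 0)) \<rightarrow> carrier T.E"
      using \<delta>0 \<alpha>_simps(1) M.ext_closed by (auto simp: z_def)
    fix y assume y: "y \<in> carrier (P (Suc 0))"
    show "z (y \<oplus>\<^bsub>P (Suc 0)\<^esub> y') = z y \<boxplus> z y'" if "y' \<in> carrier (P (Suc 0))" for y'
      using y that \<delta>0 \<alpha>_simps(1,2) by (simp add: z_def graded_hom_simps(2)[OF \<delta>] M.ext_add)
    show "z (e \<odot>\<^bsub>P (Suc 0)\<^esub> y) = e \<boxtimes> z y" if "e \<in> carrier T.E" for e
      using y that \<delta>0[OF y] \<alpha>_simps(1,3) \<alpha>\<epsilon>
      by (simp add: z_def graded_hom_simps(3)[OF \<delta>] ext_linear)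
  next
    fix n
    show "z ` homog (P (Suc 0)) n \<subseteq> homog T.E (n + - 1)"
      using ext_homog[OF \<alpha>_simps(4)[OF graded_hom_simps(4)[OF \<delta>]]] by (auto simp: z_def)
  qed
  define f where "f = restrict z (carrier (P (Suc 0)))"
  have z_closed: "z y \<in> carrier T.E" if "y \<in> carrier (P (Suc 0))" for y
    using graded_hom_simps(1)[OF z_hom that] by (simp add: reg)
  have "f \<in> carrier (graded_dual T.E (P (Suc 0)))"
  proof -
    have "f = (\<lambda>y\<in>carrier (P (Suc 0)). finsum T.E (\<lambda>_. z y) {- 1 :: int})"
      unfolding f_def using z_closed by (intro restrict_ext) simp
    then show ?thesis
      unfolding graded_dual_def using z_hom by (auto intro!: exI[of _ "{- 1}"] exI[of _ "\<lambda>_. z"])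
  qed
  moreover have "f (\<delta> (Suc 0) y) = \<zero>\<^bsub>T.E\<^esub>" if "y \<in> carrier (P (Suc (Suc 0)))" for y
  proof -
    have "\<delta> (Suc 0) y \<in> carrier (P (Suc 0))" "\<delta> 0 (\<delta> (Suc 0) y) = \<zero>\<^bsub>P 0\<^esub>"
      using ker_\<delta>[of 0] that by auto
    moreover have "\<alpha> \<zero>\<^bsub>P 0\<^esub> = \<zero>\<^bsub>T.E\<^esub>"
    proof -
      interpret P: graded_left_module T.E "P 0" by (rule M)
      show ?thesis
        using \<alpha>_simps(2)[of "\<zero>\<^bsub>P 0\<^esub>" "\<zero>\<^bsub>P 0\<^esub>"] \<alpha>_simps(1)[of "\<zero>\<^bsub>P 0\<^esub>"] by simp
    qed
    ultimately show ?thesis by (simp add: f_def z_def M.ext_zero)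
  qed
  ultimately have cocycle: "f \<in> cocycles T.E P \<delta> (Suc 0)" unfolding cocycles_def by blast
  let ?B = "coboundaries T.E P \<delta> (Suc 0)" and ?M = "graded_dual T.E (P (Suc 0))"
  have "?B +>\<^bsub>?M\<^esub> f = ?B"
    using Ext cocycle unfolding env_alg_eq graded_Ext_def subquotient_def by auto
  \<comment> \<open>The zero map is a coboundary, so f belongs to its own coset. Once that coset is
    the zero class \<open>?B\<close>, f is itself a coboundary.\<close>
  moreover have "f \<in> ?B +>\<^bsub>?M\<^esub> f"
  proof -
    have "(\<lambda>y\<in>carrier (P (Suc 0)). \<zero>\<^bsub>T.E\<^esub>) \<in> ?B"
      using \<delta>0 by (auto intro!: image_eqI[OF _ graded_dual_zero[OF T.E_ring]] restrict_ext)
    moreover have "f = (\<lambda>y\<in>carrier (P (Suc 0)). \<zero>\<^bsub>T.E\<^esub>) \<oplus>\<^bsub>?M\<^esub> f"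
      unfolding f_def using z_closed by (auto simp: graded_dual_def intro!: restrict_ext)
    ultimately show ?thesis by (auto simp: a_r_coset_def r_coset_def)
  qed
  ultimately obtain g where g: "g \<in> carrier (graded_dual T.E (P 0))"
    and fg: "f = (\<lambda>y\<in>carrier (P (Suc 0)). g (\<delta> 0 y))"
    by auto
  \<comment> \<open>For p over 1, the element d p lies in the kernel of \<open>\<epsilon>\<close>,
    say d p = \<open>\<delta> 0 y\<close>. Evaluating f = g o \<open>\<delta> 0\<close> at y gives d
    (g p) = d q + 1 for q = \<open>M.ext (\<alpha> p)\<close>, so 1 would be a multiple of
    d.\<close>
  obtain p where p: "p \<in> carrier (P 0)" "\<epsilon> p = \<one>" using surj one_closed by (metis imageE)
  interpret P: graded_left_module T.E "P 0" by (rule M)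
  have dp: "?d \<odot>\<^bsub>P 0\<^esub> p \<in> carrier (P 0)" using d p(1) by (rule P.smult_closed)
  have "\<epsilon> (?d \<odot>\<^bsub>P 0\<^esub> p) = ?d \<triangleright> \<one>"
    using graded_hom_simps(3)[OF \<epsilon> d p(1)] p(2) by simp
  also have "\<dots> = \<zero>" using x L R by (simp add: action_minus action_pure smult_one minus_eq r_neg)
  finally obtain y where y: "y \<in> carrier (P (Suc 0))" "?d \<odot>\<^bsub>P 0\<^esub> p = \<delta> 0 y"
    using ker_\<epsilon> dp by auto
  have gp: "g p \<in> carrier T.E" by (rule graded_dual_hom(1)[OF T.E_ring g p(1)])
  have \<alpha>p: "\<alpha> p \<in> carrier T.E" by (rule \<alpha>_simps(1)[OF p(1)])
  have "?d \<boxtimes> g p = g (\<delta> 0 y)"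
    using graded_dual_hom(2)[OF T.E_ring g M d p(1)] y(2) by simp
  also have "\<dots> = z y" using fun_cong[OF fg, of y] y(1) by (simp add: f_def)
  also have "\<dots> = M.ext (?d \<boxtimes> \<alpha> p)" unfolding z_def y(2)[symmetric] \<alpha>_simps(3)[OF d p(1)] ..
  also have "\<dots> = ?d \<boxtimes> M.ext (\<alpha> p) \<boxplus> \<one>\<^bsub>T.E\<^esub>"
    using \<alpha>p \<alpha>\<epsilon>[OF p(1)] p(2) by (intro ext_d) simp_all
  finally have eq: "?d \<boxtimes> g p = ?d \<boxtimes> M.ext (\<alpha> p) \<boxplus> \<one>\<^bsub>T.E\<^esub>" .
  define q where "q = M.ext (\<alpha> p)"
  have q: "q \<in> carrier T.E" unfolding q_def using \<alpha>p by (rule M.ext_closed)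
  have "?d \<boxtimes> (g p \<boxminus> q) = ?d \<boxtimes> g p \<boxminus> ?d \<boxtimes> q"
    using L R gp q by algebra
  also have "\<dots> = (?d \<boxtimes> q \<boxplus> \<one>\<^bsub>T.E\<^esub>) \<boxminus> ?d \<boxtimes> q"
    using eq by (simp add: q_def)
  also have "\<dots> = \<one>\<^bsub>T.E\<^esub>" using L R q by algebra
  finally show False using outer gp q T.E.minus_closed by blast
qed

end

section \<open>Homomorphisms between presented algebras\<close>

text \<open>Representations of the free algebra by arbitrary linear operators for the generators.
  The scalar action is a parameter, so that one locale serves both for homomorphisms between free
  algebras and for operators on triples.\<close>

locale free_action =
  fixes scale :: "'k::field \<Rightarrow> 'v::ab_group_add \<Rightarrow> 'v" and act :: "'g \<Rightarrow> 'v \<Rightarrow> 'v"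
  assumes scale_add_l: "scale (c + d) v = scale c v + scale d v"
    and scale_add_r: "scale c (v + v') = scale c v + scale c v'"
    and scale_scale: "scale c (scale d v) = scale (c * d) v"
    and scale_one: "scale 1 v = v"
    and act_add: "act g (v + v') = act g v + act g v'"
    and act_scale: "act g (scale c v) = scale c (act g v)"
begin

definition poly_act :: "('g, 'k) free_poly \<Rightarrow> 'v \<Rightarrow> 'v" where
  "poly_act p v = lin_ext (\<lambda>u c. scale c (foldr act (letters u) v)) p"

sublocale coefficient_additive "\<lambda>u c. scale c (foldr act (letters u) v)"
proof unfold_locales
  fix u :: "'g word" and b c :: 'k
  show "scale (b + c) (foldr act (letters u) v) = scale b (foldr act (letters u) v) + scale c (foldr act (letters u) v)"
    by (rule scale_add_l)
  show "scale 0 (foldr act (letters u) v) = 0"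
    using scale_add_l[of 0 0 "foldr act (letters u) v"] by simp
qed

lemma poly_act_add_l: "poly_act (p + q) v = poly_act p v + poly_act q v"
  unfolding poly_act_def by (rule lin_ext_add)

lemma poly_act_zero [simp]: "poly_act 0 v = 0"
  unfolding poly_act_def by (rule lin_ext_zero)

lemma poly_act_single: "poly_act (Poly_Mapping.single u c) v = scale c (foldr act (letters u) v)"
  unfolding poly_act_def by (rule lin_ext_single)

lemma foldr_act_add: "foldr act l (v + v') = foldr act l v + foldr act l v'"
  by (induction l) (simp_all add: act_add)

lemma foldr_act_scale: "foldr act l (scale c v) = scale c (foldr act l v)"
  by (induction l) (simp_all add: act_scale)

lemma poly_act_add_r: "poly_act p (v + v') = poly_act p v + poly_act p v'"
  unfolding poly_act_def lin_ext_def by (simp add: foldr_act_add scale_add_r sum.distrib)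

lemma poly_act_mult: "poly_act (p * q) v = poly_act p (poly_act q v)"
proof (induction p rule: poly_mapping_additive_induct)
  case (single u c)
  show ?case
  proof (induction q rule: poly_mapping_additive_induct)
    case zero
    show ?case using poly_act_add_r[of "Poly_Mapping.single u c" 0 0] by simp
  next
    case (single u' c')
    then show ?case
      by (simp add: mult_single poly_act_single plus_word_def foldr_act_scale scale_scale)
  qed (simp_all add: distrib_left poly_act_add_l poly_act_add_r)
qed (simp_all add: distrib_right poly_act_add_l)

lemma poly_act_const: "poly_act (const c) v = scale c v"
  by (simp add: const_def poly_act_single zero_word_def)

lemma poly_act_one [simp]: "poly_act 1 v = v"
  using poly_act_const[of 1] scale_one by simp

lemma poly_act_gen: "poly_act (gen g) v = act g v"
  by (simp add: gen_def poly_act_single scale_one)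

end

lemma free_action_mult: "free_action (\<lambda>c p. const c * p) (\<lambda>g p. f g * p)"
  for f :: "'g \<Rightarrow> ('h, 'k::field) free_poly"
proof unfold_locales
  fix c :: 'k and g :: 'g and p :: "('h, 'k) free_poly"
  show "f g * (const c * p) = const c * (f g * p)"
    using const_commute[of c "f g"] by (simp add: mult.assoc[symmetric])
qed (simp_all add: const_add const_mult distrib_left distrib_right mult.assoc)

text \<open>The orbit map of 1 when each generator g acts as left multiplication by
  \<open>f g\<close>. It is multiplicative because left multiplications commute with right
  ones.\<close>

definition free_hom :: "('g \<Rightarrow> ('h, 'k::field) free_poly) \<Rightarrow> ('g, 'k) free_poly \<Rightarrow> ('h, 'k) free_poly" where
  "free_hom f p = free_action.poly_act (\<lambda>c p. const c * p) (\<lambda>g p. f g * p) p 1"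

context
  fixes f :: "'g \<Rightarrow> ('h, 'k::field) free_poly"
begin

interpretation free_action "\<lambda>c p. const c * p" "\<lambda>g p. f g * p" by (rule free_action_mult)

lemma free_hom_add: "free_hom f (p + q) = free_hom f p + free_hom f q"
  unfolding free_hom_def by (rule poly_act_add_l)

lemma free_hom_mult: "free_hom f (p * q) = free_hom f p * free_hom f q"
proof -
  have "poly_act p (v * v') = poly_act p v * v'" for v v' :: "('h, 'k) free_poly"
  proof (induction p rule: poly_mapping_additive_induct)
    case (single u c)
    have "foldr (\<lambda>g p. f g * p) l (v * v') = foldr (\<lambda>g p. f g * p) l v * v'" for l
      by (induction l) (simp_all add: mult.assoc)
    then show ?case by (simp add: poly_act_single mult.assoc)
  qed (simp_all add: poly_act_add_l distrib_right)
  from this[of 1 "poly_act q 1"] show ?thesis unfolding free_hom_def poly_act_mult mult_1_left .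
qed

lemma free_hom_zero [simp]: "free_hom f 0 = 0"
  unfolding free_hom_def by simp

lemma free_hom_one [simp]: "free_hom f 1 = 1"
  unfolding free_hom_def by simp

lemma free_hom_const [simp]: "free_hom f (const c) = const c"
  unfolding free_hom_def by (simp add: poly_act_const)

lemma free_hom_gen [simp]: "free_hom f (gen g) = f g"
  unfolding free_hom_def by (simp add: poly_act_gen)

lemma free_hom_single:
  "free_hom f (Poly_Mapping.single (Word l) c) = const c * foldr (\<lambda>g p. f g * p) l 1"
  unfolding free_hom_def by (simp add: poly_act_single)

lemma free_hom_uminus: "free_hom f (- p) = - free_hom f p"
  by (rule additive_uminus) (rule free_hom_add)

lemma free_hom_diff: "free_hom f (p - q) = free_hom f p - free_hom f q"
  by (rule additive_diff) (rule free_hom_add)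

lemma free_hom_sum: "free_hom f (sum h A) = (\<Sum>i\<in>A. free_hom f (h i))"
  by (induction A rule: infinite_finite_induct) (simp_all add: free_hom_add)

end

lemmas free_hom_simps = free_hom_add free_hom_mult free_hom_uminus free_hom_diff free_hom_sum

lemma single_Word: "Poly_Mapping.single (Word l) c = const c * foldr (\<lambda>g p. gen g * p) l 1"
proof (induction l)
  case Nil
  then show ?case by (simp add: const_def zero_word_def)
next
  case (Cons g l)
  have "Poly_Mapping.single (Word (g # l)) c = gen g * Poly_Mapping.single (Word l) c"
    by (simp add: gen_def mult_single plus_word_def)
  also have "\<dots> = const c * (gen g * foldr (\<lambda>g p. gen g * p) l 1)"
    unfolding Cons using const_commute[of c "gen g"] by (simp add: mult.assoc[symmetric])
  finally show ?case by simp
qed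

lemma free_poly_induct [case_names const gen add mult]:
  assumes const: "\<And>c. P (const c)" and gen: "\<And>g. P (gen g)"
    and add: "\<And>p q. P p \<Longrightarrow> P q \<Longrightarrow> P (p + q)" and mult: "\<And>p q. P p \<Longrightarrow> P q \<Longrightarrow> P (p * q)"
  shows "P p"
proof (induction p rule: poly_mapping_additive_induct)
  case zero
  show ?case using const[of 0] by simp
next
  case (single u c)
  have "P (foldr (\<lambda>g p. gen g * p) l 1)" for l
    using const[of 1] by (induction l) (simp_all add: gen mult)
  then show ?case using single_Word[of "letters u" c] mult const by simp
qed (rule add)

lemma two_sided_vimage: "two_sided J \<Longrightarrow> two_sided {p. free_hom f p \<in> J}"
  unfolding two_sided_def by (simp add: free_hom_simps)

lemma free_hom_rel_ideal:
  assumes "\<And>r. r \<in> R \<Longrightarrow> free_hom f r \<in> rel_ideal R'" and "p \<in> rel_ideal R"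
  shows "free_hom f p \<in> rel_ideal R'"
  using rel_ideal_minimal[OF two_sided_vimage[OF two_sided_rel_ideal, of f R'], of R] assms by blast

text \<open>Congruence to the identity passes to products because p'q' - pq = p'(q' - q) + (p' -
  p)q, so it may be tested on generators.\<close>

lemma free_hom_comp_congruent:
  assumes J: "two_sided J" and "\<And>g. free_hom f' (f g) - gen g \<in> J"
  shows "free_hom f' (free_hom f p) - p \<in> J"
proof (induction p rule: free_poly_induct)
  case (add p q)
  have "free_hom f' (free_hom f (p + q)) - (p + q) =
      (free_hom f' (free_hom f p) - p) + (free_hom f' (free_hom f q) - q)"
    by (simp add: free_hom_simps)
  then show ?case using two_sidedD(2)[OF J] add by metis
next
  case (mult p q)
  have "free_hom f' (free_hom f (p * q)) - p * q =
      free_hom f' (free_hom f p) * (free_hom f' (free_hom f q) - q) + (free_hom f' (free_hom f p) - p) * q"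
    by (simp add: free_hom_simps algebra_simps)
  then show ?case using two_sidedD(2-4)[OF J] mult by metis
qed (use assms two_sidedD(1)[OF J] in auto)

lemma homog_free_alg:
  "homog (free_alg wt) n = {p. \<forall>u\<in>Poly_Mapping.keys p. int (\<Sum>g\<leftarrow>letters u. wt g) = n}"
  by (simp add: free_alg_def)

lemma homog_free_alg_closed:
  shows "0 \<in> homog (free_alg wt) n"
    and "p \<in> homog (free_alg wt) n \<Longrightarrow> q \<in> homog (free_alg wt) n \<Longrightarrow> p + q \<in> homog (free_alg wt) n"
    and "const c \<in> homog (free_alg wt) 0"
    and "p \<in> homog (free_alg wt) m \<Longrightarrow> q \<in> homog (free_alg wt) n \<Longrightarrow> p * q \<in> homog (free_alg wt) (m + n)"
    and "gen g \<in> homog (free_alg wt) (int (wt g))"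
  using keys_add[of p q] keys_mult[of p q]
  by (auto simp: homog_free_alg const_def gen_def zero_word_def plus_word_def)

lemma homog_free_alg_const_mult:
  "p \<in> homog (free_alg wt) n \<Longrightarrow> const c * p \<in> homog (free_alg wt) n"
  using homog_free_alg_closed(4)[OF homog_free_alg_closed(3)[of c wt]] by fastforce

lemma free_hom_homog:
  assumes f: "\<And>g. f g \<in> homog (free_alg wt') (int (wt g))" and p: "p \<in> homog (free_alg wt) n"
  shows "free_hom f p \<in> homog (free_alg wt') n"
proof (induction p rule: poly_mapping_additive_induct)
  case (single u c)
  have "foldr (\<lambda>g p. f g * p) l 1 \<in> homog (free_alg wt') (int (\<Sum>g\<leftarrow>l. wt g))" for l
  proof (induction l)
    case Nil
    show ?case using homog_free_alg_closed(3)[of 1] by simp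
  next
    case (Cons g l)
    then show ?case using homog_free_alg_closed(4)[OF f] by simp
  qed
  from homog_free_alg_const_mult[OF this[of "letters u"], of c] show ?case
    using free_hom_single[of f "letters u" c] p single by (simp add: homog_free_alg)
qed (simp_all add: free_hom_add homog_free_alg_closed)

text \<open>Both homomorphisms descend because they map relations into ideals, and the congruences
  on generators make the induced maps inverse to each other. Homogeneity of both, not just of one,
  gives equality of the graded parts.\<close>

lemma presented_alg_isoI:
  fixes f :: "'g \<Rightarrow> ('h, 'k::field) free_poly"
  assumes R: "\<And>r. r \<in> R \<Longrightarrow> free_hom f r \<in> rel_ideal R'"
    and R': "\<And>r. r \<in> R' \<Longrightarrow> free_hom f' r \<in> rel_ideal R"
    and f'f: "\<And>g. free_hom f' (f g) - gen g \<in> rel_ideal R"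
    and ff': "\<And>h. free_hom f (f' h) - gen h \<in> rel_ideal R'"
    and f_homog: "\<And>g. f g \<in> homog (free_alg wt') (int (wt g))"
    and f'_homog: "\<And>h. f' h \<in> homog (free_alg wt) (int (wt' h))"
  shows "graded_alg_iso (presented_alg wt R) (presented_alg wt' R')"
proof -
  let ?A = "presented_alg wt R" and ?B = "presented_alg wt' R'"
  have f_ideal: "free_hom f p \<in> rel_ideal R'" if "p \<in> rel_ideal R" for p
    using that free_hom_rel_ideal R by blast
  have f'_ideal: "free_hom f' p \<in> rel_ideal R" if "p \<in> rel_ideal R'" for p
    using that free_hom_rel_ideal R' by blast
  define \<phi> where "\<phi> X = pres wt' R' (free_hom f (SOME p. pres wt R p = X))" for X
  have \<phi>: "\<phi> (pres wt R p) = pres wt' R' (free_hom f p)" for p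
  proof -
    define q where "q = (SOME q. pres wt R q = pres wt R p)"
    have "pres wt R q = pres wt R p" unfolding q_def by (rule someI) (rule refl)
    then have "free_hom f (q - p) \<in> rel_ideal R'" unfolding pres_eq_iff by (rule f_ideal)
    then have "pres wt' R' (free_hom f q) = pres wt' R' (free_hom f p)"
      unfolding pres_eq_iff by (simp add: free_hom_diff)
    then show ?thesis unfolding \<phi>_def q_def .
  qed
  have inv: "pres wt R (free_hom f' (free_hom f p)) = pres wt R p"
    "pres wt' R' (free_hom f (free_hom f' q)) = pres wt' R' q" for p q
    unfolding pres_eq_iff
    by (rule free_hom_comp_congruent[OF two_sided_rel_ideal], rule f'f)
      (rule free_hom_comp_congruent[OF two_sided_rel_ideal], rule ff')
  have 1: "\<phi> \<in> ring_hom ?A ?B"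
    by (rule ring_hom_memI)
      (auto simp: pres_carrier pres_mult pres_add pres_one \<phi> free_hom_simps)
  have 2: "bij_betw \<phi> (carrier ?A) (carrier ?B)"
  proof (rule bij_betw_imageI)
    show "inj_on \<phi> (carrier ?A)"
    proof (rule inj_onI)
      fix X Y assume "X \<in> carrier ?A" "Y \<in> carrier ?A" and eq: "\<phi> X = \<phi> Y"
      then obtain p q where X: "X = pres wt R p" and Y: "Y = pres wt R q"
        unfolding pres_carrier by blast
      have "free_hom f (p - q) \<in> rel_ideal R'"
        using eq unfolding X Y \<phi> pres_eq_iff by (simp add: free_hom_diff)
      then have "free_hom f' (free_hom f (p - q)) \<in> rel_ideal R"
        by (rule f'_ideal)
      then have "pres wt R (free_hom f' (free_hom f p)) = pres wt R (free_hom f' (free_hom f q))"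
        unfolding pres_eq_iff by (simp add: free_hom_diff)
      then show "X = Y" unfolding inv X Y .
    qed
    show "\<phi> ` carrier ?A = carrier ?B"
      unfolding pres_carrier image_image \<phi>
    proof (intro subset_antisym subsetI)
      fix Y assume "Y \<in> range (pres wt' R')"
      then obtain q where "Y = pres wt' R' q" by blast
      then show "Y \<in> range (\<lambda>p. pres wt' R' (free_hom f p))" using inv(2)[of q] by (metis rangeI)
    qed auto
  qed
  have 3: "\<phi> ` homog ?A n = homog ?B n" for n
    unfolding pres_homog image_image \<phi>
  proof (intro subset_antisym subsetI)
    fix Y assume "Y \<in> pres wt' R' ` homog (free_alg wt') n"
    then obtain q where q: "q \<in> homog (free_alg wt') n" "Y = pres wt' R' q" by blast
    then have "Y = pres wt' R' (free_hom f (free_hom f' q))" using inv(2) by simp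
    then show "Y \<in> (\<lambda>p. pres wt' R' (free_hom f p)) ` homog (free_alg wt) n"
      using free_hom_homog[OF f'_homog q(1)] by blast
  qed (use free_hom_homog[where f = f, OF f_homog] in blast)
  have 4: "\<phi> (c \<odot>\<^bsub>?A\<^esub> X) = c \<odot>\<^bsub>?B\<^esub> \<phi> X" if "X \<in> carrier ?A" for c X
    using that by (auto simp: pres_carrier pres_smult \<phi> free_hom_simps)
  show ?thesis
    unfolding graded_alg_iso_def
  proof (intro bexI conjI allI ballI)
    show "\<phi> \<in> ring_iso ?A ?B" using 1 2 by (simp add: ring_iso_def)
  qed (fact 3 4)+
qed

section \<open>Binary quartics\<close>

text \<open>Stated for arbitrary x and y, so that it applies to generators of either free algebra
  and to other linear forms. Indices above 3 repeat the value at 3 and do not enter the sums, which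
  stop at 3.\<close>

definition cubic :: "'a::ring_1 \<Rightarrow> 'a \<Rightarrow> nat \<Rightarrow> 'a" where
  "cubic x y i =
     (if i = 0 then x * x * x
      else if i = 1 then x * x * y + x * y * x + y * x * x
      else if i = 2 then x * y * y + y * x * y + y * y * x
      else y * y * y)"

lemma cubic_simps [simp]:
  "cubic x y 0 = x * x * x"
  "cubic x y (Suc 0) = x * x * y + x * y * x + y * x * x"
  "cubic x y 2 = x * y * y + y * x * y + y * y * x"
  "cubic x y 3 = y * y * y"
  by (simp_all add: cubic_def)

lemma sum_lessThan_4: "sum f {..<4::nat} = f 0 + f (Suc 0) + f 2 + f 3"
  by (simp add: eval_nat_numeral)

section \<open>The relations of a symmetric quartic in terms of its coefficients\<close>

definition deriv_poly :: "(nat \<Rightarrow> 'k) \<Rightarrow> (xy, 'k::field) free_poly" where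
  "deriv_poly a = (\<Sum>i<4. const (a i) * cubic (gen X) (gen Y) i)"

lemma lookup_cyclic_deriv:
  "Poly_Mapping.lookup (cyclic_deriv b w) (Word v) = Poly_Mapping.lookup w (Word (b # v))"
proof -
  let ?h = "\<lambda>u c. case letters u of [] \<Rightarrow> 0 | a # v \<Rightarrow> if a = b then Poly_Mapping.single (Word v) c else 0"
  interpret coefficient_additive ?h
    by unfold_locales (auto split: list.split simp: single_add)
  have cd: "cyclic_deriv b w = lin_ext ?h w" for w :: "(xy, 'k::field) free_poly"
    by (simp add: cyclic_deriv_def lin_ext_def)
  show ?thesis
    unfolding cd
  proof (induction w rule: poly_mapping_additive_induct)
    case (single u c)
    then show ?case
      by (cases u rule: word.exhaust) (auto simp: lookup_single when_def split: list.split)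
  qed (simp_all add: lin_ext_add lookup_add)
qed

text \<open>Rearranging words of length d by a permutation is injective, so exactly one key can
  contribute to the coefficient at the rearranged word and no terms are merged.\<close>

lemma Sym_lookup_permute:
  assumes w: "w \<in> Sym d" and \<theta>: "\<theta> permutes {..<d}" and l: "length l = d"
  shows "Poly_Mapping.lookup w (Word (permute_list \<theta> l)) = Poly_Mapping.lookup w (Word l)"
proof -
  have tp: "length (letters u) = d" if "u \<in> Poly_Mapping.keys w" for u
    using w that by (auto simp: Sym_def tensor_power_def)
  have inj: "Word (permute_list \<theta> (letters u)) = Word (permute_list \<theta> l) \<longleftrightarrow> u = Word l"
    if "u \<in> Poly_Mapping.keys w" for u
  proof -
    have "letters u = l" if eq: "permute_list \<theta> (letters u) = permute_list \<theta> l"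
    proof (rule nth_equalityI)
      show "length (letters u) = length l" using tp \<open>u \<in> Poly_Mapping.keys w\<close> l by simp
      fix i assume "i < length (letters u)"
      then have "i \<in> \<theta> ` {..<d}"
        using permutes_image[OF \<theta>] tp \<open>u \<in> Poly_Mapping.keys w\<close> by auto
      then obtain j where j: "j < d" "i = \<theta> j" by auto
      have "permute_list \<theta> (letters u) ! j = letters u ! i" "permute_list \<theta> l ! j = l ! i"
        using j l tp[OF \<open>u \<in> Poly_Mapping.keys w\<close>] \<theta> by (simp_all add: permute_list_def)
      then show "letters u ! i = l ! i" using eq by simp
    qed
    then show ?thesis by (cases u) auto
  qed
  have "Poly_Mapping.lookup (permute_factors \<theta> w) (Word (permute_list \<theta> l)) =
      (\<Sum>u\<in>Poly_Mapping.keys w. if u = Word l then Poly_Mapping.lookup w u else 0)"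
    unfolding permute_factors_def lookup_sum
    by (rule sum.cong) (auto simp: lookup_single when_def inj simp del: word.inject)
  also have "\<dots> = Poly_Mapping.lookup w (Word l)"
    by (simp add: in_keys_iff)
  finally show ?thesis using w \<theta> by (simp add: Sym_def)
qed

text \<open>Two words with the same number of each letter differ by a permutation of positions, so
  the coefficient can be read at the sorted word.\<close>

lemma Sym_lookup_count:
  assumes w: "w \<in> Sym d" and l: "length l = d"
  shows "Poly_Mapping.lookup w (Word l) =
    Poly_Mapping.lookup w (Word (replicate (d - count_list l Y) X @ replicate (count_list l Y) Y))"
proof -
  let ?r = "replicate (d - count_list l Y) X @ replicate (count_list l Y) Y"
  have X: "count_list l X = length l - count_list l Y" for l
  proof (induction l)
    case (Cons a l)
    have "count_list l Y \<le> length l" by (rule count_le_length)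
    with Cons show ?case by (cases a) auto
  qed simp
  have "count (mset ?r) a = count (mset l) a" for a
    by (cases a) (use l X[of l] in \<open>simp_all add: count_mset\<close>)
  then have "mset ?r = mset l" by (rule multiset_eqI)
  then obtain \<theta> where "\<theta> permutes {..<length l}" "permute_list \<theta> l = ?r"
    by (rule mset_eq_permutation)
  then show ?thesis using Sym_lookup_permute[OF w _ l] l by metis
qed

lemma gen_product: "gen a * gen b * gen c = Poly_Mapping.single (Word [a, b, c]) 1"
  by (simp add: gen_def mult_single plus_word_def)

lemma const_single: "const c * Poly_Mapping.single u d = Poly_Mapping.single u (c * d)"
  by (simp add: const_def mult_single)

lemma length_3_xy:
  assumes "length v = 3"
  shows "v \<in> {[X,X,X], [X,X,Y], [X,Y,X], [Y,X,X], [X,Y,Y], [Y,X,Y], [Y,Y,X], [Y,Y,Y]}"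
proof -
  obtain p q r where v: "v = [p, q, r]"
    using assms by (auto simp: numeral_3_eq_3 length_Suc_conv)
  show ?thesis unfolding v by (cases p; cases q; cases r) simp_all
qed

lemma Sym4_cyclic_deriv:
  assumes w: "w \<in> Sym 4"
  obtains a where "cyclic_deriv X w = deriv_poly a" "cyclic_deriv Y w = deriv_poly (\<lambda>i. a (Suc i))"
proof
  define a where "a i = Poly_Mapping.lookup w (Word (replicate (4 - i) X @ replicate i Y))" for i
  have l4: "Poly_Mapping.lookup w (Word l) = a (count_list l Y)" if "length l = 4" for l
    unfolding a_def by (rule Sym_lookup_count[OF w that])
  have other: "Poly_Mapping.lookup w (Word l) = 0" if "length l \<noteq> 4" for l
    using w that by (force simp: Sym_def tensor_power_def in_keys_iff)
  \<comment> \<open>The count is 0 for X and 1 for Y: removing an initial Y shifts the index of the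
    coefficients by one.\<close>
  have "cyclic_deriv b w = deriv_poly (\<lambda>i. a (i + count_list [b] Y))" for b
  proof (rule poly_mapping_eqI)
    fix u :: "xy word"
    obtain v where u: "u = Word v" by (cases u)
    show "Poly_Mapping.lookup (cyclic_deriv b w) u =
        Poly_Mapping.lookup (deriv_poly (\<lambda>i. a (i + count_list [b] Y))) u"
    proof (cases "length v = 3")
      case True
      have "Poly_Mapping.lookup (cyclic_deriv b w) u = a (count_list (b # v) Y)"
        unfolding u lookup_cyclic_deriv by (rule l4) (simp add: True)
      moreover have "Poly_Mapping.lookup (deriv_poly (\<lambda>i. a (i + count_list [b] Y))) u = a (count_list (b # v) Y)"
        using length_3_xy[OF True]
        unfolding u deriv_poly_def sum_lessThan_4 cubic_simps gen_product distrib_left const_single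
          lookup_add lookup_single when_def
        by (elim insertE emptyE; cases b; simp add: eval_nat_numeral)
      ultimately show ?thesis by simp
    next
      case False
      have ne: "[p, q, r] \<noteq> v" for p q r using False by auto
      have "Poly_Mapping.lookup (deriv_poly (\<lambda>i. a (i + count_list [b] Y))) u = 0"
        unfolding u deriv_poly_def sum_lessThan_4 cubic_simps gen_product distrib_left const_single
          lookup_add lookup_single when_def
        by (simp add: ne)
      then show ?thesis using other False unfolding u lookup_cyclic_deriv by simp
    qed
  qed
  from this[of X] this[of Y] show "cyclic_deriv X w = deriv_poly a"
    "cyclic_deriv Y w = deriv_poly (\<lambda>i. a (Suc i))" by simp_all
qed

definition catalecticant :: "(nat \<Rightarrow> 'k::comm_ring_1) \<Rightarrow> 'k" where
  "catalecticant a = a 0 * (a 2 * a 4 - a 3 * a 3) - a 1 * (a 1 * a 4 - a 2 * a 3)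
     + a 2 * (a 1 * a 3 - a 2 * a 2)"

definition quartic_ideal :: "(nat \<Rightarrow> 'k::field) \<Rightarrow> (xy, 'k) free_poly set" where
  "quartic_ideal a = rel_ideal {deriv_poly a, deriv_poly (\<lambda>i. a (Suc i))}"

subsection \<open>Nonzero catalecticant\<close>

lemma const_left_commute: "p * (const c * q) = const c * (p * q)"
  by (metis const_commute mult.assoc)

lemma const_2_mult: "const 2 * p = p + p"
proof -
  have "const (1 + 1) * p = p + p" by (simp only: const_add const_one distrib_right mult_1_left)
  then show ?thesis by simp
qed

lemma const_3_mult: "const 3 * p = p + p + p"
proof -
  have "const (1 + 1 + 1) * p = p + p + p"
    by (simp only: const_add const_one distrib_right mult_1_left)
  then show ?thesis by simp
qed

text \<open>Splitting off the first or the last letter writes the sum of all words of length 4 with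
  i + 1 letters y in two ways: \<open>x s\<^sub>i\<^sub>+\<^sub>1 + y s\<^sub>i =
  s\<^sub>i\<^sub>+\<^sub>1 x + s\<^sub>i y\<close>. The outer identities are the cases with a
  single kind of letter.\<close>

lemma cubic_commutators:
  "x * cubic x y 0 = cubic x y 0 * x"
  "x * cubic x y (Suc 0) - cubic x y (Suc 0) * x = cubic x y 0 * y - y * cubic x y 0"
  "x * cubic x y 2 - cubic x y 2 * x = cubic x y (Suc 0) * y - y * cubic x y (Suc 0)"
  "x * cubic x y 3 - cubic x y 3 * x = cubic x y 2 * y - y * cubic x y 2"
  "y * cubic x y 3 = cubic x y 3 * y"
  by (simp_all add: algebra_simps)

text \<open>The multipliers p, q, r play the role of cofactors of the first column: the combination
  eliminates v and w and leaves the determinant times u.\<close>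

lemma cramer_three:
  fixes u v w :: "('g, 'k::field) free_poly"
  assumes J: "two_sided J" and ne: "p * a + q * a' + r * a'' \<noteq> 0"
    and 0: "p * b + q * b' + r * b'' = 0" "p * c + q * c' + r * c'' = 0"
    and e: "const a * u + const b * v + const c * w \<in> J"
      "const a' * u + const b' * v + const c' * w \<in> J"
      "const a'' * u + const b'' * v + const c'' * w \<in> J"
  shows "u \<in> J"
proof -
  let ?D = "p * a + q * a' + r * a''"
  have "const p * (const a * u + const b * v + const c * w)
      + const q * (const a' * u + const b' * v + const c' * w)
      + const r * (const a'' * u + const b'' * v + const c'' * w) =
      const ?D * u + const (p * b + q * b' + r * b'') * v + const (p * c + q * c' + r * c'') * w"
    by (simp only: const_add const_mult distrib_left distrib_right mult.assoc add_ac)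
  also have "\<dots> = const ?D * u" unfolding 0 by simp
  finally have "const ?D * u \<in> J" using e two_sidedD(2,3)[OF J] by metis
  then have "const (inverse ?D) * (const ?D * u) \<in> J" by (rule two_sidedD(3)[OF J])
  then show ?thesis using ne by (simp add: mult.assoc[symmetric] const_mult[symmetric])
qed

text \<open>
  The commutators \<open>[s\<^sub>i, y] = [x, s\<^sub>i\<^sub>+\<^sub>1]\<close> of the cubics \<open>s\<^sub>i\<close> satisfy three linear
  equations modulo the relations, whose matrix is the catalecticant Hankel matrix.
\<close>

lemma cubic_central:
  assumes "catalecticant a \<noteq> 0" and i: "i < 4"
  shows "cubic (gen X) (gen Y) i * gen g - gen g * cubic (gen X) (gen Y) i \<in> quartic_ideal a"
proof -
  let ?x = "gen X :: (xy, 'a) free_poly" and ?y = "gen Y :: (xy, 'a) free_poly"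
  let ?s = "cubic ?x ?y" and ?I = "quartic_ideal a"
  have I: "two_sided ?I" unfolding quartic_ideal_def by (rule two_sided_rel_ideal)
  define c where "c i = ?s i * ?y - ?y * ?s i" for i
  have r: "deriv_poly a \<in> ?I" "deriv_poly (\<lambda>i. a (Suc i)) \<in> ?I"
    unfolding quartic_ideal_def using rel_ideal_superset by blast+
  have y: "deriv_poly b * ?y - ?y * deriv_poly b =
      const (b 0) * c 0 + const (b 1) * c 1 + const (b 2) * c 2" for b :: "nat \<Rightarrow> 'a"
    using cubic_commutators(5)[of ?y ?x]
    by (simp add: deriv_poly_def sum_lessThan_4 c_def distrib_left distrib_right right_diff_distrib
        mult.assoc const_left_commute[of ?y] del: cubic_simps)
  have x: "?x * deriv_poly b - deriv_poly b * ?x =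
      const (b 1) * c 0 + const (b 2) * c 1 + const (b 3) * c 2" for b :: "nat \<Rightarrow> 'a"
    using cubic_commutators(1-4)[of ?x ?y, symmetric]
    by (simp add: deriv_poly_def sum_lessThan_4 c_def distrib_left distrib_right right_diff_distrib
        mult.assoc const_left_commute[of ?x] del: cubic_simps)
  \<comment> \<open>The next three memberships come from the commutators of the first relation with
    y, of x with the first relation, and of x with the second. Their coefficient rows are those of
    the Hankel matrix.\<close>
  have e1: "const (a 0) * c 0 + const (a 1) * c 1 + const (a 2) * c 2 \<in> ?I"
    using two_sidedD(3-6)[OF I] r y[of a] by metis
  have e2: "const (a 1) * c 0 + const (a 2) * c 1 + const (a 3) * c 2 \<in> ?I"
    using two_sidedD(3-6)[OF I] r x[of a] by metis
  have "const (a 2) * c 0 + const (a 3) * c 1 + const (a (Suc 3)) * c 2 \<in> ?I"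
    using two_sidedD(3-6)[OF I] r(2) x[of "\<lambda>i. a (Suc i)"]
    by (metis One_nat_def Suc_1 eval_nat_numeral(3))
  then have e3: "const (a 2) * c 0 + const (a 3) * c 1 + const (a 4) * c 2 \<in> ?I" by simp
  have c0: "c 0 \<in> ?I"
    by (rule cramer_three[OF I, where p = "a 2 * a 4 - a 3 * a 3" and q = "a 2 * a 3 - a 1 * a 4"
          and r = "a 1 * a 3 - a 2 * a 2", OF _ _ _ e1 e2 e3])
      (use assms in \<open>auto simp: catalecticant_def algebra_simps\<close>)
  \<comment> \<open>\<open>cramer_three\<close> solves for the first unknown; the other two unknowns
    are moved to the front, with the cofactors of their own columns.\<close>
  have swap: "p + q + r = q + p + r" "p + q + r = r + p + q" for p q r :: "(xy, 'a) free_poly"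
    by (simp_all add: add_ac)
  have c1: "c 1 \<in> ?I"
    by (rule cramer_three[OF I, where p = "a 2 * a 3 - a 1 * a 4" and q = "a 0 * a 4 - a 2 * a 2"
          and r = "a 1 * a 2 - a 0 * a 3", OF _ _ _ e1[unfolded swap(1)[of "_ * c 0"]]
          e2[unfolded swap(1)[of "_ * c 0"]] e3[unfolded swap(1)[of "_ * c 0"]]])
      (use assms in \<open>auto simp: catalecticant_def algebra_simps\<close>)
  have c2: "c 2 \<in> ?I"
    by (rule cramer_three[OF I, where p = "a 1 * a 3 - a 2 * a 2" and q = "a 1 * a 2 - a 0 * a 3"
          and r = "a 0 * a 2 - a 1 * a 1", OF _ _ _ e1[unfolded swap(2)[of "_ * c 0"]]
          e2[unfolded swap(2)[of "_ * c 0"]] e3[unfolded swap(2)[of "_ * c 0"]]])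
      (use assms in \<open>auto simp: catalecticant_def algebra_simps\<close>)
  have c3: "c 3 = 0" using cubic_commutators(5)[of ?y ?x] by (simp add: c_def del: cubic_simps)
  have ii: "i = 0 \<or> i = 1 \<or> i = 2 \<or> i = 3" using i by auto
  show ?thesis
  proof (cases g)
    case Y
    then show ?thesis using ii c0 c1 c2 c3 two_sidedD(1)[OF I] unfolding c_def by auto
  next
    case X
    have "?s 0 * ?x - ?x * ?s 0 = 0" "?s 1 * ?x - ?x * ?s 1 = - c 0"
      "?s 2 * ?x - ?x * ?s 2 = - c 1" "?s 3 * ?x - ?x * ?s 3 = - c 2"
      using cubic_commutators(1-4)[of ?x ?y, symmetric]
      by (simp_all add: c_def del: cubic_simps)
    then show ?thesis using X ii c0 c1 c2 two_sidedD(1,5)[OF I] by metis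
  qed
qed

text \<open>Linear algebra modulo the span of A and B, with pivots p and q. The functionals
  \<open>m l\<close> kill A and B and are coordinates on the quotient; the unit vectors
  \<open>n l\<close> at the positions f and r represent the dual basis; \<open>b j\<close> and
  \<open>b' j\<close> express what remains of the j-th unit vector through A and B. All formulas are
  Cramer's rule for the minor at p, q.\<close>

lemma rank_two_coordinates_aux:
  fixes A B :: "nat \<Rightarrow> 'k::field"
  assumes idx: "distinct [p, q, f, r]" "{..<4} = {p, q, f, r}"
    and D: "A p * B q - A q * B p \<noteq> 0"
  shows "\<exists>m n :: bool \<Rightarrow> nat \<Rightarrow> 'k. \<exists>b b'.
    (\<forall>l. (\<Sum>i<4. m l i * A i) = 0 \<and> (\<Sum>i<4. m l i * B i) = 0) \<and>
    (\<forall>l l'. (\<Sum>i<4. n l i * m l' i) = (if l = l' then 1 else 0)) \<and>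
    (\<forall>i<4. \<forall>j<4. (if i = j then 1 else 0) =
      n True i * m True j + n False i * m False j + b j * A i + b' j * B i)"
proof -
  define e where "e l = (if l then f else r)" for l
  define c where "c = inverse (A p * B q - A q * B p)"
  define m where "m l i = (if i = p then c * (A q * B (e l) - A (e l) * B q)
    else if i = q then c * (B p * A (e l) - A p * B (e l)) else if i = e l then 1 else 0)" for l i
  define n where "n l i = (if i = e l then 1 else 0 :: 'k)" for l i
  define b where "b j = (if j = p then c * B q else if j = q then - c * B p else 0)" for j
  define b' where "b' j = (if j = p then - c * A q else if j = q then c * A p else 0)" for j
  have c: "c * (A p * B q - A q * B p) = 1" using D by (simp add: c_def)
  have ne: "p \<noteq> q" "p \<noteq> f" "p \<noteq> r" "q \<noteq> f" "q \<noteq> r" "f \<noteq> r" using idx(1) by auto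
  have sum: "sum g {..<4} = g p + g q + g f + g r" for g :: "nat \<Rightarrow> 'k"
    unfolding idx(2) using ne by (simp add: add.assoc)
  have mem: "i \<in> {p, q, f, r}" if "i < 4" for i using that idx(2) by blast
  have "(\<Sum>i<4. m l i * A i) = 0 \<and> (\<Sum>i<4. m l i * B i) = 0" for l
    unfolding sum m_def e_def
    by (cases l; intro conjI; simp only: ne ne[symmetric] if_True if_False simp_thms; insert c; Groebner_Basis.algebra)
  moreover have "(\<Sum>i<4. n l i * m l' i) = (if l = l' then 1 else 0)" for l l'
    unfolding sum m_def n_def e_def using ne by (cases l; cases l') simp_all
  moreover have "(if i = j then 1 else 0) = n True i * m True j + n False i * m False j + b j * A i + b' j * B i"
    if "i < 4" "j < 4" for i j
    using mem[OF that(1)] mem[OF that(2)] unfolding m_def n_def b_def b'_def e_def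
    by (elim insertE emptyE; simp only: ne ne[symmetric] if_True if_False simp_thms; insert c; simp add: algebra_simps)
  ultimately show ?thesis by blast
qed

text \<open>The two relations have coefficient rows \<open>a 0, ..., a 3\<close> and
  \<open>a 1, ..., a 4\<close>. A nonzero catalecticant provides a nonzero minor among the first
  three columns, so index 3 is never a pivot.\<close>

lemma rank_two_coordinates:
  fixes a :: "nat \<Rightarrow> 'k::field"
  assumes "catalecticant a \<noteq> 0"
  obtains m n :: "bool \<Rightarrow> nat \<Rightarrow> 'k" and b b' where
    "\<And>l. (\<Sum>i<4. m l i * a i) = 0" "\<And>l. (\<Sum>i<4. m l i * a (Suc i)) = 0"
    "\<And>l l'. (\<Sum>i<4. n l i * m l' i) = (if l = l' then 1 else 0)"
    "\<And>i j. i < 4 \<Longrightarrow> j < 4 \<Longrightarrow> (if i = j then 1 else 0) =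
      n True i * m True j + n False i * m False j + b j * a i + b' j * a (Suc i)"
proof -
  have "a 0 * a 2 - a 1 * a 1 \<noteq> 0 \<or> a 0 * a 3 - a 2 * a 1 \<noteq> 0 \<or> a 1 * a 3 - a 2 * a 2 \<noteq> 0"
  proof (rule ccontr)
    assume "\<not> ?thesis"
    then have 0: "a 0 * a 2 - a 1 * a 1 = 0" "a 0 * a 3 - a 2 * a 1 = 0" "a 1 * a 3 - a 2 * a 2 = 0"
      by auto
    \<comment> \<open>Expansion of the Hankel determinant along its last row.\<close>
    have "catalecticant a = a 4 * (a 0 * a 2 - a 1 * a 1) - a 3 * (a 0 * a 3 - a 2 * a 1)
        + a 2 * (a 1 * a 3 - a 2 * a 2)"
      by (simp add: catalecticant_def algebra_simps)
    then show False using assms unfolding 0 by simp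
  qed
  then obtain p q f where pqf: "(p, q, f) \<in> {(0::nat, 1::nat, 2::nat), (0, 2, 1), (1, 2, 0)}"
    and D: "a p * a (Suc q) - a q * a (Suc p) \<noteq> 0"
    by (elim disjE) (auto simp: eval_nat_numeral)
  have idx: "distinct [p, q, f, 3]" "{..<4} = {p, q, f, 3}" using pqf by auto
  from rank_two_coordinates_aux[OF idx, of a "\<lambda>i. a (Suc i)", OF D] that show thesis
    by (elim exE conjE) blast
qed

lemma central_of_generators:
  assumes J: "two_sided J" and "\<And>g. p * gen g - gen g * p \<in> J"
  shows "p * q - q * p \<in> J"
proof (induction q rule: free_poly_induct)
  case (const c)
  then show ?case using const_commute[of c p] two_sidedD(1)[OF J] by simp
next
  case (add q q')
  have "p * (q + q') - (q + q') * p = (p * q - q * p) + (p * q' - q' * p)"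
    by (simp add: algebra_simps)
  then show ?case using two_sidedD(2)[OF J] add by metis
next
  case (mult q q')
  have "p * (q * q') - q * q' * p = (p * q - q * p) * q' + q * (p * q' - q' * p)"
    by (simp add: algebra_simps)
  then show ?case using two_sidedD(2-4)[OF J] mult by metis
qed (use assms in auto)

lemma central_sum:
  assumes J: "two_sided J" and "\<And>i. i \<in> A \<Longrightarrow> s i * q - q * s i \<in> J"
  shows "(\<Sum>i\<in>A. const (c i) * s i) * q - q * (\<Sum>i\<in>A. const (c i) * s i) \<in> J"
  using assms(2)
proof (induction A rule: infinite_finite_induct)
  case (insert i A)
  have eq: "(\<Sum>i\<in>insert i A. const (c i) * s i) * q - q * (\<Sum>i\<in>insert i A. const (c i) * s i) =
      const (c i) * (s i * q - q * s i) +
      ((\<Sum>i\<in>A. const (c i) * s i) * q - q * (\<Sum>i\<in>A. const (c i) * s i))"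
    using insert(1,2)
    by (simp add: distrib_left distrib_right right_diff_distrib mult.assoc const_left_commute[of q])
  show ?case
    unfolding eq by (intro two_sidedD(2)[OF J] two_sidedD(3)[OF J] insert.IH insert.prems) simp_all
qed (use two_sidedD(1)[OF J] in auto)

lemma homog_cubic:
  assumes "x \<in> homog (free_alg wt) 1" "y \<in> homog (free_alg wt) 1"
  shows "cubic x y i \<in> homog (free_alg wt) 3"
proof -
  have "p * q * r \<in> homog (free_alg wt) 3"
    if "p \<in> homog (free_alg wt) 1" "q \<in> homog (free_alg wt) 1" "r \<in> homog (free_alg wt) 1" for p q r
    using homog_free_alg_closed(4)[OF homog_free_alg_closed(4)[OF that(1,2)] that(3)] by simp
  then show ?thesis
    unfolding cubic_def by (auto intro!: homog_free_alg_closed(2) assms)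
qed

text \<open>In J(w) the class of the i-th cubic is the sum over l of \<open>m l i\<close> times a
  central element \<open>z l\<close>. Hence x, y correspond to x_1, x_2 and the \<open>z l\<close>
  to the y_l. The indices \<open>True\<close> and \<open>False\<close> stand for 1 and 2.\<close>

lemma nonzero_catalecticant_iso:
  fixes a :: "nat \<Rightarrow> 'k::field_char_0"
  assumes cat: "catalecticant a \<noteq> 0"
  shows "\<exists>M\<^sub>1 M\<^sub>2 :: 'k^2^2. graded_alg_iso
    (presented_alg (\<lambda>_. 1) {deriv_poly a, deriv_poly (\<lambda>i. a (Suc i))})
    (A_alg (\<lambda>l :: 2. if l = 1 then M\<^sub>1 else M\<^sub>2))"
proof -
  obtain m n :: "bool \<Rightarrow> nat \<Rightarrow> 'k" and b b' where
    ma: "\<And>l. (\<Sum>i<4. m l i * a i) = 0" "\<And>l. (\<Sum>i<4. m l i * a (Suc i)) = 0"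
    and nm: "\<And>l l'. (\<Sum>i<4. n l i * m l' i) = (if l = l' then 1 else 0)"
    and split: "\<And>i j. i < 4 \<Longrightarrow> j < 4 \<Longrightarrow> (if i = j then 1 else 0) =
      n True i * m True j + n False i * m False j + b j * a i + b' j * a (Suc i)"
    by (rule rank_two_coordinates[OF cat]) blast
  \<comment> \<open>The entry at (i, j) is the l-th coordinate of x_i x_j^2 + x_j x_i x_j + x_j^2
    x_i. On the diagonal this is three times a cube; at (1, 2) it is the cubic with two letters y,
    at (2, 1) the one with a single y.\<close>
  define M :: "bool \<Rightarrow> 'k^2^2" where
    "M l = (\<chi> i j. if i = 1 then (if j = 1 then 3 * m l 0 else m l 2)
       else (if j = 1 then m l 1 else 3 * m l 3))" for l
  let ?M = "\<lambda>l :: 2. if l = 1 then M True else M False"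
  let ?I = "quartic_ideal a" and ?I' = "rel_ideal (A_relations ?M)"
  let ?x = "gen X :: (xy, 'k) free_poly" and ?y = "gen Y :: (xy, 'k) free_poly"
  let ?x' = "gen (XG 1) :: (2 gens, 'k) free_poly" and ?y' = "gen (XG 2) :: (2 gens, 'k) free_poly"
  define f :: "xy \<Rightarrow> (2 gens, 'k) free_poly" where "f g = (case g of X \<Rightarrow> ?x' | Y \<Rightarrow> ?y')" for g
  define z where "z l = (\<Sum>i<4. const (n l i) * cubic ?x ?y i)" for l
  define f' :: "2 gens \<Rightarrow> (xy, 'k) free_poly" where
    "f' g = (case g of XG i \<Rightarrow> if i = 1 then ?x else ?y | YG l \<Rightarrow> z (l = 1))" for g
  define y :: "bool \<Rightarrow> (2 gens, 'k) free_poly" where "y l = gen (YG (if l then 1 else 2))" for l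
  \<comment> \<open>The relations of A(M_1, M_2) apart from centrality, with the factor 3 removed on
    the diagonal.\<close>
  define t where "t i = cubic ?x' ?y' i - const (m True i) * y True - const (m False i) * y False" for i
  have I: "two_sided ?I" unfolding quartic_ideal_def by (rule two_sided_rel_ideal)
  have I': "two_sided ?I'" by (rule two_sided_rel_ideal)
  have f_cubic: "free_hom f (cubic ?x ?y i) = cubic ?x' ?y' i" for i
    by (simp add: cubic_def free_hom_simps f_def)
  have f'_cubic: "free_hom f' (cubic ?x' ?y' i) = cubic ?x ?y i" for i
    by (simp add: cubic_def free_hom_simps f'_def)
  define rel :: "2 \<Rightarrow> 2 \<Rightarrow> (2 gens, 'k) free_poly" where "rel i j = gen (XG i) * gen (XG j) * gen (XG j) + gen (XG j) * gen (XG i) * gen (XG j)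
      + gen (XG j) * gen (XG j) * gen (XG i) - (\<Sum>l\<in>UNIV. const (?M l $ i $ j) * gen (YG l))" for i j
  have rel_t: "rel 1 1 = const 3 * t 0" "rel 1 2 = t 2" "rel 2 1 = t (Suc 0)" "rel 2 2 = const 3 * t 3"
    by (simp_all add: rel_def t_def y_def M_def UNIV_2 right_diff_distrib const_mult
        mult.assoc algebra_simps) (simp_all add: const_3_mult add.assoc)
  have rel_cases: "rel i j \<in> {const 3 * t 0, t 2, t (Suc 0), const 3 * t 3}" for i j
    using exhaust_2[of i] exhaust_2[of j] rel_t by auto
  have A_rel: "A_relations ?M = {rel i j |i j. True} \<union>
      {gen (YG l) * gen g - gen g * gen (YG l) |l g. True}"
    unfolding A_relations_def rel_def ..
  have t: "t i \<in> ?I'" if "i < 4" for i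
  proof -
    have rel: "rel i j \<in> ?I'" for i j
      using rel_ideal_superset[of "A_relations ?M"] unfolding A_rel by blast
    have "const (inverse 3) * (const 3 * p) = p" for p :: "(2 gens, 'k) free_poly"
      by (simp add: mult.assoc[symmetric] const_mult[symmetric])
    then have "t 0 \<in> ?I'" "t 3 \<in> ?I'"
      using rel[of 1 1] rel[of 2 2] two_sidedD(3)[OF I', of _ "const (inverse 3)"] rel_t by metis+
    moreover have "t (Suc 0) \<in> ?I'" "t 2 \<in> ?I'" using rel[of 2 1] rel[of 1 2] rel_t by simp_all
    moreover have "i = 0 \<or> i = Suc 0 \<or> i = 2 \<or> i = 3" using that by auto
    ultimately show ?thesis by blast
  qed
  \<comment> \<open>Modulo the relations \<open>t\<close>, the combination with coefficients c
    becomes the sum over l of the pairing of \<open>m l\<close> with c times \<open>y l\<close>. The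
    pairings vanish for both relations of J(w), and for c = \<open>n l\<close> they single out
    \<open>y l\<close>.\<close>
  have sum_t: "(\<Sum>i<4. const (c i) * cubic ?x' ?y' i) =
      (\<Sum>i<4. const (c i) * t i) + const (\<Sum>i<4. m True i * c i) * y True
      + const (\<Sum>i<4. m False i * c i) * y False" for c
    by (simp add: t_def sum_lessThan_4 const_add const_mult algebra_simps mult.commute[of "m _ _"] del: cubic_simps)
  have sum_t_mem: "(\<Sum>i<4. const (c i) * t i) \<in> ?I'" for c
    unfolding sum_lessThan_4 using t two_sidedD(2,3)[OF I'] by auto
  have "graded_alg_iso (presented_alg (\<lambda>_. 1) {deriv_poly a, deriv_poly (\<lambda>i. a (Suc i))})
      (presented_alg gens_deg (A_relations ?M))"
  proof (rule presented_alg_isoI[where f = f and f' = f'])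
    fix r assume "r \<in> {deriv_poly a, deriv_poly (\<lambda>i. a (Suc i))}"
    then obtain c where r: "r = deriv_poly c" and mc: "\<And>l. (\<Sum>i<4. m l i * c i) = 0"
      using ma by auto
    have "free_hom f r = (\<Sum>i<4. const (c i) * cubic ?x' ?y' i)"
      unfolding r deriv_poly_def by (simp add: free_hom_simps f_cubic)
    then show "free_hom f r \<in> ?I'" unfolding sum_t mc using sum_t_mem by simp
  next
    have Y_central: "z l * q - q * z l \<in> ?I" for l q
      unfolding z_def
      by (rule central_of_generators[OF I]) (rule central_sum[OF I], rule cubic_central[OF cat], simp)
    have f't: "free_hom f' (t j) \<in> ?I" if "j < 4" for j
    proof -
      have "free_hom f' (t j) = cubic ?x ?y j - const (m True j) * z True - const (m False j) * z False"
        by (simp add: t_def free_hom_simps f'_cubic y_def f'_def)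
      also have "\<dots> = (\<Sum>i<4. const (if i = j then 1 else 0) * cubic ?x ?y i)
          - const (m True j) * z True - const (m False j) * z False"
        using that by (simp add: if_distrib[of const] if_distrib[of "\<lambda>c. c * _"] cong: if_cong)
      also have "\<dots> = (\<Sum>i<4. const ((if i = j then 1 else 0) - m True j * n True i - m False j * n False i) * cubic ?x ?y i)"
        unfolding z_def sum_distrib_left sum_subtractf[symmetric]
        by (intro sum.cong refl) (simp only: const_diff const_mult left_diff_distrib mult.assoc)
      \<comment> \<open>By \<open>split\<close>, the j-th unit vector minus its components along
        \<open>n True\<close> and \<open>n False\<close> is a combination of the coefficient rows of
        the two relations.\<close>
      also have "\<dots> = (\<Sum>i<4. const (b j * a i + b' j * a (Suc i)) * cubic ?x ?y i)"
      proof (intro sum.cong refl)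
        fix i assume "i \<in> {..<4::nat}"
        then have "(if i = j then 1 else 0) - m True j * n True i - m False j * n False i = b j * a i + b' j * a (Suc i)"
          using split[of i j] that by (simp add: mult.commute)
        then show "const ((if i = j then 1 else 0) - m True j * n True i - m False j * n False i) * cubic ?x ?y i =
            const (b j * a i + b' j * a (Suc i)) * cubic ?x ?y i" by (rule arg_cong)
      qed
      also have "\<dots> = const (b j) * deriv_poly a + const (b' j) * deriv_poly (\<lambda>i. a (Suc i))"
        unfolding deriv_poly_def sum_distrib_left sum.distrib[symmetric]
        by (intro sum.cong refl) (simp only: const_add const_mult distrib_right mult.assoc)
      also have "\<dots> \<in> ?I"
        using two_sidedD(2,3)[OF I] rel_ideal_superset[of "{deriv_poly a, deriv_poly (\<lambda>i. a (Suc i))}"]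
        unfolding quartic_ideal_def by auto
      finally show ?thesis .
    qed
    fix r assume "r \<in> A_relations ?M"
    then consider i j where "r = rel i j" | l g where "r = gen (YG l) * gen g - gen g * gen (YG l)"
      unfolding A_rel by blast
    then show "free_hom f' r \<in> rel_ideal {deriv_poly a, deriv_poly (\<lambda>i. a (Suc i))}"
      unfolding quartic_ideal_def[symmetric]
    proof cases
      case (1 i j)
      then show "free_hom f' r \<in> ?I"
        using rel_cases[of i j] f't two_sidedD(3)[OF I] by (auto simp: free_hom_mult simp del: t_def)
    next
      case (2 l g)
      then show "free_hom f' r \<in> ?I"
        using Y_central by (simp add: free_hom_simps) (simp add: f'_def)
    qed
  next
    show "free_hom f' (f g) - gen g \<in> rel_ideal {deriv_poly a, deriv_poly (\<lambda>i. a (Suc i))}" for g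
      using two_sidedD(1)[OF two_sided_rel_ideal] by (cases g) (simp_all add: f_def f'_def)
  next
    fix h :: "2 gens"
    show "free_hom f (f' h) - gen h \<in> ?I'"
    proof (cases h)
      case (XG i)
      then show ?thesis
        using exhaust_2[of i] two_sidedD(1)[OF I'] by (auto simp: f_def f'_def)
    next
      case (YG l)
      have l: "y (l = 1) = gen h" using YG exhaust_2[of l] by (auto simp: y_def)
      have "free_hom f (f' h) = (\<Sum>i<4. const (n (l = 1) i) * cubic ?x' ?y' i)"
        using YG by (simp add: f'_def z_def free_hom_simps f_cubic)
      also have "\<dots> = (\<Sum>i<4. const (n (l = 1) i) * t i) + gen h"
        unfolding sum_t using nm[of "l = 1"] l
        by (cases "l = 1") (simp_all add: mult.commute[of "m _ _"])
      finally show ?thesis using sum_t_mem by simp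
    qed
  next
    show "f g \<in> homog (free_alg gens_deg) (int 1)" for g
      using homog_free_alg_closed(5)[of "XG 1 :: 2 gens" gens_deg]
        homog_free_alg_closed(5)[of "XG 2 :: 2 gens" gens_deg]
      by (cases g) (simp_all add: f_def)
  next
    fix h :: "2 gens"
    have gen1: "(gen g :: (xy, 'k) free_poly) \<in> homog (free_alg (\<lambda>_. 1)) 1" for g
      using homog_free_alg_closed(5)[of g "\<lambda>_. 1"] by simp
    have "z l \<in> homog (free_alg (\<lambda>_. 1)) 3" for l
      unfolding z_def sum_lessThan_4
      by (intro homog_free_alg_closed(2) homog_free_alg_const_mult homog_cubic gen1)
    then show "f' h \<in> homog (free_alg (\<lambda>_. 1)) (int (gens_deg h))"
      using gen1 by (cases h) (simp_all add: f'_def)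
  qed
  then show ?thesis unfolding A_alg_def by blast
qed

subsection \<open>Zero catalecticant\<close>

lemma calabi_yauE:
  assumes "calabi_yau d S"
  obtains P \<delta> \<epsilon> where "nat_graded_algebra S"
    "finite_fg_projective_resolution (env_alg S) (env_left S) P \<delta> \<epsilon>"
    "\<And>i. i \<noteq> d \<Longrightarrow>
      carrier (graded_Ext (env_alg S) P \<delta> i) = {\<zero>\<^bsub>graded_Ext (env_alg S) P \<delta> i\<^esub>}"
  using assms unfolding calabi_yau_def 
  by (elim conjE exE) (rule that; (assumption | drule spec, drule (1) mp, assumption))

lemma presented_alg_cong: "rel_ideal R = rel_ideal R' \<Longrightarrow> presented_alg wt R = presented_alg wt R'"
  by (simp add: presented_alg_def Idl_free_alg)

text \<open>The homomorphism that sends all generators to 0 has an ideal as its kernel. It detects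
  that an element with nonzero constant term, such as 1, stays outside an ideal of relations without
  constant terms.\<close>

lemma one_notin_augmentation:
  assumes R: "\<And>r. r \<in> R \<Longrightarrow> free_hom (\<lambda>_. 0) r = (0 :: ('g, 'k::field) free_poly)"
    and p: "p \<in> rel_ideal R"
  shows "free_hom (\<lambda>_. 0) p = (0 :: ('g, 'k) free_poly)"
proof -
  have "two_sided {0 :: ('g, 'k) free_poly}" by (simp add: two_sided_def)
  from two_sided_vimage[OF this, of "\<lambda>_. 0"] R p show ?thesis
    using rel_ideal_minimal[of "{p. free_hom (\<lambda>_. 0) p \<in> {0}}" R] by auto
qed

section \<open>Triples of coefficients with respect to 1, z, z^2\<close>

definition scale3 :: "'k::field \<Rightarrow> ('g, 'k) free_poly \<times> ('g, 'k) free_poly \<times> ('g, 'k) free_poly \<Rightarrow>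
    ('g, 'k) free_poly \<times> ('g, 'k) free_poly \<times> ('g, 'k) free_poly" where
  "scale3 c v = (const c * fst v, const c * fst (snd v), const c * snd (snd v))"

lemma scale3_simps:
  "scale3 c (v + v') = scale3 c v + scale3 c v'" "scale3 (c + d) v = scale3 c v + scale3 d v"
  "scale3 c (scale3 d v) = scale3 (c * d) v" "scale3 1 v = v" "scale3 0 v = 0"
  by (simp_all add: zero_prod_def scale3_def distrib_left distrib_right const_add const_mult mult.assoc)

text \<open>The last component is dropped: multiplication by z would turn it into a multiple of z^3,
  which is zero in the algebra.\<close>

definition shift3 :: "'a::zero \<times> 'a \<times> 'a \<Rightarrow> 'a \<times> 'a \<times> 'a" where
  "shift3 v = (0, fst v, fst (snd v))"

text \<open>
  A triple \<open>(u, v, w)\<close> stands for \<open>u + z v + z\<^sup>2 w\<close>, and \<open>shift3\<close> for left multiplication by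
  \<open>z\<close>. If left multiplication by a complementary linear form \<open>z'\<close> lifts to triples compatibly with
  the relations, then the last component of the lift of \<open>p\<close> is the coefficient of \<open>z\<^sup>2\<close> in \<open>p\<close>.
\<close>

lemma not_calabi_yau_of_lift:
  fixes z z' :: "(xy, 'k::field) free_poly" and R :: "(xy, 'k) free_poly set"
  defines "I \<equiv> rel_ideal R"
  assumes basis: "z = const p * gen X + const q * gen Y" "z' = const r * gen X + const s * gen Y"
      "p * s - q * r \<noteq> 0"
    and z3: "z * z * z \<in> I"
    and R0: "\<And>r. r \<in> R \<Longrightarrow> free_hom (\<lambda>_. 0) r = (0 :: (xy, 'k) free_poly)"
    and T_add: "\<And>v v'. T (v + v') = T v + T v'"
    and T_scale: "\<And>c v. T (scale3 c v) = scale3 c (T v)"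
    and T_ideal: "\<And>v. v \<in> I \<times> I \<times> I \<Longrightarrow> T v \<in> I \<times> I \<times> I"
    and T_lift: "\<And>u v w. (case T (u, v, w) of (u', v', w') \<Rightarrow> u' + z * v' + z * z * w')
      - z' * (u + z * v + z * z * w) \<in> I"
    and rel: "\<And>\<rho> r v. (\<And>p q v. \<rho> (p + q) v = \<rho> p v + \<rho> q v) \<Longrightarrow>
      (\<And>p q v. \<rho> (p * q) v = \<rho> p (\<rho> q v)) \<Longrightarrow> (\<And>c v. \<rho> (const c) v = scale3 c v) \<Longrightarrow>
      (\<And>v. \<rho> z v = shift3 v) \<Longrightarrow> (\<And>v. \<rho> z' v = T v) \<Longrightarrow> r \<in> R \<Longrightarrow> \<rho> r v \<in> I \<times> I \<times> I"
  shows "\<not> calabi_yau 3 (presented_alg (\<lambda>_. 1) R)"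
proof
  let ?S = "presented_alg (\<lambda>_. 1) R" and ?Q = "pres (\<lambda>_. 1) R"
  assume cy: "calabi_yau 3 ?S"
  then interpret nat_graded_algebra ?S by (rule calabi_yauE)
  interpret enveloping ?S by unfold_locales
  have I: "two_sided I" unfolding I_def by (rule two_sided_rel_ideal)
  \<comment> \<open>The inverse determinant of the coordinate change; it expresses X and Y through z
    and z', so the operators for z and z' determine those for the generators.\<close>
  define D where "D = inverse (p * s - q * r)"
  have D: "D * (p * s - q * r) = 1" using basis(3) by (simp add: D_def)
  define act where "act g v = (case g of X \<Rightarrow> scale3 (D * s) (shift3 v) + scale3 (- D * q) (T v)
    | Y \<Rightarrow> scale3 (- D * r) (shift3 v) + scale3 (D * p) (T v))" for g v
  have act: "act X v = scale3 (D * s) (shift3 v) + scale3 (- D * q) (T v)"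
    "act Y v = scale3 (- D * r) (shift3 v) + scale3 (D * p) (T v)" for v
    by (simp_all add: act_def)
  have shift3_add: "shift3 (v + v') = shift3 v + shift3 v'" for v v' :: "(xy, 'k) free_poly \<times> _ \<times> _"
    by (simp add: shift3_def)
  have shift3_scale: "shift3 (scale3 c v) = scale3 c (shift3 v)" for c and v :: "(xy, 'k) free_poly \<times> _ \<times> _"
    by (simp add: shift3_def scale3_def)
  interpret A: free_action scale3 act
    by unfold_locales
      (auto simp: scale3_simps act_def shift3_add shift3_scale T_add T_scale mult.commute split: xy.split)
  let ?\<rho> = A.poly_act
  have \<rho>z: "?\<rho> z v = shift3 v" for v
  proof -
    have "?\<rho> z v = scale3 (p * (D * s) + q * (- D * r)) (shift3 v) + scale3 (p * (- D * q) + q * (D * p)) (T v)"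
      unfolding basis(1) A.poly_act_add_l A.poly_act_mult A.poly_act_const A.poly_act_gen act
      by (simp only: scale3_simps add_ac)
    also have "p * (D * s) + q * (- D * r) = 1" using D by (simp add: algebra_simps)
    also have "p * (- D * q) + q * (D * p) = 0" by (simp add: algebra_simps)
    finally show ?thesis by (simp add: scale3_simps)
  qed
  have \<rho>z': "?\<rho> z' v = T v" for v
  proof -
    have "?\<rho> z' v = scale3 (r * (D * s) + s * (- D * r)) (shift3 v) + scale3 (r * (- D * q) + s * (D * p)) (T v)"
      unfolding basis(2) A.poly_act_add_l A.poly_act_mult A.poly_act_const A.poly_act_gen act
      by (simp only: scale3_simps add_ac)
    also have "r * (- D * q) + s * (D * p) = 1" using D by (simp add: algebra_simps)
    also have "r * (D * s) + s * (- D * r) = 0" by (simp add: algebra_simps)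
    finally show ?thesis by (simp add: scale3_simps)
  qed
  have I3_add: "v + v' \<in> I \<times> I \<times> I" if "v \<in> I \<times> I \<times> I" "v' \<in> I \<times> I \<times> I" for v v'
    using that two_sidedD(2)[OF I] by auto
  have I3_scale: "scale3 c v \<in> I \<times> I \<times> I" if "v \<in> I \<times> I \<times> I" for c v
    using that two_sidedD(3)[OF I] by (auto simp: scale3_def)
  have I3_shift: "shift3 v \<in> I \<times> I \<times> I" if "v \<in> I \<times> I \<times> I" for v
    using that two_sidedD(1)[OF I] by (auto simp: shift3_def)
  have \<rho>_ideal: "?\<rho> p v \<in> I \<times> I \<times> I" if "v \<in> I \<times> I \<times> I" for p v
    using that
  proof (induction p arbitrary: v rule: free_poly_induct)
    case (gen g)
    then show ?case
      using I3_add I3_scale I3_shift T_ideal by (cases g) (simp_all only: A.poly_act_gen act)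
  qed (simp_all only: A.poly_act_const A.poly_act_add_l A.poly_act_mult I3_scale I3_add)
  \<comment> \<open>The polynomials that send all triples into
    \<open>I \<times> I \<times> I\<close> form an ideal, since the action preserves this set. It
    contains R by \<open>rel\<close>, hence all of I.\<close>
  have \<rho>_rel: "?\<rho> p v \<in> I \<times> I \<times> I" if "p \<in> I" for p v
  proof -
    have "?\<rho> 0 v \<in> I \<times> I \<times> I" for v
      using two_sidedD(1)[OF I] by (simp add: zero_prod_def)
    then have "two_sided {p. \<forall>v. ?\<rho> p v \<in> I \<times> I \<times> I}"
      unfolding two_sided_def mem_Collect_eq A.poly_act_add_l A.poly_act_mult
      by (intro conjI ballI allI) (simp_all only: mem_Collect_eq I3_add \<rho>_ideal)
    moreover have "R \<subseteq> {p. \<forall>v. ?\<rho> p v \<in> I \<times> I \<times> I}"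
      using rel[of ?\<rho>, OF A.poly_act_add_l A.poly_act_mult A.poly_act_const \<rho>z \<rho>z'] by blast
    ultimately show ?thesis using rel_ideal_minimal that unfolding I_def by blast
  qed
  \<comment> \<open>Evaluation of a triple. Modulo I it turns the action on triples into left
    multiplication, as \<open>\<iota>\<rho>\<close> shows.\<close>
  define \<iota> where "\<iota> v = fst v + z * fst (snd v) + z * z * snd (snd v)" for v
  have \<iota>_add: "\<iota> (v + v') = \<iota> v + \<iota> v'" for v v' by (simp add: \<iota>_def algebra_simps)
  have \<iota>_scale: "\<iota> (scale3 c v) = const c * \<iota> v" for c v
    by (simp add: \<iota>_def scale3_def distrib_left const_left_commute[of z] mult.assoc)
  have \<iota>_shift: "\<iota> (shift3 v) - z * \<iota> v \<in> I" for v
  proof -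
    have "\<iota> (shift3 v) - z * \<iota> v = - (z * z * z * snd (snd v))"
      by (simp add: \<iota>_def shift3_def algebra_simps)
    then show ?thesis using two_sidedD(4,5)[OF I] z3 by metis
  qed
  have \<iota>_T: "\<iota> (T v) - z' * \<iota> v \<in> I" for v
    using T_lift[of "fst v" "fst (snd v)" "snd (snd v)"] by (simp add: \<iota>_def case_prod_beta)
  have xy: "gen X = const (D * s) * z + const (- D * q) * z'"
    "gen Y = const (- D * r) * z + const (D * p) * z'"
  proof -
    have comb: "const c * z + const d * z' =
        const (c * p + d * r) * gen X + const (c * q + d * s) * gen Y" for c d
    proof -
      have "const c * z + const d * z' =
          (const (c * p) * gen X + const (d * r) * gen X) + (const (c * q) * gen Y + const (d * s) * gen Y)"
        unfolding basis by (simp only: distrib_left mult.assoc[symmetric] const_mult[symmetric] add_ac)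
      then show ?thesis by (simp only: const_add distrib_right)
    qed
    have "D * s * p + - D * q * r = 1" "D * s * q + - D * q * s = 0"
      "- D * r * p + D * p * r = 0" "- D * r * q + D * p * s = 1"
      using D by (simp_all add: algebra_simps)
    then show "gen X = const (D * s) * z + const (- D * q) * z'"
      "gen Y = const (- D * r) * z + const (D * p) * z'"
      unfolding comb by simp_all
  qed
  have \<iota>_gen: "\<iota> (scale3 c (shift3 v) + scale3 d (T v)) - (const c * z + const d * z') * \<iota> v \<in> I" for c d v
  proof -
    have "\<iota> (scale3 c (shift3 v) + scale3 d (T v)) - (const c * z + const d * z') * \<iota> v =
        const c * (\<iota> (shift3 v) - z * \<iota> v) + const d * (\<iota> (T v) - z' * \<iota> v)"
      by (simp add: \<iota>_add \<iota>_scale algebra_simps)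
    then show ?thesis using \<iota>_shift \<iota>_T two_sidedD(2,3)[OF I] by metis
  qed
  have \<iota>\<rho>: "\<iota> (?\<rho> p v) - p * \<iota> v \<in> I" for p v
  proof (induction p arbitrary: v rule: free_poly_induct)
    case (const c)
    then show ?case using two_sidedD(1)[OF I] by (simp add: A.poly_act_const \<iota>_scale)
  next
    case (gen g)
    then show ?case
      unfolding A.poly_act_gen using \<iota>_gen by (cases g) (simp_all only: act xy)
  next
    case (add p q)
    have "\<iota> (?\<rho> (p + q) v) - (p + q) * \<iota> v = (\<iota> (?\<rho> p v) - p * \<iota> v) + (\<iota> (?\<rho> q v) - q * \<iota> v)"
      by (simp add: A.poly_act_add_l \<iota>_add algebra_simps)
    then show ?case using add two_sidedD(2)[OF I] by metis
  next
    case (mult p q)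
    have "\<iota> (?\<rho> (p * q) v) - p * q * \<iota> v =
        (\<iota> (?\<rho> p (?\<rho> q v)) - p * \<iota> (?\<rho> q v)) + p * (\<iota> (?\<rho> q v) - q * \<iota> v)"
      by (simp add: A.poly_act_mult algebra_simps)
    then show ?case using mult two_sidedD(2,3)[OF I] by metis
  qed
  define lam where "lam p = snd (snd (?\<rho> p (1, 0, 0)))" for p
  have lam_add: "lam (p + q) = lam p + lam q" for p q by (simp add: lam_def A.poly_act_add_l)
  have lam_const: "lam (const c * p) = const c * lam p" for c p
    by (simp add: lam_def A.poly_act_mult A.poly_act_const scale3_def)
  have lam_diff: "lam (p - q) = lam p - lam q" for p q by (rule additive_diff) (rule lam_add)
  have lam_ideal: "lam p \<in> I" if "p \<in> I" for p
    using \<rho>_rel[OF that, of "(1, 0, 0)"] unfolding lam_def by (auto simp: mem_Times_iff)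
  \<comment> \<open>Applying p to (1, 0, 0) yields a triple that evaluates to p modulo I. Shifting
    it once or twice brings its middle or first component into the last place, so these components
    are \<open>lam (z * p)\<close> and \<open>lam (z * (z * p))\<close>.\<close>
  have lam_split: "lam (z * (z * p)) + z * lam (z * p) + z * (z * lam p) - p \<in> I" for p
    using \<iota>\<rho>[of p "(1, 0, 0)"]
    by (simp add: lam_def A.poly_act_mult \<rho>z \<iota>_def shift3_def mult.assoc)
  define \<kappa> where "\<kappa> s = ?Q (lam (SOME p. ?Q p = s))" for s
  have \<kappa>: "\<kappa> (?Q p) = ?Q (lam p)" for p
  proof -
    define q where "q = (SOME q. ?Q q = ?Q p)"
    have "?Q q = ?Q p" unfolding q_def by (rule someI) (rule refl)
    then have "lam (q - p) \<in> I" unfolding pres_eq_iff I_def[symmetric] by (rule lam_ideal)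
    then have "?Q (lam q) = ?Q (lam p)" unfolding pres_eq_iff I_def[symmetric] lam_diff .
    then show ?thesis unfolding \<kappa>_def q_def .
  qed
  have no: "\<not> finite_fg_projective_resolution (env_alg ?S) (env_left ?S) P \<delta> \<epsilon>" for P \<delta> \<epsilon>
  proof (rule cube_zero_not_resolved[where x = "?Q z" and \<kappa> = \<kappa>])
    show "?Q z \<in> carrier ?S" by (simp add: pres_carrier)
    show "?Q z \<otimes>\<^bsub>?S\<^esub> (?Q z \<otimes>\<^bsub>?S\<^esub> ?Q z) = \<zero>\<^bsub>?S\<^esub>"
      unfolding pres_mult pres_zero pres_eq_iff using z3 by (simp add: I_def mult.assoc)
  next
    fix t assume "t \<in> carrier ?S"
    then obtain p where t: "t = ?Q p" unfolding pres_carrier by blast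
    show "\<kappa> t \<in> carrier ?S" unfolding t \<kappa> pres_carrier by blast
    show "\<kappa> (c \<odot>\<^bsub>?S\<^esub> t) = c \<odot>\<^bsub>?S\<^esub> \<kappa> t" for c
      unfolding t pres_smult \<kappa> lam_const ..
    show "\<kappa> (?Q z \<otimes>\<^bsub>?S\<^esub> (?Q z \<otimes>\<^bsub>?S\<^esub> t)) \<oplus>\<^bsub>?S\<^esub> ?Q z \<otimes>\<^bsub>?S\<^esub> \<kappa> (?Q z \<otimes>\<^bsub>?S\<^esub> t)
        \<oplus>\<^bsub>?S\<^esub> ?Q z \<otimes>\<^bsub>?S\<^esub> (?Q z \<otimes>\<^bsub>?S\<^esub> \<kappa> t) = t"
      unfolding t pres_mult \<kappa> pres_add pres_eq_iff I_def[symmetric] by (rule lam_split)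
    show "\<one>\<^bsub>?S\<^esub> \<noteq> (?Q z \<otimes>\<^bsub>?S\<^esub> ?Q z) \<otimes>\<^bsub>?S\<^esub> t \<oplus>\<^bsub>?S\<^esub> ?Q z \<otimes>\<^bsub>?S\<^esub> t \<otimes>\<^bsub>?S\<^esub> ?Q z
        \<oplus>\<^bsub>?S\<^esub> t \<otimes>\<^bsub>?S\<^esub> (?Q z \<otimes>\<^bsub>?S\<^esub> ?Q z)"
    proof
      assume eq: "\<one>\<^bsub>?S\<^esub> = (?Q z \<otimes>\<^bsub>?S\<^esub> ?Q z) \<otimes>\<^bsub>?S\<^esub> t \<oplus>\<^bsub>?S\<^esub> ?Q z \<otimes>\<^bsub>?S\<^esub> t \<otimes>\<^bsub>?S\<^esub> ?Q z
        \<oplus>\<^bsub>?S\<^esub> t \<otimes>\<^bsub>?S\<^esub> (?Q z \<otimes>\<^bsub>?S\<^esub> ?Q z)"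
      have "1 - (z * z * p + z * p * z + p * (z * z)) \<in> rel_ideal R"
        using eq unfolding t pres_mult pres_one pres_add pres_eq_iff .
      \<comment> \<open>Every term on the right contains z, which has no constant term, whereas 1
        has constant term 1.\<close>
      from one_notin_augmentation[OF R0 this] show False
        unfolding basis by (simp add: free_hom_simps)
    qed
  next
    fix t t' assume "t \<in> carrier ?S" "t' \<in> carrier ?S"
    then obtain p q where t: "t = ?Q p" "t' = ?Q q" unfolding pres_carrier by blast
    show "\<kappa> (t \<oplus>\<^bsub>?S\<^esub> t') = \<kappa> t \<oplus>\<^bsub>?S\<^esub> \<kappa> t'"
      unfolding t pres_add \<kappa> lam_add ..
  qed
  show False by (rule calabi_yauE[OF cy]) (erule notE[OF no])
qed

text \<open>The algebra is the free product of k[z]/(z^3) with k[z'] or, if \<open>\<beta>\<close>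
  is nonzero, with k[z']/(z'^3). A product with z' on the left has no components at z and z^2, so
  \<open>T\<close> puts the whole product into the first place.\<close>

lemma two_cubes_not_calabi_yau:
  fixes z z' :: "(xy, 'k::field) free_poly"
  assumes basis: "z = const p * gen X + const q * gen Y" "z' = const r * gen X + const s * gen Y"
      "p * s - q * r \<noteq> 0"
    and "\<alpha> \<noteq> 0"
  shows "\<not> calabi_yau 3 (presented_alg (\<lambda>_. 1) {const \<alpha> * (z * z * z), const \<beta> * (z' * z' * z')})"
proof -
  let ?R = "{const \<alpha> * (z * z * z), const \<beta> * (z' * z' * z')}"
  let ?I = "rel_ideal ?R"
  define T where "T v = (z' * (fst v + z * fst (snd v) + z * z * snd (snd v)),
    0 :: (xy, 'k) free_poly, 0 :: (xy, 'k) free_poly)" for v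
  have I: "two_sided ?I" by (rule two_sided_rel_ideal)
  have R: "const \<alpha> * (z * z * z) \<in> ?I" "const \<beta> * (z' * z' * z') \<in> ?I"
    using rel_ideal_superset by blast+
  show ?thesis
  proof (rule not_calabi_yau_of_lift[OF basis, where T = T])
    have "z * z * z = const (inverse \<alpha>) * (const \<alpha> * (z * z * z))"
      using \<open>\<alpha> \<noteq> 0\<close> by (simp add: mult.assoc[symmetric] const_mult[symmetric])
    then show "z * z * z \<in> ?I" using two_sidedD(3)[OF I R(1)] by metis
  next
    fix r assume "r \<in> ?R"
    then show "free_hom (\<lambda>_. 0) r = (0 :: (xy, 'k) free_poly)"
      by (auto simp: basis free_hom_simps)
  next
    show "T (v + v') = T v + T v'" for v v' by (simp add: T_def algebra_simps)
    show "T (scale3 c v) = scale3 c (T v)" for c v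
      by (simp add: T_def scale3_def distrib_left mult.assoc const_left_commute[of z] const_left_commute[of z'])
    show "T v \<in> ?I \<times> ?I \<times> ?I" if "v \<in> ?I \<times> ?I \<times> ?I" for v
      using that two_sidedD(1-3)[OF I] by (auto simp: T_def)
    show "(case T (u, v, w) of (u', v', w') \<Rightarrow> u' + z * v' + z * z * w') - z' * (u + z * v + z * z * w) \<in> ?I"
      for u v w
      using two_sidedD(1)[OF I] by (simp add: T_def)
  next
    fix \<rho> :: "(xy, 'k) free_poly \<Rightarrow> _" and r v
    assume mult: "\<And>p q v. \<rho> (p * q) v = \<rho> p (\<rho> q v)" and c: "\<And>c v. \<rho> (const c) v = scale3 c v"
      and z: "\<And>v. \<rho> z v = shift3 v" and z': "\<And>v. \<rho> z' v = T v" and r: "r \<in> ?R"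
    have "scale3 \<alpha> (shift3 (shift3 (shift3 v))) \<in> ?I \<times> ?I \<times> ?I"
      using two_sidedD(1)[OF I] by (simp add: shift3_def scale3_def)
    moreover have "scale3 \<beta> (T (T (T v))) \<in> ?I \<times> ?I \<times> ?I"
      using two_sidedD(1)[OF I] two_sidedD(4)[OF I R(2)]
      by (simp add: T_def scale3_def mult.assoc)
    ultimately show "\<rho> r v \<in> ?I \<times> ?I \<times> ?I" using r by (auto simp: mult c z z')
  qed
qed

text \<open>The second relation rewrites z' z z as - z z' z - z z z'. Applied to z' (u + z v + z^2
  w), this moves the last summand into the components at z and z^2, which is the formula for
  \<open>T\<close>.\<close>

lemma tangent_cube_not_calabi_yau:
  fixes z z' :: "(xy, 'k::field) free_poly"
  assumes basis: "z = const p * gen X + const q * gen Y" "z' = const r * gen X + const s * gen Y"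
      "p * s - q * r \<noteq> 0"
  shows "\<not> calabi_yau 3 (presented_alg (\<lambda>_. 1) {z * z * z, cubic z z' (Suc 0)})"
proof -
  let ?R = "{z * z * z, cubic z z' (Suc 0)}"
  let ?I = "rel_ideal ?R"
  define T where "T v = (z' * fst v + z' * (z * fst (snd v)), - (z' * (z * snd (snd v))), - (z' * snd (snd v)))" for v
  have I: "two_sided ?I" by (rule two_sided_rel_ideal)
  have R: "z * z * z \<in> ?I" "cubic z z' (Suc 0) \<in> ?I" using rel_ideal_superset by blast+
  show ?thesis
  proof (rule not_calabi_yau_of_lift[OF basis, where T = T])
    show "z * z * z \<in> ?I" by (rule R)
    fix r assume "r \<in> ?R"
    then show "free_hom (\<lambda>_. 0) r = (0 :: (xy, 'k) free_poly)"
      by (auto simp: basis free_hom_simps)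
  next
    show "T (v + v') = T v + T v'" for v v' by (simp add: T_def algebra_simps)
    show "T (scale3 c v) = scale3 c (T v)" for c v
      by (simp add: T_def scale3_def distrib_left mult.assoc const_left_commute[of z] const_left_commute[of z'])
    show "T v \<in> ?I \<times> ?I \<times> ?I" if "v \<in> ?I \<times> ?I \<times> ?I" for v
      using that two_sidedD(1-3,5)[OF I] by (auto simp: T_def)
    show "(case T (u, v, w) of (u', v', w') \<Rightarrow> u' + z * v' + z * z * w') - z' * (u + z * v + z * z * w) \<in> ?I"
      for u v w
    proof -
      have "(case T (u, v, w) of (u', v', w') \<Rightarrow> u' + z * v' + z * z * w') - z' * (u + z * v + z * z * w)
          = - (cubic z z' (Suc 0) * w)"
        by (simp add: T_def algebra_simps)
      then show ?thesis using two_sidedD(4,5)[OF I] R(2) by metis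
    qed
  next
    fix \<rho> :: "(xy, 'k) free_poly \<Rightarrow> _" and r v
    assume add: "\<And>p q v. \<rho> (p + q) v = \<rho> p v + \<rho> q v" and mult: "\<And>p q v. \<rho> (p * q) v = \<rho> p (\<rho> q v)"
      and z: "\<And>v. \<rho> z v = shift3 v" and z': "\<And>v. \<rho> z' v = T v" and r: "r \<in> ?R"
    have "shift3 (shift3 (shift3 v)) \<in> ?I \<times> ?I \<times> ?I"
      using two_sidedD(1)[OF I] by (simp add: shift3_def)
    \<comment> \<open>The mixed relation acts on triples as zero exactly, not merely modulo the
      ideal.\<close>
    moreover have "shift3 (shift3 (T v)) + shift3 (T (shift3 v)) + T (shift3 (shift3 v)) = 0"
      by (simp add: shift3_def T_def zero_prod_def)
    ultimately show "\<rho> r v \<in> ?I \<times> ?I \<times> ?I"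
      using r two_sidedD(1)[OF I] by (auto simp: add mult z z' zero_prod_def)
  qed
qed

section \<open>Normal forms of quartics with vanishing catalecticant\<close>

lemma rel_ideal_base_change:
  assumes "p * s - q * r \<noteq> 0"
  shows "rel_ideal {const p * u + const q * v, const r * u + const s * v} = rel_ideal {u, v}"
proof (rule rel_ideal_eqI)
  let ?u = "const p * u + const q * v" and ?v = "const r * u + const s * v"
  have J: "two_sided (rel_ideal R)" for R :: "('g, 'k::field) free_poly set" by (rule two_sided_rel_ideal)
  show "{?u, ?v} \<subseteq> rel_ideal {u, v}"
    using rel_ideal_superset[of "{u, v}"] two_sidedD(2,3)[OF J[of "{u, v}"]] by auto
  define D where "D = inverse (p * s - q * r)"
  have "D * (p * s - q * r) = 1" using assms by (simp add: D_def)
  then have D: "D * s * p + - D * q * r = 1" "D * s * q + - D * q * s = 0"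
      "- D * r * p + D * p * r = 0" "- D * r * q + D * p * s = 1"
    by (simp_all add: algebra_simps)
  have comb: "const c * ?u + const d * ?v = const (c * p + d * r) * u + const (c * q + d * s) * v" for c d
    by (simp only: distrib_left const_add distrib_right const_mult mult.assoc add_ac)
  have mem: "const c * ?u + const d * ?v \<in> rel_ideal {?u, ?v}" for c d
    by (rule two_sidedD(2)[OF J]; rule two_sidedD(3)[OF J]; rule subsetD[OF rel_ideal_superset]; simp)
  have "u \<in> rel_ideal {?u, ?v}" "v \<in> rel_ideal {?u, ?v}"
    using mem[of "D * s" "- D * q"] mem[of "- D * r" "D * p"] unfolding comb D by simp_all
  then show "{u, v} \<subseteq> rel_ideal {?u, ?v}" by blast
qed

lemma deriv_poly_linear:
  assumes "\<And>i. i < 4 \<Longrightarrow> a i = \<alpha> * b i + \<beta> * c i"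
  shows "deriv_poly a = const \<alpha> * deriv_poly b + const \<beta> * deriv_poly c"
proof -
  have "deriv_poly a = (\<Sum>i<4. const (\<alpha> * b i + \<beta> * c i) * cubic (gen X) (gen Y) i)"
    unfolding deriv_poly_def by (rule sum.cong) (simp_all add: assms)
  then show ?thesis
    by (simp add: deriv_poly_def const_add const_mult distrib_right mult.assoc sum.distrib sum_distrib_left)
qed

text \<open>A geometric coefficient sequence gives the cube of the linear form x + t y. The second
  identity is the derivative of the first with respect to t.\<close>

lemma deriv_poly_power:
  fixes t :: "'k::field"
  defines "z \<equiv> gen X + const t * gen Y"
  shows "deriv_poly (\<lambda>i. t ^ i) = z * z * z"
    and "deriv_poly (\<lambda>i. of_nat i * t ^ (i - 1)) = cubic z (gen Y) (Suc 0)"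
  unfolding deriv_poly_def z_def sum_lessThan_4 cubic_simps
  by (simp_all add: distrib_left distrib_right mult.assoc
    const_left_commute[of "gen X"] const_left_commute[of "gen Y"] const_mult const_2_mult const_3_mult
    power2_eq_square power3_eq_cube add_ac)

text \<open>The counterparts for an infinite root, where the linear form is y.\<close>

lemma deriv_poly_unit:
  "deriv_poly (\<lambda>i. if i = 3 then 1 else 0) = gen Y * gen Y * gen Y"
  "deriv_poly (\<lambda>i. if i = 2 then 1 else 0) = cubic (gen Y) (gen X) (Suc 0)"
  by (simp_all add: deriv_poly_def sum_lessThan_4 add_ac)

text \<open>A nonzero column of the adjugate lies in the kernel of a singular matrix. The first and
  third columns are tried; if both vanish, the remaining equations force (-a_1, a_0, 0) or, when a_0
  = 0, the vector (1, 0, 0) into the kernel.\<close>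

lemma Hankel_kernel:
  assumes "catalecticant a = 0"
  obtains c\<^sub>0 c\<^sub>1 c\<^sub>2 :: "'k::field" where "c\<^sub>0 \<noteq> 0 \<or> c\<^sub>1 \<noteq> 0 \<or> c\<^sub>2 \<noteq> 0"
    "\<And>i. i \<le> 2 \<Longrightarrow> c\<^sub>0 * a i + c\<^sub>1 * a (Suc i) + c\<^sub>2 * a (Suc (Suc i)) = 0"
proof -
  have *: thesis if "c\<^sub>0 \<noteq> 0 \<or> c\<^sub>1 \<noteq> 0 \<or> c\<^sub>2 \<noteq> 0" "c\<^sub>0 * a 0 + c\<^sub>1 * a 1 + c\<^sub>2 * a 2 = 0"
    "c\<^sub>0 * a 1 + c\<^sub>1 * a 2 + c\<^sub>2 * a 3 = 0" "c\<^sub>0 * a 2 + c\<^sub>1 * a 3 + c\<^sub>2 * a 4 = 0" for c\<^sub>0 c\<^sub>1 c\<^sub>2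
  proof (rule \<open>\<And>c\<^sub>0 c\<^sub>1 c\<^sub>2. c\<^sub>0 \<noteq> 0 \<or> c\<^sub>1 \<noteq> 0 \<or> c\<^sub>2 \<noteq> 0 \<Longrightarrow>
      (\<And>i. i \<le> 2 \<Longrightarrow> c\<^sub>0 * a i + c\<^sub>1 * a (Suc i) + c\<^sub>2 * a (Suc (Suc i)) = 0) \<Longrightarrow> thesis\<close>)
    fix i :: nat assume "i \<le> 2"
    then have "i = 0 \<or> i = 1 \<or> i = 2" by auto
    then show "c\<^sub>0 * a i + c\<^sub>1 * a (Suc i) + c\<^sub>2 * a (Suc (Suc i)) = 0"
      using that by (auto simp: eval_nat_numeral)
  qed (rule that(1))
  \<comment> \<open>The 2 by 2 minors; \<open>det\<close> is the vanishing determinant expanded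
    along the first row.\<close>
  define m where "m i j k l = a i * a j - a k * a l" for i j k l :: nat
  have det: "a 0 * m 2 4 3 3 + a 1 * m 2 3 1 4 + a 2 * m 1 3 2 2 = 0"
    using assms by (simp add: catalecticant_def m_def algebra_simps)
  show thesis
  proof (cases "m 2 4 3 3 = 0 \<and> m 2 3 1 4 = 0 \<and> m 1 3 2 2 = 0 \<and> m 1 2 0 3 = 0 \<and> m 0 2 1 1 = 0")
    case False
    then consider "m 2 4 3 3 \<noteq> 0 \<or> m 2 3 1 4 \<noteq> 0 \<or> m 1 3 2 2 \<noteq> 0"
      | "m 1 3 2 2 \<noteq> 0 \<or> m 1 2 0 3 \<noteq> 0 \<or> m 0 2 1 1 \<noteq> 0" by blast
    then show thesis
    proof cases
      case 1
      then show thesis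
        by (rule *) (use det in \<open>simp_all add: m_def algebra_simps\<close>)
    next
      case 2
      then show thesis
        by (rule *) (use det in \<open>simp_all add: m_def algebra_simps\<close>)
    qed
  next
    case True
    show thesis
    proof (cases "a 0 = 0")
      case False
      then have "- a 1 \<noteq> 0 \<or> a 0 \<noteq> 0 \<or> (0::'k) \<noteq> 0" by blast
      then show thesis by (rule *) (use True in \<open>simp_all add: m_def algebra_simps\<close>)
    next
      case a0: True
      have a1: "a 1 = 0" using True a0 by (simp add: m_def)
      have a2: "a 2 = 0" using True a1 by (simp add: m_def)
      show thesis by (rule *[of 1 0 0]) (use a0 a1 a2 in simp_all)
    qed
  qed
qed

text \<open>A kernel vector of the Hankel matrix is a recurrence for the coefficients with
  characteristic polynomial c_0 + c_1 t + c_2 t^2. A finite root t contributes the form x + t y, and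
  each drop of the degree contributes an infinite root with the form y.\<close>

lemma zero_catalecticant_not_calabi_yau:
  fixes a :: "nat \<Rightarrow> 'k::alg_closed_field"
  assumes cat: "catalecticant a = 0" and nz: "i\<^sub>0 \<le> 4" "a i\<^sub>0 \<noteq> 0"
  shows "\<not> calabi_yau 3 (presented_alg (\<lambda>_. 1) {deriv_poly a, deriv_poly (\<lambda>i. a (Suc i))})"
proof -
  let ?x = "gen X :: (xy, 'k) free_poly" and ?y = "gen Y :: (xy, 'k) free_poly"
  let ?R = "{deriv_poly a, deriv_poly (\<lambda>i. a (Suc i))}"
  define lin where "lin t = ?x + const t * ?y" for t
  have lin: "lin t = const 1 * ?x + const t * ?y" "?x = const 1 * ?x + const 0 * ?y"
    "?y = const 0 * ?x + const 1 * ?y" for t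
    by (simp_all add: lin_def)
  have cc: "const (c * d) * p = const d * (const c * p)" for c d and p :: "(xy, 'k) free_poly"
    by (simp only: mult.commute[of c d] const_mult mult.assoc)
  have change: ?thesis
    if "deriv_poly a = const p * u + const q * v" "deriv_poly (\<lambda>i. a (Suc i)) = const r * u + const s * v"
      "p * s - q * r \<noteq> 0" "\<not> calabi_yau 3 (presented_alg (\<lambda>_. 1) {u, v})" for p q r s u v
    using presented_alg_cong[OF rel_ideal_base_change[OF that(3), of u v], of "\<lambda>_. 1"] that(4)
    unfolding that(1,2) by simp
  obtain c\<^sub>0 c\<^sub>1 c\<^sub>2 where c: "c\<^sub>0 \<noteq> 0 \<or> c\<^sub>1 \<noteq> 0 \<or> c\<^sub>2 \<noteq> 0"
    and rec: "\<And>i. i \<le> 2 \<Longrightarrow> c\<^sub>0 * a i + c\<^sub>1 * a (Suc i) + c\<^sub>2 * a (Suc (Suc i)) = 0"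
    by (rule Hankel_kernel[OF cat]) blast
  \<comment> \<open>\<open>two_cubes_not_calabi_yau\<close> requires the first coefficient to be
    nonzero; here either one may be, by exchanging the roles of the forms.\<close>
  have two_cubes: "\<not> calabi_yau 3 (presented_alg (\<lambda>_. 1)
      {const \<alpha> * (z * z * z), const \<beta> * (z' * z' * z')})"
    if "z = const p * ?x + const q * ?y" "z' = const r * ?x + const s * ?y" "p * s - q * r \<noteq> 0"
      "\<alpha> \<noteq> 0 \<or> \<beta> \<noteq> 0" for z z' p q r s \<alpha> \<beta>
  proof (cases "\<alpha> = 0")
    case False
    then show ?thesis by (rule two_cubes_not_calabi_yau[OF that(1-3)])
  next
    case True
    then have "\<beta> \<noteq> 0" using that(4) by simp
    moreover have "r * q - s * p \<noteq> 0" using that(3) by (simp add: algebra_simps)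
    ultimately have "\<not> calabi_yau 3 (presented_alg (\<lambda>_. 1)
        {const \<beta> * (z' * z' * z'), const \<alpha> * (z * z * z)})"
      by (intro two_cubes_not_calabi_yau[OF that(2,1)])
    then show ?thesis by (simp add: insert_commute)
  qed
  have i5: "i = 0 \<or> i = 1 \<or> i = 2 \<or> i = 3 \<or> i = 4" if "i \<le> 4" for i :: nat using that by auto
  have zero_at: False if "\<And>i. i \<le> 4 \<Longrightarrow> a i = 0" using that nz by blast
  have rec': "c\<^sub>0 * a 0 + c\<^sub>1 * a 1 + c\<^sub>2 * a 2 = 0" "c\<^sub>0 * a 1 + c\<^sub>1 * a 2 + c\<^sub>2 * a 3 = 0"
    "c\<^sub>0 * a 2 + c\<^sub>1 * a 3 + c\<^sub>2 * a 4 = 0"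
    using rec[of 0] rec[of 1] rec[of 2] by (simp_all add: eval_nat_numeral)
  show ?thesis
  proof (cases "c\<^sub>2 = 0")
    case c2: False
    obtain t where t: "c\<^sub>0 + c\<^sub>1 * t + c\<^sub>2 * t\<^sup>2 = 0"
    proof -
      have "degree [:c\<^sub>0, c\<^sub>1, c\<^sub>2:] > 0" using c2 by simp
      from alg_closed_imp_poly_has_root[OF this] obtain t where "poly [:c\<^sub>0, c\<^sub>1, c\<^sub>2:] t = 0" by blast
      then show thesis by (intro that[of t]) (simp add: power2_eq_square algebra_simps)
    qed
    \<comment> \<open>The second root, by Vieta.\<close>
    define t' where "t' = - c\<^sub>1 / c\<^sub>2 - t"
    have sum: "c\<^sub>1 = - c\<^sub>2 * (t + t')" using c2 by (simp add: t'_def field_simps)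
    have prod: "c\<^sub>0 = c\<^sub>2 * (t * t')"
      using t unfolding sum by (simp add: power2_eq_square algebra_simps)
    have step: "a (Suc (Suc i)) = (t + t') * a (Suc i) - t * t' * a i" if "i \<le> 2" for i
    proof -
      have "c\<^sub>2 * (a (Suc (Suc i)) - ((t + t') * a (Suc i) - t * t' * a i)) = 0"
        using rec[OF that] unfolding sum prod by (simp add: algebra_simps)
      then show ?thesis using c2 by simp
    qed
    note steps = step[of 0, simplified] step[of 1, simplified] step[of 2, simplified]
    show ?thesis
    proof (cases "t = t'")
      case False
      define \<beta> where "\<beta> = (a 1 - t * a 0) / (t' - t)"
      define \<alpha> where "\<alpha> = a 0 - \<beta>"
      have "\<beta> * (t' - t) = a 1 - t * a 0" using False by (simp add: \<beta>_def)
      then have a1: "a 1 = \<alpha> * t + \<beta> * t'" by (simp add: \<alpha>_def algebra_simps)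
      have a0: "a 0 = \<alpha> + \<beta>" by (simp add: \<alpha>_def)
      have a: "a i = \<alpha> * t ^ i + \<beta> * t' ^ i" if "i \<le> 4" for i
        using i5[OF that] steps a0 a1 by (auto simp: eval_nat_numeral algebra_simps)
      have "\<alpha> \<noteq> 0 \<or> \<beta> \<noteq> 0" using zero_at a by fastforce
      then have "\<not> calabi_yau 3 (presented_alg (\<lambda>_. 1)
          {const \<alpha> * (lin t * lin t * lin t), const \<beta> * (lin t' * lin t' * lin t')})"
        using False by (intro two_cubes[OF lin(1) lin(1)]) auto
      moreover have "deriv_poly a = const \<alpha> * (lin t * lin t * lin t) + const \<beta> * (lin t' * lin t' * lin t')"
        unfolding lin_def deriv_poly_power(1)[symmetric] using a by (intro deriv_poly_linear) simp
      moreover have "deriv_poly (\<lambda>i. a (Suc i)) =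
          const (\<alpha> * t) * (lin t * lin t * lin t) + const (\<beta> * t') * (lin t' * lin t' * lin t')"
        unfolding lin_def deriv_poly_power(1)[symmetric]
        using a by (intro deriv_poly_linear) (simp add: algebra_simps)
      \<comment> \<open>The scalars stay inside the two generators, so the base change is the
        Vandermonde matrix of t and t', invertible even when one scalar is zero.\<close>
      ultimately show ?thesis
        using False
        by (intro change[of 1 "const \<alpha> * (lin t * lin t * lin t)" 1
              "const \<beta> * (lin t' * lin t' * lin t')" t t'])
          (simp_all add: cc)
    next
      case True
      \<comment> \<open>For a double root the solutions of the recurrence are spanned by
        \<open>t ^ i\<close> and its derivative in t.\<close>
      define \<beta> where "\<beta> = a 1 - t * a 0"
      define \<alpha> where "\<alpha> = a 0"
      have a1: "a 1 = \<alpha> * t + \<beta>" and a0: "a 0 = \<alpha>" by (simp_all add: \<alpha>_def \<beta>_def)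
      have a: "a i = \<alpha> * t ^ i + \<beta> * (of_nat i * t ^ (i - 1))" if "i \<le> 4" for i
        using i5[OF that] steps a0 a1 True by (auto simp: eval_nat_numeral algebra_simps)
      have dp: "deriv_poly a = const \<alpha> * (lin t * lin t * lin t) + const \<beta> * cubic (lin t) ?y (Suc 0)"
        unfolding lin_def deriv_poly_power[symmetric] using a by (intro deriv_poly_linear) simp
      have dp': "deriv_poly (\<lambda>i. a (Suc i)) =
          const (\<alpha> * t + \<beta>) * (lin t * lin t * lin t) + const (t * \<beta>) * cubic (lin t) ?y (Suc 0)"
        unfolding lin_def deriv_poly_power[symmetric]
      proof (rule deriv_poly_linear)
        fix i :: nat assume "i < 4"
        then show "a (Suc i) = (\<alpha> * t + \<beta>) * t ^ i + t * \<beta> * (of_nat i * t ^ (i - 1))"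
          using a[of "Suc i"] by (cases i) (simp_all add: algebra_simps)
      qed
      show ?thesis
      proof (cases "\<beta> = 0")
        case False
        then show ?thesis
          by (intro change[OF dp dp'] tangent_cube_not_calabi_yau[OF lin(1) lin(3)])
            (auto simp: algebra_simps)
      next
        case True
        \<comment> \<open>The quartic is a multiple of the fourth power of \<open>lin t\<close>.
          Both relations are multiples of one cube, and a zero multiple of another cube serves as
          the second generator.\<close>
        then have "\<alpha> \<noteq> 0" using zero_at a by fastforce
        then have "\<not> calabi_yau 3 (presented_alg (\<lambda>_. 1)
            {const \<alpha> * (lin t * lin t * lin t), const 0 * (?y * ?y * ?y)})"
          by (intro two_cubes[OF lin(1) lin(3)]) auto
        then show ?thesis
          using dp dp' True
          by (intro change[of 1 "const \<alpha> * (lin t * lin t * lin t)" 0 "const 0 * (?y * ?y * ?y)" t 1])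
            (simp_all add: cc)
      qed
    qed
  next
    case c2: True
    show ?thesis
    proof (cases "c\<^sub>1 = 0")
      case c1: False
      \<comment> \<open>One root is infinite; this is the finite one.\<close>
      define t where "t = - c\<^sub>0 / c\<^sub>1"
      have c0: "c\<^sub>0 = - c\<^sub>1 * t" using c1 by (simp add: t_def)
      have step: "a (Suc i) = t * a i" if "i \<le> 2" for i
      proof -
        have "c\<^sub>1 * (a (Suc i) - t * a i) = 0"
          using rec[OF that] c2 unfolding c0 by (simp add: algebra_simps)
        then show ?thesis using c1 by simp
      qed
      note steps = step[of 0, simplified] step[of 1, simplified] step[of 2, simplified]
      define \<alpha> where "\<alpha> = a 0"
      \<comment> \<open>The recurrence now has order one and reaches only up to \<open>a 3\<close>,
        so \<open>a 4\<close> is free and its deviation is the coefficient of the fourth power of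
        y.\<close>
      define \<beta> where "\<beta> = a 4 - \<alpha> * t ^ 4"
      have a: "a i = \<alpha> * t ^ i + \<beta> * (if i = 4 then 1 else 0)" if "i \<le> 4" for i
        using i5[OF that] steps by (auto simp: eval_nat_numeral \<alpha>_def \<beta>_def algebra_simps)
      have "\<alpha> \<noteq> 0 \<or> \<beta> \<noteq> 0" using zero_at a by fastforce
      then have "\<not> calabi_yau 3 (presented_alg (\<lambda>_. 1)
          {const \<alpha> * (lin t * lin t * lin t), const \<beta> * (?y * ?y * ?y)})"
        by (intro two_cubes[OF lin(1) lin(3)]) auto
      moreover have "deriv_poly a = const \<alpha> * (lin t * lin t * lin t) + const 0 * (?y * ?y * ?y)"
        unfolding lin_def deriv_poly_power(1)[symmetric] deriv_poly_unit[symmetric]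
        using a by (intro deriv_poly_linear) simp
      moreover have "deriv_poly (\<lambda>i. a (Suc i)) =
          const (\<alpha> * t) * (lin t * lin t * lin t) + const \<beta> * (?y * ?y * ?y)"
        unfolding lin_def deriv_poly_power(1)[symmetric] deriv_poly_unit[symmetric]
        using a by (intro deriv_poly_linear) (simp add: algebra_simps)
      ultimately show ?thesis
        by (intro change[of 1 "const \<alpha> * (lin t * lin t * lin t)" 0 "const \<beta> * (?y * ?y * ?y)" t 1])
          (simp_all add: cc)
    next
      \<comment> \<open>A double infinite root: only \<open>a 3\<close> and \<open>a 4\<close>
        survive, and \<open>a 3\<close> decides between the mixed relation and a single
        cube.\<close>
      case c1: True
      then have c0: "c\<^sub>0 \<noteq> 0" using c c2 by simp
      have a012: "a 0 = 0" "a 1 = 0" "a 2 = 0" using rec' c0 c1 c2 by simp_all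
      have i4: "i = 0 \<or> i = 1 \<or> i = 2 \<or> i = 3" if "i < 4" for i :: nat using that by auto
      have dp: "deriv_poly a = const (a 3) * (?y * ?y * ?y) + const 0 * cubic ?y ?x (Suc 0)"
        unfolding deriv_poly_unit[symmetric]
        by (rule deriv_poly_linear) (use i4 a012 in \<open>fastforce\<close>)
      have dp': "deriv_poly (\<lambda>i. a (Suc i)) = const (a 4) * (?y * ?y * ?y) + const (a 3) * cubic ?y ?x (Suc 0)"
        unfolding deriv_poly_unit[symmetric]
        by (rule deriv_poly_linear) (use i4 a012 in \<open>auto simp: eval_nat_numeral dest!: i4\<close>)
      show ?thesis
      proof (cases "a 3 = 0")
        case False
        then show ?thesis
          by (intro change[OF dp dp'] tangent_cube_not_calabi_yau[OF lin(3) lin(2)]) auto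
      next
        case True
        have "a 4 \<noteq> 0" using zero_at i5 a012 True by metis
        then have "\<not> calabi_yau 3 (presented_alg (\<lambda>_. 1)
            {const (a 4) * (?y * ?y * ?y), const 0 * (?x * ?x * ?x)})"
          by (intro two_cubes[OF lin(3) lin(2)]) auto
        then show ?thesis
          using dp dp' True
          by (intro change[of 0 "const (a 4) * (?y * ?y * ?y)" 1 "const 0 * (?x * ?x * ?x)" 1 0]) simp_all
      qed
    qed
  qed
qed

section \<open>The free algebra of the zero quartic\<close>

lemma rel_ideal_zero: "rel_ideal {0} = {0}"
proof
  show "rel_ideal {0} \<subseteq> {0}" by (rule rel_ideal_minimal) (simp_all add: two_sided_def)
  show "{0} \<subseteq> rel_ideal {0}" by (rule rel_ideal_superset)
qed

text \<open>
  The derivation \<open>D\<close> with \<open>D g\<^sub>0 = 1 \<otimes> 1\<close> that kills the other generators is not inner, because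
  inner derivations take values in the augmentation ideal.
\<close>

lemma free_not_calabi_yau:
  fixes wt :: "'g \<Rightarrow> nat"
  assumes wt: "wt g\<^sub>0 = 1"
  shows "\<not> calabi_yau 3 (presented_alg wt {0 :: ('g, 'k::field) free_poly})"
proof
  let ?S = "presented_alg wt {0 :: ('g, 'k) free_poly}"
    and ?Q = "pres wt {0 :: ('g, 'k) free_poly}"
  assume cy: "calabi_yau 3 ?S"
  then interpret nat_graded_algebra ?S by (rule calabi_yauE)
  interpret enveloping ?S by unfold_locales
  have Q_inj: "?Q p = ?Q q \<longleftrightarrow> p = q" for p q by (simp add: pres_eq_iff rel_ideal_zero)
  have Q: "?Q p \<in> carrier ?S" for p by (simp add: pres_carrier)
  have carrierE: "\<exists>p. s = ?Q p" if "s \<in> carrier ?S" for s using that unfolding pres_carrier by blast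
  have QQ: "a \<otimes>\<^bsub>?S\<^esub> b = ?Q (p * q)" if "a = ?Q p" "b = ?Q q" for a b p q
    unfolding that by (rule pres_mult)
  define W where "W l = ?Q (Poly_Mapping.single (Word l) 1)" for l
  have W: "W l \<in> carrier ?S" for l by (simp add: W_def Q)
  have W_append: "W (l @ l') = W l \<otimes>\<^bsub>?S\<^esub> W l'" for l l'
    by (simp add: W_def pres_mult mult_single plus_word_def)
  have W_Nil: "W [] = \<one>\<^bsub>?S\<^esub>"
  proof -
    have "Poly_Mapping.single (Word []) 1 = (const 1 :: ('g, 'k) free_poly)"
      by (simp only: const_def zero_word_def)
    then show ?thesis by (simp add: W_def pres_one)
  qed
  have W_homog: "W l \<in> homog ?S (int (\<Sum>g\<leftarrow>l. wt g))" for l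
    unfolding W_def pres_homog by (rule imageI) (simp add: homog_free_alg)

  \<comment> \<open>The Leibniz rule for splitting off the first letter, with D g_0 = 1. The values
    are formal pairs because linear extension needs a type with addition, while \<open>T.E\<close>
    is only a record; classes are taken afterwards.\<close>
  define Dw where "Dw = rec_list 0 (\<lambda>g l d. (if g = g\<^sub>0 then Poly_Mapping.single (W l, \<one>\<^bsub>?S\<^esub>) 1 else 0)
    + mult T.PA (Poly_Mapping.single (\<one>\<^bsub>?S\<^esub>, W [g]) (1::'k)) d)"
  have Dw_simps: "Dw [] = 0" "Dw (g # l) = (if g = g\<^sub>0 then Poly_Mapping.single (W l, \<one>\<^bsub>?S\<^esub>) 1 else 0)
    + mult T.PA (Poly_Mapping.single (\<one>\<^bsub>?S\<^esub>, W [g]) 1) (Dw l)" for g l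
    by (simp_all add: Dw_def)
  have single_closed: "Poly_Mapping.single (a, b) c \<in> carrier T.PA"
    if "a \<in> carrier ?S" "b \<in> carrier ?S" for a b c
    using that by (intro T.pair_closed) simp_all
  have Dw_closed: "Dw l \<in> carrier T.PA" for l
    by (induction l)
      (auto simp: Dw_simps intro!: T.pair_closed(1,5) T.mult_closed single_closed W)
  define DE where "DE l = T.cls (Dw l)" for l
  have DE_closed: "DE l \<in> carrier T.E" for l
    unfolding DE_def T.E_carrier using Dw_closed by blast
  have DE_Nil: "DE [] = \<zero>\<^bsub>T.E\<^esub>" by (simp add: DE_def Dw_simps T.E_zero)
  have DE_Cons: "DE (g # l) = (if g = g\<^sub>0 then T.pure 1 (W l) \<one>\<^bsub>?S\<^esub> else \<zero>\<^bsub>T.E\<^esub>)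
      \<oplus>\<^bsub>T.E\<^esub> T.pure 1 \<one>\<^bsub>?S\<^esub> (W [g]) \<otimes>\<^bsub>T.E\<^esub> DE l" for g l
  proof -
    have "(if g = g\<^sub>0 then T.pure 1 (W l) \<one>\<^bsub>?S\<^esub> else \<zero>\<^bsub>T.E\<^esub>) =
        T.cls (if g = g\<^sub>0 then Poly_Mapping.single (W l, \<one>\<^bsub>?S\<^esub>) 1 else 0)"
      by (simp add: T.pure_def T.E_zero)
    moreover have "(if g = g\<^sub>0 then Poly_Mapping.single (W l, \<one>\<^bsub>?S\<^esub>) (1::'k) else 0) \<in> carrier T.PA"
      using single_closed[OF W one_closed] T.pair_closed(5) by simp
    ultimately show ?thesis
      using single_closed[OF one_closed W] Dw_closed T.mult_closed
      by (simp add: DE_def Dw_simps T.pure_def T.E_mult T.E_add)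
  qed
  \<comment> \<open>The Leibniz rule on words. Left and right factors commute in the enveloping
    algebra, which lets the induction on the first word pass.\<close>
  have DE_append: "DE (l @ l') = T.pure 1 \<one>\<^bsub>?S\<^esub> (W l) \<otimes>\<^bsub>T.E\<^esub> DE l' \<oplus>\<^bsub>T.E\<^esub> T.pure 1 (W l') \<one>\<^bsub>?S\<^esub> \<otimes>\<^bsub>T.E\<^esub> DE l"
    for l l'
  proof (induction l)
    case Nil
    then show ?case
      using DE_closed W T.E_one[symmetric] by (simp add: DE_Nil W_Nil T.pure_closed)
  next
    case (Cons g l)
    let ?e = "if g = g\<^sub>0 then T.pure 1 (W l) \<one>\<^bsub>?S\<^esub> else \<zero>\<^bsub>T.E\<^esub>"
    let ?L = "T.pure 1 \<one>\<^bsub>?S\<^esub> (W [g])" and ?R = "T.pure 1 (W l') \<one>\<^bsub>?S\<^esub>" and ?U = "T.pure 1 \<one>\<^bsub>?S\<^esub> (W l)"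
    have c: "?e \<in> carrier T.E" "?L \<in> carrier T.E" "?R \<in> carrier T.E" "?U \<in> carrier T.E"
      using W by (simp_all add: T.pure_closed)
    have e: "(if g = g\<^sub>0 then T.pure 1 (W (l @ l')) \<one>\<^bsub>?S\<^esub> else \<zero>\<^bsub>T.E\<^esub>) = ?R \<otimes>\<^bsub>T.E\<^esub> ?e"
      using W c by (simp add: T.pure_mult W_append)
    have LR: "?L \<otimes>\<^bsub>T.E\<^esub> ?R = ?R \<otimes>\<^bsub>T.E\<^esub> ?L" using W by (simp add: T.pure_mult)
    have U: "T.pure 1 \<one>\<^bsub>?S\<^esub> (W (g # l)) = ?L \<otimes>\<^bsub>T.E\<^esub> ?U"
      using W W_append[of "[g]" l] by (simp add: T.pure_mult)
    have "DE ((g # l) @ l') = ?R \<otimes>\<^bsub>T.E\<^esub> ?e \<oplus>\<^bsub>T.E\<^esub> ?L \<otimes>\<^bsub>T.E\<^esub> (?U \<otimes>\<^bsub>T.E\<^esub> DE l' \<oplus>\<^bsub>T.E\<^esub> ?R \<otimes>\<^bsub>T.E\<^esub> DE l)"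
      using Cons e by (simp add: DE_Cons)
    also have "\<dots> = ?L \<otimes>\<^bsub>T.E\<^esub> ?U \<otimes>\<^bsub>T.E\<^esub> DE l' \<oplus>\<^bsub>T.E\<^esub> (?R \<otimes>\<^bsub>T.E\<^esub> ?e \<oplus>\<^bsub>T.E\<^esub> (?L \<otimes>\<^bsub>T.E\<^esub> ?R) \<otimes>\<^bsub>T.E\<^esub> DE l)"
      using c DE_closed by (simp add: T.E.r_distr T.E.m_assoc T.E.a_ac)
    also have "\<dots> = T.pure 1 \<one>\<^bsub>?S\<^esub> (W (g # l)) \<otimes>\<^bsub>T.E\<^esub> DE l' \<oplus>\<^bsub>T.E\<^esub> ?R \<otimes>\<^bsub>T.E\<^esub> DE (g # l)"
      unfolding LR U using c DE_closed by (simp add: DE_Cons T.E.r_distr T.E.m_assoc)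
    finally show ?case .
  qed
  have DE_homog: "DE l \<in> homog T.E (int (\<Sum>g\<leftarrow>l. wt g) - 1)" for l
  proof (induction l)
    case (Cons g l)
    have "(if g = g\<^sub>0 then T.pure 1 (W l) \<one>\<^bsub>?S\<^esub> else \<zero>\<^bsub>T.E\<^esub>) \<in> homog T.E (int (\<Sum>g\<leftarrow>g # l. wt g) - 1)"
      using T.pure_homog[of "W l" _ "\<one>\<^bsub>?S\<^esub>" 0 1] W_homog[of l] homog_one wt T.E_homog_zero by simp
    moreover have "T.pure 1 \<one>\<^bsub>?S\<^esub> (W [g]) \<otimes>\<^bsub>T.E\<^esub> DE l \<in> homog T.E ((0 + int (wt g)) + (int (\<Sum>g\<leftarrow>l. wt g) - 1))"
      using W_homog[of "[g]"] homog_one Cons by (intro T.E_homog_mult T.pure_homog) simp_all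
    ultimately show ?case by (simp add: DE_Cons T.E_homog_add add_diff_eq)
  qed (simp add: DE_Nil T.E_homog_zero)

  interpret Dlin: coefficient_additive "\<lambda>u c. mult T.PA (Poly_Mapping.single (\<one>\<^bsub>?S\<^esub>, \<one>\<^bsub>?S\<^esub>) c) (Dw (letters u))"
    by unfold_locales (simp_all add: single_add T.mult_add_l)
  define Dp where "Dp = lin_ext (\<lambda>u c. mult T.PA (Poly_Mapping.single (\<one>\<^bsub>?S\<^esub>, \<one>\<^bsub>?S\<^esub>) c) (Dw (letters u)))"
  have Dp_closed: "Dp p \<in> carrier T.PA" for p
  proof (induction p rule: poly_mapping_additive_induct)
    case (single u c)
    then show ?case
      unfolding Dp_def Dlin.lin_ext_single
      by (intro T.mult_closed single_closed one_closed Dw_closed)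
  qed (simp_all add: Dp_def Dlin.lin_ext_add T.pair_closed(1,5))
  define D where "D p = T.cls (Dp p)" for p
  have D_closed: "D p \<in> carrier T.E" for p
    unfolding D_def T.E_carrier using Dp_closed by blast
  have D_add: "D (p + q) = D p \<oplus>\<^bsub>T.E\<^esub> D q" for p q
    unfolding D_def using Dp_closed by (simp add: T.E_add) (simp add: Dp_def Dlin.lin_ext_add)
  have D_zero: "D 0 = \<zero>\<^bsub>T.E\<^esub>" unfolding D_def by (simp add: Dp_def T.E_zero)
  have D_single: "D (Poly_Mapping.single u c) = T.pure c \<one>\<^bsub>?S\<^esub> \<one>\<^bsub>?S\<^esub> \<otimes>\<^bsub>T.E\<^esub> DE (letters u)" for u c
    unfolding D_def DE_def T.pure_def using single_closed[OF one_closed one_closed] Dw_closed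
    by (simp add: Dp_def Dlin.lin_ext_single T.E_mult)
  have D_const: "D (const c * p) = T.pure c \<one>\<^bsub>?S\<^esub> \<one>\<^bsub>?S\<^esub> \<otimes>\<^bsub>T.E\<^esub> D p" for c p
  proof (induction p rule: poly_mapping_additive_induct)
    case (single u d)
    then show ?case
      using DE_closed by (simp add: const_single D_single T.E.m_assoc[symmetric] T.pure_closed T.pure_mult)
  qed (simp_all add: D_zero D_add distrib_left T.E.r_distr T.pure_closed D_closed)
  have pure_Q: "T.pure 1 \<one>\<^bsub>?S\<^esub> (?Q (Poly_Mapping.single u c)) = T.pure c \<one>\<^bsub>?S\<^esub> (W (letters u))"
    "T.pure 1 (?Q (Poly_Mapping.single u c)) \<one>\<^bsub>?S\<^esub> = T.pure c (W (letters u)) \<one>\<^bsub>?S\<^esub>" for u c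
  proof -
    have "?Q (Poly_Mapping.single u c) = c \<odot>\<^bsub>?S\<^esub> W (letters u)"
      by (simp add: W_def pres_smult const_single)
    then show "T.pure 1 \<one>\<^bsub>?S\<^esub> (?Q (Poly_Mapping.single u c)) = T.pure c \<one>\<^bsub>?S\<^esub> (W (letters u))"
      "T.pure 1 (?Q (Poly_Mapping.single u c)) \<one>\<^bsub>?S\<^esub> = T.pure c (W (letters u)) \<one>\<^bsub>?S\<^esub>"
      using T.pure_smult_r[of "\<one>\<^bsub>?S\<^esub>" "W (letters u)" 1 c] T.pure_smult_l[of "W (letters u)" "\<one>\<^bsub>?S\<^esub>" 1 c] W
      by simp_all
  qed
  have D_mult: "D (p * q) = T.pure 1 \<one>\<^bsub>?S\<^esub> (?Q p) \<otimes>\<^bsub>T.E\<^esub> D q \<oplus>\<^bsub>T.E\<^esub> T.pure 1 (?Q q) \<one>\<^bsub>?S\<^esub> \<otimes>\<^bsub>T.E\<^esub> D p" for p q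
  proof (induction p rule: poly_mapping_additive_induct)
    case zero
    then show ?case
      using T.pure_zero_r[of "\<one>\<^bsub>?S\<^esub>" 1]
      by (simp add: D_zero pres_zero[symmetric] D_closed T.pure_closed Q)
  next
    case p: (single u c)
    show ?case
    proof (induction q rule: poly_mapping_additive_induct)
      case zero
      then show ?case
        using T.pure_zero_l[of "\<one>\<^bsub>?S\<^esub>" 1]
        by (simp add: D_zero pres_zero[symmetric] D_closed T.pure_closed Q)
    next
      case (single v d)
      let ?C = "\<lambda>c. T.pure c \<one>\<^bsub>?S\<^esub> \<one>\<^bsub>?S\<^esub>"
      have "D (Poly_Mapping.single u c * Poly_Mapping.single v d) = ?C (c * d) \<otimes>\<^bsub>T.E\<^esub> DE (letters u @ letters v)"
        by (simp add: mult_single D_single plus_word_def)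
      also have "\<dots> = ?C (c * d) \<otimes>\<^bsub>T.E\<^esub> T.pure 1 \<one>\<^bsub>?S\<^esub> (W (letters u)) \<otimes>\<^bsub>T.E\<^esub> DE (letters v)
          \<oplus>\<^bsub>T.E\<^esub> ?C (c * d) \<otimes>\<^bsub>T.E\<^esub> T.pure 1 (W (letters v)) \<one>\<^bsub>?S\<^esub> \<otimes>\<^bsub>T.E\<^esub> DE (letters u)"
        using W DE_closed by (simp add: DE_append T.E.r_distr T.E.m_assoc T.pure_closed)
      also have "?C (c * d) \<otimes>\<^bsub>T.E\<^esub> T.pure 1 \<one>\<^bsub>?S\<^esub> (W (letters u)) = T.pure c \<one>\<^bsub>?S\<^esub> (W (letters u)) \<otimes>\<^bsub>T.E\<^esub> ?C d"
        using W by (simp add: T.pure_mult)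
      also have "?C (c * d) \<otimes>\<^bsub>T.E\<^esub> T.pure 1 (W (letters v)) \<one>\<^bsub>?S\<^esub> = T.pure d (W (letters v)) \<one>\<^bsub>?S\<^esub> \<otimes>\<^bsub>T.E\<^esub> ?C c"
        using W by (simp add: T.pure_mult mult.commute)
      finally show ?case
        unfolding pure_Q D_single using W DE_closed by (simp add: T.E.m_assoc T.pure_closed)
    next
      case (add q q')
      let ?p = "Poly_Mapping.single u c"
      have "T.pure 1 (?Q (q + q')) \<one>\<^bsub>?S\<^esub> = T.pure 1 (?Q q) \<one>\<^bsub>?S\<^esub> \<oplus>\<^bsub>T.E\<^esub> T.pure 1 (?Q q') \<one>\<^bsub>?S\<^esub>"
        using T.pure_add_l[of "?Q q" "?Q q'" "\<one>\<^bsub>?S\<^esub>" 1] Q by (simp add: pres_add)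
      then show ?case
        using add Q D_closed
        by (simp add: D_add distrib_left T.E.r_distr T.E.l_distr T.pure_closed T.E.a_ac)
    qed
  next
    case (add p p')
    have "T.pure 1 \<one>\<^bsub>?S\<^esub> (?Q (p + p')) = T.pure 1 \<one>\<^bsub>?S\<^esub> (?Q p) \<oplus>\<^bsub>T.E\<^esub> T.pure 1 \<one>\<^bsub>?S\<^esub> (?Q p')"
      using T.pure_add_r[of "\<one>\<^bsub>?S\<^esub>" "?Q p" "?Q p'" 1] Q by (simp add: pres_add)
    then show ?case
      using add Q D_closed
      by (simp add: D_add distrib_right T.E.r_distr T.E.l_distr T.pure_closed T.E.a_ac)
  qed
  have D_homog: "D p \<in> homog T.E (n - 1)" if p: "p \<in> homog (free_alg wt) n" for p n
  proof (induction p rule: poly_mapping_additive_induct)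
    case (single u c)
    then have n: "int (\<Sum>g\<leftarrow>letters u. wt g) = n" using p by (simp add: homog_free_alg)
    have "T.pure c \<one>\<^bsub>?S\<^esub> \<one>\<^bsub>?S\<^esub> \<otimes>\<^bsub>T.E\<^esub> DE (letters u) \<in> homog T.E ((0 + 0) + (n - 1))"
      using DE_homog[of "letters u"] homog_one unfolding n by (intro T.E_homog_mult T.pure_homog) simp_all
    then show ?case by (simp add: D_single)
  qed (simp_all add: D_zero D_add T.E_homog_zero T.E_homog_add)

  \<comment> \<open>The representative is unique because the ideal of relations is zero.\<close>
  define DS where "DS s = D (THE p. ?Q p = s)" for s
  have DS: "DS (?Q p) = D p" for p
  proof -
    have "(THE q. ?Q q = ?Q p) = p" by (rule the_equality) (simp_all add: Q_inj)
    then show ?thesis by (simp add: DS_def)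
  qed
  \<comment> \<open>The augmentation from S to the field, with the field realised as the constants
    of the free algebra.\<close>
  define aug where "aug s = (free_hom (\<lambda>_. 0) (THE p. ?Q p = s) :: ('g, 'k) free_poly)" for s
  have aug: "aug (?Q p) = free_hom (\<lambda>_. 0) p" for p
  proof -
    have "(THE q. ?Q q = ?Q p) = p" by (rule the_equality) (simp_all add: Q_inj)
    then show ?thesis by (simp add: aug_def)
  qed
  have aug_add: "aug (a \<oplus>\<^bsub>?S\<^esub> b) = aug a + aug b" and aug_mult: "aug (a \<otimes>\<^bsub>?S\<^esub> b) = aug a * aug b"
    and aug_smult: "aug (c \<odot>\<^bsub>?S\<^esub> a) = const c * aug a"
    if "a \<in> carrier ?S" "b \<in> carrier ?S" for a b c
    using carrierE[OF that(1)] carrierE[OF that(2)]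
    by (auto simp: pres_add pres_mult pres_smult aug free_hom_simps)
  let ?G = "free_alg wt :: ('k, ('g, 'k) free_poly) graded"
  interpret G: ring ?G by (rule free_alg_ring)
  interpret M: tensor_map "op_alg ?S" ?S ?G "\<lambda>c a b. const c * (aug a * aug b)"
  proof unfold_locales
    fix a b :: "('g, 'k) free_poly set" and c d :: 'k
    assume "a \<in> carrier (op_alg ?S)" and b: "b \<in> carrier ?S"
    then have a: "a \<in> carrier ?S" by simp
    show "const c * (aug (d \<odot>\<^bsub>op_alg ?S\<^esub> a) * aug b) = const (c * d) * (aug a * aug b)"
      using aug_smult[OF a b] by (simp add: const_mult mult.assoc)
    show "const c * (aug a * aug (d \<odot>\<^bsub>?S\<^esub> b)) = const (c * d) * (aug a * aug b)"
      using aug_smult[OF b a] const_left_commute[of "aug a"] by (simp add: const_mult mult.assoc)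
  qed (simp_all add: const_add aug_add distrib_left distrib_right)
  let ?x = "?Q (gen g\<^sub>0)"
  have aug_x: "aug ?x = 0" by (simp add: aug)
  have L: "T.pure 1 \<one>\<^bsub>?S\<^esub> ?x \<in> carrier T.E" and R: "T.pure 1 ?x \<one>\<^bsub>?S\<^esub> \<in> carrier T.E"
    using Q by (simp_all add: T.pure_closed)
  have ext_L: "M.ext (T.pure 1 \<one>\<^bsub>?S\<^esub> ?x \<otimes>\<^bsub>T.E\<^esub> v) = 0" if "v \<in> carrier T.E" for v
    using that
  proof (induction v rule: T.E_induct)
    case (pure a b c)
    then show ?case using Q by (simp add: T.pure_mult M.ext_pure aug_mult aug_x)
  qed (simp add: L T.E.r_distr M.ext_add)
  have ext_R: "M.ext (T.pure 1 ?x \<one>\<^bsub>?S\<^esub> \<otimes>\<^bsub>T.E\<^esub> v) = 0" if "v \<in> carrier T.E" for v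
    using that
  proof (induction v rule: T.E_induct)
    case (pure a b c)
    then show ?case using Q by (simp add: T.pure_mult M.ext_pure aug_mult aug_x)
  qed (simp add: R T.E.r_distr M.ext_add)
  \<comment> \<open>The tensor square of the augmentation vanishes on all multiples of
    \<open>pure 1 \<one> x\<close> and \<open>pure 1 x \<one>\<close>, where x is the class of g_0,
    yet it sends 1 to 1.\<close>
  have outer: "(T.pure 1 \<one>\<^bsub>?S\<^esub> ?x \<ominus>\<^bsub>T.E\<^esub> T.pure 1 ?x \<one>\<^bsub>?S\<^esub>) \<otimes>\<^bsub>T.E\<^esub> v \<noteq> \<one>\<^bsub>T.E\<^esub>"
    if v: "v \<in> carrier T.E" for v
  proof
    assume eq: "(T.pure 1 \<one>\<^bsub>?S\<^esub> ?x \<ominus>\<^bsub>T.E\<^esub> T.pure 1 ?x \<one>\<^bsub>?S\<^esub>) \<otimes>\<^bsub>T.E\<^esub> v = \<one>\<^bsub>T.E\<^esub>"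
    have "T.pure 1 \<one>\<^bsub>?S\<^esub> ?x \<otimes>\<^bsub>T.E\<^esub> v =
        (T.pure 1 \<one>\<^bsub>?S\<^esub> ?x \<ominus>\<^bsub>T.E\<^esub> T.pure 1 ?x \<one>\<^bsub>?S\<^esub>) \<otimes>\<^bsub>T.E\<^esub> v \<oplus>\<^bsub>T.E\<^esub> T.pure 1 ?x \<one>\<^bsub>?S\<^esub> \<otimes>\<^bsub>T.E\<^esub> v"
      using L R v by algebra
    then have "M.ext (T.pure 1 \<one>\<^bsub>?S\<^esub> ?x \<otimes>\<^bsub>T.E\<^esub> v) = M.ext \<one>\<^bsub>T.E\<^esub> + M.ext (T.pure 1 ?x \<one>\<^bsub>?S\<^esub> \<otimes>\<^bsub>T.E\<^esub> v)"
      unfolding eq using M.ext_add[of "\<one>\<^bsub>T.E\<^esub>" "T.pure 1 ?x \<one>\<^bsub>?S\<^esub> \<otimes>\<^bsub>T.E\<^esub> v"] R v by simp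
    then have "M.ext \<one>\<^bsub>T.E\<^esub> = 0" using ext_L[OF v] ext_R[OF v] by simp
    moreover have "M.ext \<one>\<^bsub>T.E\<^esub> = 1"
      unfolding T.E_one using M.ext_pure[of "\<one>\<^bsub>?S\<^esub>" "\<one>\<^bsub>?S\<^esub>" 1] by (simp add: pres_one aug Q)
    ultimately show False by simp
  qed
  have no: "carrier (graded_Ext (env_alg ?S) P \<delta> 1) \<noteq> {\<zero>\<^bsub>graded_Ext (env_alg ?S) P \<delta> 1\<^esub>}"
    if "finite_fg_projective_resolution (env_alg ?S) (env_left ?S) P \<delta> \<epsilon>" for P \<delta> \<epsilon>
  proof (rule outer_derivation_Ext[where D = DS and x = ?x, OF _ _ _ _ _ Q _ outer that])
    fix s assume "s \<in> carrier ?S"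
    then obtain p where s: "s = ?Q p" using carrierE by blast
    show "DS s \<in> carrier T.E" unfolding s DS by (rule D_closed)
    show "DS (c \<odot>\<^bsub>?S\<^esub> s) = T.pure c \<one>\<^bsub>?S\<^esub> \<one>\<^bsub>?S\<^esub> \<otimes>\<^bsub>T.E\<^esub> DS s" for c
      unfolding s pres_smult DS by (rule D_const)
    fix t assume "t \<in> carrier ?S"
    then obtain q where t: "t = ?Q q" using carrierE by blast
    show "DS (s \<oplus>\<^bsub>?S\<^esub> t) = DS s \<oplus>\<^bsub>T.E\<^esub> DS t" unfolding s t pres_add DS by (rule D_add)
    show "DS (s \<otimes>\<^bsub>?S\<^esub> t) = T.pure 1 \<one>\<^bsub>?S\<^esub> s \<otimes>\<^bsub>T.E\<^esub> DS t \<oplus>\<^bsub>T.E\<^esub> T.pure 1 t \<one>\<^bsub>?S\<^esub> \<otimes>\<^bsub>T.E\<^esub> DS s"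
      unfolding s t pres_mult DS by (rule D_mult)
  next
    fix s n assume "s \<in> homog ?S n"
    then obtain p where "p \<in> homog (free_alg wt) n" "s = ?Q p" unfolding pres_homog by blast
    then show "DS s \<in> homog T.E (n - 1)" by (simp add: DS D_homog)
  next
    have "DE [g\<^sub>0] = \<one>\<^bsub>T.E\<^esub>" using W by (simp add: DE_Cons DE_Nil W_Nil T.pure_closed T.E_one)
    then show "DS ?x = \<one>\<^bsub>T.E\<^esub>"
      unfolding DS gen_def D_single using T.E_one[symmetric] by simp
  qed
  show False
    by (rule calabi_yauE[OF cy]) (use no in force)
qed

theorem theorem5p3:
  fixes w :: "(xy, 'k::{alg_closed_field, field_char_0}) free_poly"
  assumes "w \<in> Sym 4"
    and "calabi_yau 3 (jacobian_alg w)"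
  shows "\<exists>M\<^sub>1 M\<^sub>2 :: 'k^2^2.
    graded_alg_iso (jacobian_alg w) (A_alg (\<lambda>l :: 2. if l = 1 then M\<^sub>1 else M\<^sub>2))"
proof -
  obtain a where a: "cyclic_deriv X w = deriv_poly a" "cyclic_deriv Y w = deriv_poly (\<lambda>i. a (Suc i))"
    by (rule Sym4_cyclic_deriv[OF assms(1)])
  have J: "jacobian_alg w = presented_alg (\<lambda>_. 1) {deriv_poly a, deriv_poly (\<lambda>i. a (Suc i))}"
    by (simp add: jacobian_alg_def a)
  have "\<exists>i\<le>4. a i \<noteq> 0"
  proof (rule ccontr)
    assume "\<not> ?thesis"
    then have "deriv_poly a = 0" "deriv_poly (\<lambda>i. a (Suc i)) = 0"
      by (simp_all add: deriv_poly_def)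
    then have "calabi_yau 3 (presented_alg (\<lambda>_ :: xy. 1) {0 :: (xy, 'k) free_poly})"
      using assms(2) unfolding J by simp
    with free_not_calabi_yau[of "\<lambda>_. 1" X, OF refl] show False by (rule notE)
  qed
  then have "catalecticant a \<noteq> 0"
    using zero_catalecticant_not_calabi_yau assms(2) unfolding J by blast
  then show ?thesis unfolding J by (rule nonzero_catalecticant_iso)
qed

end
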